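(* Let $H$ be a quasi-Hopf algebra over a field $k$ with bijective antipode, let $R:{}_H\mathcal M\to{}^H_H\mathcal{YD}$ be the right adjoint of the forgetful functor described in the context, with its induced monoidal structure, and let $\mathbf A:=R(k)$, an algebra in ${}^H_H\mathcal{YD}$ as the image of the trivial algebra $k$ under a monoidal functor; identify $\mathbf A=H\otimes k=H$ as a vector space. Then the action $\triangleright$, the coaction $\delta^{1st}_{\mathbf A}$ of the first kind, the coaction $\delta^{2nd}_{\mathbf A}$ of the second kind, the multiplication $\star$ and the unit $1_{\mathbf A}$ of $\mathbf A\in{}^H_H\mathcal{YD}$ are given respectively by $$h\triangleright a=h_{(1)}aS(h_{(2)}),$$ $$\delta^{1st}_{\mathbf A}(a)=\phi_1\phi'_{1(1)}a_{(1)}\overline{\mathbf f}_1S\bigl(q^R_2\phi'_{2(2)}\bigr)\phi'_3\otimes\phi_2\phi'_{1(2)}a_{(2)}\overline{\mathbf f}_2S\bigl(\phi_3q^R_1\phi'_{2(1)}\bigr),$$ $$\delta^{2nd}_{\mathbf A}(a)=\phi_1\overline\phi_{1(1)}a_{(1)}\overline{\mathbf f}_1S(\overline\phi_3)\otimes\phi_2\overline\phi_{1(2)}a_{(2)}\overline{\mathbf f}_2S(\phi_3\overline\phi_2),$$ $$a\star b=\phi_1aS(\overline\phi_1\phi_2)\alpha\overline\phi_2\phi_{3(1)}bS(\overline\phi_3\phi_{3(2)}),\qquad 1_{\mathbf A}=\beta$$ for $a,b\in\mathbf A$ and $h\in H$, where $\phi'$ is a copy of $\phi$.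
   Context: Conventions. $k$ is a field, $\otimes=\otimes_k$. For a $k$-algebra $A$, $x\in A^{\otimes n}$ is written $x=x_1\otimes\cdots\otimes x_n$ (summation understood), $x^{-1}=\overline x_1\otimes\cdots\otimes\overline x_n$ if invertible; primes denote independent copies. A quasi-Hopf algebra is $(H,\Delta,\epsilon,\phi,S,\alpha,\beta)$ with $H$ a $k$-algebra, algebra maps $\Delta:H\to H\otimes H$ ($\Delta(h)=h_{(1)}\otimes h_{(2)}$), $\epsilon:H\to k$, an invertible $\phi\in H^{\otimes3}$, an anti-algebra map $S$ and $\alpha,\beta\in H$ such that for all $h$: $h_{(1)}\otimes\Delta(h_{(2)})=\phi(\Delta(h_{(1)})\otimes h_{(2)})\phi^{-1}$; $\epsilon(h_{(1)})h_{(2)}=h=h_{(1)}\epsilon(h_{(2)})$; $(\mathrm{id}\otimes\mathrm{id}\otimes\Delta)(\phi)(\Delta\otimes\mathrm{id}\otimes\mathrm{id})(\phi)=(1\otimes\phi)(\mathrm{id}\otimes\Delta\otimes\mathrm{id})(\phi)(\phi\otimes1)$; $(\mathrm{id}\otimes\epsilon\otimes\mathrm{id})(\phi)=1\otimes1$; $S(h_{(1)})\alpha h_{(2)}=\epsilon(h)\alpha$, $h_{(1)}\beta S(h_{(2)})=\epsilon(h)\beta$; $\phi_1\beta S(\phi_2)\alpha\phi_3=1=S(\overline\phi_1)\alpha\overline\phi_2\beta S(\overline\phi_3)$; and (standing) $\epsilon(\alpha)=\epsilon(\beta)=1$. $\overline S=S^{-1}$. $\Delta(h_{(1)})\otimes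 h_{(2)}=h_{(1,1)}\otimes h_{(1,2)}\otimes h_{(2)}$; $\Delta^{\mathrm{cop}}(h)=h_{(2)}\otimes h_{(1)}$. ${}_H\mathcal M$ is monoidal: $h(v\otimes w)=h_{(1)}v\otimes h_{(2)}w$, unit $k$ via $\epsilon$, associator $(x\otimes y)\otimes z\mapsto\phi_1x\otimes(\phi_2y\otimes\phi_3z)$. Elements: $p^R=\overline\phi_1\otimes\overline\phi_2\beta S(\overline\phi_3)$, $q^R=\phi_1\otimes\overline S(\alpha\phi_3)\phi_2$; $\mathbf a=S(\overline\phi_1\phi_2)\alpha\overline\phi_2\phi_{3(1)}\otimes S(\phi_1)\alpha\overline\phi_3\phi_{3(2)}$; $\mathbf f=(S\otimes S)(\Delta^{\mathrm{cop}}(p^R_1))\cdot\mathbf a\cdot\Delta(p^R_2)$ (invertible); $\chi=(\phi\otimes1)(\Delta\otimes\mathrm{id}\otimes\mathrm{id})(\phi^{-1})$; $\omega=(1\otimes1\otimes1\otimes\overline{\mathbf f}_2\otimes\overline{\mathbf f}_1)(\mathrm{id}\otimes\Delta\otimes S\otimes S)(\chi)(\phi\otimes1\otimes1)\in H^{\otimes5}$. Yetter-Drinfeld modules. An object $V$ of ${}^H_H\mathcal{YD}$ is a left $H$-module with a second kind coaction $\delta^{2nd}_V(v)=v_{[-1]}\otimes v_{[0]}\in H\otimes V$ satisfying $v_{[-1]}\otimes v_{[0][-1]}\otimes v_{[0][0]}=\omega_1(v_{[-1]})_{(1)}\omega_5\otimes\omega_2(v_{[-1]})_{(2)}\omega_4\otimes\omega_3v_{[0]}$,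 $\epsilon(v_{[-1]})v_{[0]}=v$, $\delta^{2nd}_V(hv)=h_{(1,1)}v_{[-1]}S(h_{(2)})\otimes h_{(1,2)}v_{[0]}$. Equivalently, it has a first kind coaction $\delta^{1st}_V(v)=v_{\langle-1\rangle}\otimes v_{\langle0\rangle}$ making $V\otimes X\to X\otimes V$, $v\otimes x\mapsto v_{\langle-1\rangle}x\otimes v_{\langle0\rangle}$ a half-braiding on ${}_H\mathcal M$ (so ${}^H_H\mathcal{YD}$ is identified with the Drinfeld center); the two are related by $\delta^{2nd}_V(v)=(p^R_1v)_{\langle-1\rangle}p^R_2\otimes(p^R_1v)_{\langle0\rangle}$ and $\delta^{1st}_V(v)=q^R_{1(1)}v_{[-1]}S(q^R_2)\otimes q^R_{1(2)}v_{[0]}$. Morphisms are linear maps preserving action and coaction. The monoidal structure of ${}^H_H\mathcal{YD}$ is that of ${}_H\mathcal M$ with $\delta^{1st}_k(1)=1\otimes1$ and $\delta^{1st}_{V\otimes W}(v\otimes w)=\phi_1(\overline\phi_1\phi'_1v)_{\langle-1\rangle}\overline\phi_2(\phi'_2w)_{\langle-1\rangle}\phi'_3\otimes\phi_2(\overline\phi_1\phi'_1v)_{\langle0\rangle}\otimes\phi_3\overline\phi_3(\phi'_2w)_{\langle0\rangle}$. The functor $R$: $R(V)=H\otimes V$ with $h\triangleright(a\otimes v)=h_{(1,1)}aS(h_{(2)})\otimes h_{(1,2)}v$ and $\delta^{2nd}(a\otimes v)=\omega_1a_{(1)}\omega_5\otimes(\omega_2a_{(2)}\omega_4\otimes\omega_3v)$;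 $R(g)=\mathrm{id}_H\otimes g$. It is right adjoint to $F$ with unit $\eta_M(m)=m_{[-1]}\otimes m_{[0]}$ and counit $\varepsilon_V(a\otimes v)=\epsilon(a)v$. Its monoidal structure is $R^{(0)}=\eta_k$, $R^{(2)}_{X,Y}=R(\varepsilon_X\otimes\varepsilon_Y)\circ\eta_{R(X)\otimes R(Y)}$. The multiplication of $\mathbf A$ is $R^{(2)}_{k,k}$ and its unit is $R^{(0)}$. *)

theory Defs
  imports Complex_Main
begin

section \<open>Vector spaces and tensor products\<close>

text \<open>
  The ground field is a type \<open>'k :: field\<close>. A vector space is a subset \<open>carrier\<close> of an additive
  group together with a scalar multiplication; a proper subset is needed because a tensor product
  cannot occupy a whole type (it depends on the scalar multiplications of its factors).
\<close>

record ('k, 'v) space =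
  carrier :: "'v set"
  scale :: "'k \<Rightarrow> 'v \<Rightarrow> 'v"

definition bilinear_on ::
  "('k::field, 'v::ab_group_add, 'a) space_scheme \<Rightarrow> ('k, 'w::ab_group_add, 'b) space_scheme \<Rightarrow>
   ('k \<Rightarrow> 'u::ab_group_add \<Rightarrow> 'u) \<Rightarrow> ('v \<Rightarrow> 'w \<Rightarrow> 'u) \<Rightarrow> bool" where
  "bilinear_on V W s B \<longleftrightarrow>
     (\<forall>v\<in>carrier V. \<forall>v'\<in>carrier V. \<forall>w\<in>carrier W. B (v + v') w = B v w + B v' w) \<and>
     (\<forall>v\<in>carrier V. \<forall>w\<in>carrier W. \<forall>w'\<in>carrier W. B v (w + w') = B v w + B v w') \<and>
     (\<forall>c. \<forall>v\<in>carrier V. \<forall>w\<in>carrier W. B (scale V c v) w = s c (B v w)) \<and>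
     (\<forall>c. \<forall>v\<in>carrier V. \<forall>w\<in>carrier W. B v (scale W c w) = s c (B v w))"

text \<open>
  Over a field, \<open>V \<otimes> W\<close> embeds into the dual of the space of bilinear forms on \<open>V \<times> W\<close>, the pure
  tensor \<open>v \<otimes> w\<close> being evaluation at \<open>(v, w)\<close>. The tensor product is taken to be the set of
  finite sums of pure tensors in that dual. The type below is the ambient space of all functionals.
  Lemmas \<open>tlift_pure\<close>, \<open>tlift_add\<close> and \<open>tlift_scale\<close> give the universal property.
\<close>

typedef ('k, 'v, 'w) tensor = "UNIV :: (('v \<Rightarrow> 'w \<Rightarrow> 'k) \<Rightarrow> 'k) set"
  morphisms teval Tensor ..

instantiation tensor :: (ab_group_add, type, type) ab_group_add
begin

definition zero_tensor :: "('a, 'b, 'c) tensor" where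
  "0 = Tensor (\<lambda>B. 0)"
definition plus_tensor :: "('a, 'b, 'c) tensor \<Rightarrow> ('a, 'b, 'c) tensor \<Rightarrow> ('a, 'b, 'c) tensor" where
  "x + y = Tensor (\<lambda>B. teval x B + teval y B)"
definition uminus_tensor :: "('a, 'b, 'c) tensor \<Rightarrow> ('a, 'b, 'c) tensor" where
  "- x = Tensor (\<lambda>B. - teval x B)"
definition minus_tensor :: "('a, 'b, 'c) tensor \<Rightarrow> ('a, 'b, 'c) tensor \<Rightarrow> ('a, 'b, 'c) tensor" where
  "x - y = Tensor (\<lambda>B. teval x B - teval y B)"

instance
  by standard
    (simp_all add: zero_tensor_def plus_tensor_def uminus_tensor_def minus_tensor_def
      Tensor_inverse teval_inverse algebra_simps)

end

definition tscale :: "'k::field \<Rightarrow> ('k, 'v, 'w) tensor \<Rightarrow> ('k, 'v, 'w) tensor" where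
  "tscale c x = Tensor (\<lambda>B. c * teval x B)"

definition pure ::
  "('k::field, 'v::ab_group_add, 'a) space_scheme \<Rightarrow> ('k, 'w::ab_group_add, 'b) space_scheme \<Rightarrow>
   'v \<Rightarrow> 'w \<Rightarrow> ('k, 'v, 'w) tensor" where
  "pure V W v w = Tensor (\<lambda>B. if bilinear_on V W (*) B then B v w else 0)"

definition expansion ::
  "('k::field, 'v::ab_group_add, 'a) space_scheme \<Rightarrow> ('k, 'w::ab_group_add, 'b) space_scheme \<Rightarrow>
   ('k, 'v, 'w) tensor \<Rightarrow> ('v \<times> 'w) list \<Rightarrow> bool" where
  "expansion V W x l \<longleftrightarrow>
     set l \<subseteq> carrier V \<times> carrier W \<and> x = (\<Sum>(v, w)\<leftarrow>l. pure V W v w)"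

definition tensor_space ::
  "('k::field, 'v::ab_group_add, 'a) space_scheme \<Rightarrow> ('k, 'w::ab_group_add, 'b) space_scheme \<Rightarrow>
   ('k, ('k, 'v, 'w) tensor) space" where
  "tensor_space V W = \<lparr>carrier = {x. \<exists>l. expansion V W x l}, scale = tscale\<rparr>"

text \<open>
  \<open>tlift V W x F\<close> is the sum of \<open>F x\<^sub>1 x\<^sub>2\<close> over an expansion \<open>x = x\<^sub>1 \<otimes> x\<^sub>2\<close>
  (summation understood), i.e. the value at \<open>x\<close> of the linear map induced by the bilinear map \<open>F\<close>.
\<close>

definition tlift ::
  "('k::field, 'v::ab_group_add, 'a) space_scheme \<Rightarrow> ('k, 'w::ab_group_add, 'b) space_scheme \<Rightarrow>
   ('k, 'v, 'w) tensor \<Rightarrow> ('v \<Rightarrow> 'w \<Rightarrow> 'u::ab_group_add) \<Rightarrow> 'u" where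
  "tlift V W x F = (\<Sum>(v, w)\<leftarrow>(SOME l. expansion V W x l). F v w)"

lemma teval_simps:
  "teval 0 B = 0" "teval (x + y) B = teval x B + teval y B" "teval (tscale c z) B = c * teval z B"
  by (simp_all add: zero_tensor_def plus_tensor_def tscale_def Tensor_inverse)

lemma tlift_expansion:
  assumes U: "vector_space s" and F: "bilinear_on V W s F" and l: "expansion V W x l"
  shows "tlift V W x F = (\<Sum>(v, w)\<leftarrow>l. F v w)"
proof (rule ccontr)
  interpret vector_space s by (rule U)
  define l' where "l' = (SOME l. expansion V W x l)"
  have l': "expansion V W x l'"
    unfolding l'_def using l by (rule someI)
  define d where "d = (\<Sum>(v, w)\<leftarrow>l'. F v w) - (\<Sum>(v, w)\<leftarrow>l. F v w)"
  assume "tlift V W x F \<noteq> (\<Sum>(v, w)\<leftarrow>l. F v w)"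
  then have d0: "d \<noteq> 0"
    by (simp add: d_def tlift_def l'_def)
  define b where "b = extend_basis {d}"
  have "independent {d}"
    using d0 by simp
  then have b: "independent b" "span b = UNIV" "d \<in> b"
    unfolding b_def
    using independent_extend_basis[of "{d}"] span_extend_basis[of "{d}"] extend_basis_superset[of "{d}"]
    by auto
  define g where "g u = representation b u d" for u
  have g_add: "g (u + v) = g u + g v" and g_scale: "g (s c u) = c * g u" for u v c
    unfolding g_def using b by (simp_all add: representation_add representation_scale)
  have g_d: "g d = 1"
    unfolding g_def using b by (simp add: representation_basis)
  define G where "G v w = g (F v w)" for v w
  have G: "bilinear_on V W (*) G"
    using F unfolding bilinear_on_def G_def by (simp add: g_add g_scale)
  have ev: "teval (\<Sum>(v, w)\<leftarrow>m. pure V W v w) G = g (\<Sum>(v, w)\<leftarrow>m. F v w)" for m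
  proof (induction m)
    case Nil
    have "g 0 = 0"
      using g_scale[of 0 0] by simp
    then show ?case
      by (simp add: teval_simps)
  next
    case (Cons p m)
    have "teval (pure V W v w) G = g (F v w)" for v w
      using G by (simp add: pure_def Tensor_inverse) (simp add: G_def)
    with Cons show ?case
      by (auto simp: teval_simps g_add split: prod.splits)
  qed
  have "g (\<Sum>(v, w)\<leftarrow>l'. F v w) = g (\<Sum>(v, w)\<leftarrow>l. F v w)"
    using l l' ev unfolding expansion_def by metis
  moreover have "g (\<Sum>(v, w)\<leftarrow>l'. F v w) = g d + g (\<Sum>(v, w)\<leftarrow>l. F v w)"
    using g_add[of d "\<Sum>(v, w)\<leftarrow>l. F v w"] by (simp add: d_def)
  ultimately show False
    using g_d by simp
qed

lemma tlift_pure: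
  assumes "vector_space s" "bilinear_on V W s F" "v \<in> carrier V" "w \<in> carrier W"
  shows "tlift V W (pure V W v w) F = F v w"
proof -
  have "expansion V W (pure V W v w) [(v, w)]"
    using assms by (simp add: expansion_def)
  from tlift_expansion[OF assms(1,2) this] show ?thesis
    by simp
qed

lemma tlift_add:
  assumes "vector_space s" "bilinear_on V W s F"
    "x \<in> carrier (tensor_space V W)" "y \<in> carrier (tensor_space V W)"
  shows "tlift V W (x + y) F = tlift V W x F + tlift V W y F"
proof -
  from assms(3,4) obtain l m where lm: "expansion V W x l" "expansion V W y m"
    by (auto simp: tensor_space_def)
  then have "expansion V W (x + y) (l @ m)"
    by (auto simp: expansion_def)
  from tlift_expansion[OF assms(1,2) this] show ?thesis
    using tlift_expansion[OF assms(1,2) lm(1)] tlift_expansion[OF assms(1,2) lm(2)] by simp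
qed

lemma pure_scale_left:
  assumes "v \<in> carrier V" "w \<in> carrier W"
  shows "pure V W (scale V c v) w = tscale c (pure V W v w)"
  using assms by (auto simp: pure_def tscale_def bilinear_on_def Tensor_inverse fun_eq_iff Tensor_inject)

lemma tscale_sum_list:
  "tscale c (\<Sum>(v, w)\<leftarrow>l. f v w) = (\<Sum>(v, w)\<leftarrow>l. tscale c (f v w))"
proof (induction l)
  case Nil
  then show ?case
    by (simp add: tscale_def zero_tensor_def Tensor_inverse)
next
  case (Cons p l)
  have "tscale c (x + y) = tscale c x + tscale c y" for x y :: "('a, 'b, 'c) tensor"
    by (simp add: tscale_def plus_tensor_def Tensor_inverse algebra_simps)
  then show ?case
    using Cons by (auto split: prod.splits)
qed

lemma tlift_scale:
  assumes "vector_space s" "bilinear_on V W s F" "x \<in> carrier (tensor_space V W)"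
    and V: "\<And>c v. v \<in> carrier V \<Longrightarrow> scale V c v \<in> carrier V"
  shows "tlift V W (tscale c x) F = s c (tlift V W x F)"
proof -
  interpret vector_space s by (rule assms(1))
  from assms(3) obtain l where l: "expansion V W x l"
    by (auto simp: tensor_space_def)
  define m where "m = map (\<lambda>(v, w). (scale V c v, w)) l"
  have sub: "set l \<subseteq> carrier V \<times> carrier W"
    using l by (simp add: expansion_def)
  have "(\<Sum>(v, w)\<leftarrow>m. pure V W v w) = (\<Sum>(v, w)\<leftarrow>l. tscale c (pure V W v w))"
    unfolding m_def using sub by (induction l) (auto simp: pure_scale_left)
  then have "expansion V W (tscale c x) m"
    using l V by (auto simp: expansion_def m_def tscale_sum_list)
  from tlift_expansion[OF assms(1,2) this]
  have "tlift V W (tscale c x) F = (\<Sum>(v, w)\<leftarrow>m. F v w)" .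
  also have "\<dots> = s c (\<Sum>(v, w)\<leftarrow>l. F v w)"
    unfolding m_def using sub assms(2)
    by (induction l) (auto simp: bilinear_on_def scale_right_distrib)
  finally show ?thesis
    using tlift_expansion[OF assms(1,2) l] by simp
qed

definition tmap ::
  "('k::field, 'v::ab_group_add, 'a) space_scheme \<Rightarrow> ('k, 'w::ab_group_add, 'b) space_scheme \<Rightarrow>
   ('k, 'v'::ab_group_add, 'c) space_scheme \<Rightarrow> ('k, 'w'::ab_group_add, 'd) space_scheme \<Rightarrow>
   ('v \<Rightarrow> 'v') \<Rightarrow> ('w \<Rightarrow> 'w') \<Rightarrow> ('k, 'v, 'w) tensor \<Rightarrow> ('k, 'v', 'w') tensor" where
  "tmap V W V' W' f g x = tlift V W x (\<lambda>v w. pure V' W' (f v) (g w))"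

section \<open>Quasi-Hopf algebras\<close>

text \<open>
  The underlying algebra is a type \<open>'h :: ring_1\<close> with a compatible scalar multiplication. The record
  extends \<open>space\<close>, so \<open>H\<close> itself can be used as a tensor factor.
\<close>

record ('k, 'h) quasi_hopf = "('k, 'h) space" +
  comult :: "'h \<Rightarrow> ('k, 'h, 'h) tensor"
  counit :: "'h \<Rightarrow> 'k"
  reassoc :: "('k, 'h, ('k, 'h, 'h) tensor) tensor"
  antipode :: "'h \<Rightarrow> 'h"
  alpha :: "'h"
  beta :: "'h"

text \<open>Tensor powers of \<open>H\<close> are nested to the right.\<close>

type_synonym ('k, 'h) tensor2 = "('k, 'h, 'h) tensor"
type_synonym ('k, 'h) tensor3 = "('k, 'h, ('k, 'h) tensor2) tensor"
type_synonym ('k, 'h) tensor4 = "('k, 'h, ('k, 'h) tensor3) tensor"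
type_synonym ('k, 'h) tensor5 = "('k, 'h, ('k, 'h) tensor4) tensor"

context
  fixes H :: "('k::field, 'h::ring_1) quasi_hopf"
begin

definition tpow2 :: "('k, ('k, 'h) tensor2) space" where "tpow2 = tensor_space H H"
definition tpow3 :: "('k, ('k, 'h) tensor3) space" where "tpow3 = tensor_space H tpow2"
definition tpow4 :: "('k, ('k, 'h) tensor4) space" where "tpow4 = tensor_space H tpow3"

definition pure2 :: "'h \<Rightarrow> 'h \<Rightarrow> ('k, 'h) tensor2" where
  "pure2 a b = pure H H a b"
definition pure3 :: "'h \<Rightarrow> 'h \<Rightarrow> 'h \<Rightarrow> ('k, 'h) tensor3" where
  "pure3 a b c = pure H tpow2 a (pure2 b c)"
definition pure4 :: "'h \<Rightarrow> 'h \<Rightarrow> 'h \<Rightarrow> 'h \<Rightarrow> ('k, 'h) tensor4" where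
  "pure4 a b c d = pure H tpow3 a (pure3 b c d)"
definition pure5 :: "'h \<Rightarrow> 'h \<Rightarrow> 'h \<Rightarrow> 'h \<Rightarrow> 'h \<Rightarrow> ('k, 'h) tensor5" where
  "pure5 a b c d e = pure H tpow4 a (pure4 b c d e)"

text \<open>
  \<open>sum\<^sub>n x (\<lambda>x\<^sub>1 \<dots> x\<^sub>n. F x\<^sub>1 \<dots> x\<^sub>n)\<close> is Sweedler notation for a multilinear expression in
  \<open>x = x\<^sub>1 \<otimes> \<dots> \<otimes> x\<^sub>n\<close>; a repeated argument \<open>x\<close> gives independent copies.
\<close>

definition sum2 :: "('k, 'h) tensor2 \<Rightarrow> ('h \<Rightarrow> 'h \<Rightarrow> 'u::ab_group_add) \<Rightarrow> 'u" where
  "sum2 x F = tlift H H x F"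
definition sum3 :: "('k, 'h) tensor3 \<Rightarrow> ('h \<Rightarrow> 'h \<Rightarrow> 'h \<Rightarrow> 'u::ab_group_add) \<Rightarrow> 'u" where
  "sum3 x F = tlift H tpow2 x (\<lambda>a y. sum2 y (F a))"
definition sum4 :: "('k, 'h) tensor4 \<Rightarrow> ('h \<Rightarrow> 'h \<Rightarrow> 'h \<Rightarrow> 'h \<Rightarrow> 'u::ab_group_add) \<Rightarrow> 'u" where
  "sum4 x F = tlift H tpow3 x (\<lambda>a y. sum3 y (F a))"
definition sum5 ::
  "('k, 'h) tensor5 \<Rightarrow> ('h \<Rightarrow> 'h \<Rightarrow> 'h \<Rightarrow> 'h \<Rightarrow> 'h \<Rightarrow> 'u::ab_group_add) \<Rightarrow> 'u" where
  "sum5 x F = tlift H tpow4 x (\<lambda>a y. sum4 y (F a))"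

definition mult2 :: "('k, 'h) tensor2 \<Rightarrow> ('k, 'h) tensor2 \<Rightarrow> ('k, 'h) tensor2" where
  "mult2 x y = sum2 x (\<lambda>x1 x2. sum2 y (\<lambda>y1 y2. pure2 (x1 * y1) (x2 * y2)))"
definition mult3 :: "('k, 'h) tensor3 \<Rightarrow> ('k, 'h) tensor3 \<Rightarrow> ('k, 'h) tensor3" where
  "mult3 x y = sum3 x (\<lambda>x1 x2 x3. sum3 y (\<lambda>y1 y2 y3. pure3 (x1 * y1) (x2 * y2) (x3 * y3)))"
definition mult4 :: "('k, 'h) tensor4 \<Rightarrow> ('k, 'h) tensor4 \<Rightarrow> ('k, 'h) tensor4" where
  "mult4 x y = sum4 x (\<lambda>x1 x2 x3 x4. sum4 y (\<lambda>y1 y2 y3 y4.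
     pure4 (x1 * y1) (x2 * y2) (x3 * y3) (x4 * y4)))"
definition mult5 :: "('k, 'h) tensor5 \<Rightarrow> ('k, 'h) tensor5 \<Rightarrow> ('k, 'h) tensor5" where
  "mult5 x y = sum5 x (\<lambda>x1 x2 x3 x4 x5. sum5 y (\<lambda>y1 y2 y3 y4 y5.
     pure5 (x1 * y1) (x2 * y2) (x3 * y3) (x4 * y4) (x5 * y5)))"

definition is_inverse2 :: "('k, 'h) tensor2 \<Rightarrow> ('k, 'h) tensor2 \<Rightarrow> bool" where
  "is_inverse2 x y \<longleftrightarrow> y \<in> carrier tpow2 \<and> mult2 x y = pure2 1 1 \<and> mult2 y x = pure2 1 1"
definition is_inverse3 :: "('k, 'h) tensor3 \<Rightarrow> ('k, 'h) tensor3 \<Rightarrow> bool" where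
  "is_inverse3 x y \<longleftrightarrow> y \<in> carrier tpow3 \<and> mult3 x y = pure3 1 1 1 \<and> mult3 y x = pure3 1 1 1"

definition inverse2 :: "('k, 'h) tensor2 \<Rightarrow> ('k, 'h) tensor2" where
  "inverse2 x = (THE y. is_inverse2 x y)"
definition inverse3 :: "('k, 'h) tensor3 \<Rightarrow> ('k, 'h) tensor3" where
  "inverse3 x = (THE y. is_inverse3 x y)"

definition reassoc_inv :: "('k, 'h) tensor3" where
  "reassoc_inv = inverse3 (reassoc H)"

end

locale quasi_hopf_algebra =
  fixes H :: "('k::field, 'h::ring_1) quasi_hopf"
  assumes carrier_H: "carrier H = UNIV"
    and vector_space_H: "vector_space (scale H)"
    and scale_mult_left: "scale H c a * b = scale H c (a * b)"
    and scale_mult_right: "a * scale H c b = scale H c (a * b)"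
    and comult_closed: "comult H a \<in> carrier (tpow2 H)"
    and comult_add: "comult H (a + b) = comult H a + comult H b"
    and comult_scale: "comult H (scale H c a) = tscale c (comult H a)"
    and comult_mult: "comult H (a * b) = mult2 H (comult H a) (comult H b)"
    and comult_one: "comult H 1 = pure2 H 1 1"
    and counit_add: "counit H (a + b) = counit H a + counit H b"
    and counit_scale: "counit H (scale H c a) = c * counit H a"
    and counit_mult: "counit H (a * b) = counit H a * counit H b"
    and counit_one: "counit H 1 = 1"
    and reassoc_closed: "reassoc H \<in> carrier (tpow3 H)"
    and reassoc_invertible: "\<exists>y. is_inverse3 H (reassoc H) y"
    and antipode_add: "antipode H (a + b) = antipode H a + antipode H b"
    and antipode_scale: "antipode H (scale H c a) = scale H c (antipode H a)"
    and antipode_mult: "antipode H (a * b) = antipode H b * antipode H a"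
    and antipode_one: "antipode H 1 = 1"
    and quasi_coassoc:
      "sum2 H (comult H h) (\<lambda>h1 h2. sum2 H (comult H h2) (\<lambda>h21 h22. pure3 H h1 h21 h22)) =
       mult3 H (mult3 H (reassoc H)
         (sum2 H (comult H h) (\<lambda>h1 h2. sum2 H (comult H h1) (\<lambda>h11 h12. pure3 H h11 h12 h2))))
         (reassoc_inv H)"
    and counit_left: "sum2 H (comult H h) (\<lambda>h1 h2. scale H (counit H h1) h2) = h"
    and counit_right: "sum2 H (comult H h) (\<lambda>h1 h2. scale H (counit H h2) h1) = h"
    and pentagon:
      "mult4 H
         (sum3 H (reassoc H) (\<lambda>x1 x2 x3. sum2 H (comult H x3) (\<lambda>x31 x32. pure4 H x1 x2 x31 x32)))
         (sum3 H (reassoc H) (\<lambda>x1 x2 x3. sum2 H (comult H x1) (\<lambda>x11 x12. pure4 H x11 x12 x2 x3))) =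
       mult4 H (mult4 H
         (sum3 H (reassoc H) (\<lambda>x1 x2 x3. pure4 H 1 x1 x2 x3))
         (sum3 H (reassoc H) (\<lambda>x1 x2 x3. sum2 H (comult H x2) (\<lambda>x21 x22. pure4 H x1 x21 x22 x3))))
         (sum3 H (reassoc H) (\<lambda>x1 x2 x3. pure4 H x1 x2 x3 1))"
    and reassoc_counit:
      "sum3 H (reassoc H) (\<lambda>x1 x2 x3. tscale (counit H x2) (pure2 H x1 x3)) = pure2 H 1 1"
    and antipode_left:
      "sum2 H (comult H h) (\<lambda>h1 h2. antipode H h1 * alpha H * h2) = scale H (counit H h) (alpha H)"
    and antipode_right:
      "sum2 H (comult H h) (\<lambda>h1 h2. h1 * beta H * antipode H h2) = scale H (counit H h) (beta H)"
    and reassoc_antipode: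
      "sum3 H (reassoc H) (\<lambda>x1 x2 x3. x1 * beta H * antipode H x2 * alpha H * x3) = 1"
    and reassoc_inv_antipode:
      "sum3 H (reassoc_inv H) (\<lambda>x1 x2 x3. antipode H x1 * alpha H * x2 * beta H * antipode H x3) = 1"
    and counit_alpha: "counit H (alpha H) = 1"
    and counit_beta: "counit H (beta H) = 1"

section \<open>The elements \<open>p\<^sup>R\<close>, \<open>q\<^sup>R\<close>, \<open>f\<close>, \<open>\<chi>\<close>, \<open>\<omega>\<close>\<close>

context
  fixes H :: "('k::field, 'h::ring_1) quasi_hopf"
begin

definition pR :: "('k, 'h) tensor2" where
  "pR = sum3 H (reassoc_inv H) (\<lambda>x1 x2 x3. pure2 H x1 (x2 * beta H * antipode H x3))"

definition qR :: "('k, 'h) tensor2" where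
  "qR = sum3 H (reassoc H) (\<lambda>x1 x2 x3. pure2 H x1 (inv (antipode H) (alpha H * x3) * x2))"

definition a_elem :: "('k, 'h) tensor2" where
  "a_elem = sum3 H (reassoc H) (\<lambda>x1 x2 x3. sum3 H (reassoc_inv H) (\<lambda>y1 y2 y3.
     sum2 H (comult H x3) (\<lambda>x31 x32.
       pure2 H (antipode H (y1 * x2) * alpha H * y2 * x31)
               (antipode H x1 * alpha H * y3 * x32))))"

definition f_elem :: "('k, 'h) tensor2" where
  "f_elem = sum2 H pR (\<lambda>p1 p2. mult2 H (mult2 H
     (sum2 H (comult H p1) (\<lambda>p11 p12. pure2 H (antipode H p12) (antipode H p11)))
     a_elem) (comult H p2))"

definition f_inv :: "('k, 'h) tensor2" where
  "f_inv = inverse2 H f_elem"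

definition chi :: "('k, 'h) tensor4" where
  "chi = mult4 H
     (sum3 H (reassoc H) (\<lambda>x1 x2 x3. pure4 H x1 x2 x3 1))
     (sum3 H (reassoc_inv H) (\<lambda>y1 y2 y3. sum2 H (comult H y1) (\<lambda>y11 y12. pure4 H y11 y12 y2 y3)))"

definition omega :: "('k, 'h) tensor5" where
  "omega = mult5 H (mult5 H
     (sum2 H f_inv (\<lambda>f1 f2. pure5 H 1 1 1 f2 f1))
     (sum4 H chi (\<lambda>x1 x2 x3 x4. sum2 H (comult H x2) (\<lambda>x21 x22.
        pure5 H x1 x21 x22 (antipode H x3) (antipode H x4)))))
     (sum3 H (reassoc H) (\<lambda>x1 x2 x3. pure5 H x1 x2 x3 1 1))"

end

section \<open>Modules, Yetter-Drinfeld data and the functor \<open>R\<close>\<close>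

record ('k, 'h, 'v) hmod = "('k, 'v) space" +
  act :: "'h \<Rightarrow> 'v \<Rightarrow> 'v"

text \<open>
  \<open>ydmod\<close> holds the structure maps of an object of the category of Yetter-Drinfeld modules. The field
  \<open>coact\<close> is the coaction of the second kind; the one of the first kind is \<open>coact_first\<close> below.
\<close>

record ('k, 'h, 'v) ydmod = "('k, 'h, 'v) hmod" +
  coact :: "'v \<Rightarrow> ('k, 'h, 'v) tensor"

context
  fixes H :: "('k::field, 'h::ring_1) quasi_hopf"
begin

definition unit_hmod :: "('k, 'h, 'k) hmod" where
  "unit_hmod = \<lparr>carrier = UNIV, scale = (*), act = (\<lambda>h c. counit H h * c)\<rparr>"

definition tensor_hmod ::
  "('k, 'h, 'v::ab_group_add, 'a) hmod_scheme \<Rightarrow> ('k, 'h, 'w::ab_group_add, 'b) hmod_scheme \<Rightarrow>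
   ('k, 'h, ('k, 'v, 'w) tensor) hmod" where
  "tensor_hmod V W =
    \<lparr>carrier = carrier (tensor_space V W), scale = tscale,
     act = (\<lambda>h x. tlift V W x (\<lambda>v w. sum2 H (comult H h) (\<lambda>h1 h2.
       pure V W (act V h1 v) (act W h2 w))))\<rparr>"

text \<open>Passage between the two kinds of coactions.\<close>

definition coact_first ::
  "('k, 'h, 'v::ab_group_add, 'a) ydmod_scheme \<Rightarrow> 'v \<Rightarrow> ('k, 'h, 'v) tensor" where
  "coact_first V v = sum2 H (qR H) (\<lambda>q1 q2. sum2 H (comult H q1) (\<lambda>q11 q12.
     tlift H V (coact V v) (\<lambda>g v0. pure H V (q11 * g * antipode H q2) (act V q12 v0))))"

definition second_of_first ::
  "('k, 'h, 'v::ab_group_add, 'a) hmod_scheme \<Rightarrow> ('v \<Rightarrow> ('k, 'h, 'v) tensor) \<Rightarrow>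
   'v \<Rightarrow> ('k, 'h, 'v) tensor" where
  "second_of_first V d v = sum2 H (pR H) (\<lambda>p1 p2.
     tlift H V (d (act V p1 v)) (\<lambda>g v0. pure H V (g * p2) v0))"

definition unit_yd :: "('k, 'h, 'k) ydmod" where
  "unit_yd = hmod.extend unit_hmod
     (ydmod.fields (second_of_first unit_hmod (\<lambda>c. pure H unit_hmod 1 c)))"

definition tensor_coact_first ::
  "('k, 'h, 'v::ab_group_add, 'a) ydmod_scheme \<Rightarrow> ('k, 'h, 'w::ab_group_add, 'b) ydmod_scheme \<Rightarrow>
   ('k, 'v, 'w) tensor \<Rightarrow> ('k, 'h, ('k, 'v, 'w) tensor) tensor" where
  "tensor_coact_first V W t = tlift V W t (\<lambda>v w.
     sum3 H (reassoc H) (\<lambda>x1 x2 x3. sum3 H (reassoc_inv H) (\<lambda>y1 y2 y3.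
     sum3 H (reassoc H) (\<lambda>z1 z2 z3.
       tlift H V (coact_first V (act V (y1 * z1) v)) (\<lambda>g v0.
       tlift H W (coact_first W (act W z2 w)) (\<lambda>g' w0.
         pure H (tensor_space V W) (x1 * g * y2 * g' * z3)
           (pure V W (act V x2 v0) (act W (x3 * y3) w0))))))))"

definition tensor_yd ::
  "('k, 'h, 'v::ab_group_add, 'a) ydmod_scheme \<Rightarrow> ('k, 'h, 'w::ab_group_add, 'b) ydmod_scheme \<Rightarrow>
   ('k, 'h, ('k, 'v, 'w) tensor) ydmod" where
  "tensor_yd V W = hmod.extend (tensor_hmod V W)
     (ydmod.fields (second_of_first (tensor_hmod V W) (tensor_coact_first V W)))"

definition R_obj ::
  "('k, 'h, 'v::ab_group_add, 'a) hmod_scheme \<Rightarrow> ('k, 'h, ('k, 'h, 'v) tensor) ydmod" where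
  "R_obj V =
    \<lparr>carrier = carrier (tensor_space H V), scale = tscale,
     act = (\<lambda>h x. tlift H V x (\<lambda>a v.
       sum2 H (comult H h) (\<lambda>h1 h2. sum2 H (comult H h1) (\<lambda>h11 h12.
         pure H V (h11 * a * antipode H h2) (act V h12 v))))),
     coact = (\<lambda>x. tlift H V x (\<lambda>a v.
       sum5 H (omega H) (\<lambda>w1 w2 w3 w4 w5. sum2 H (comult H a) (\<lambda>a1 a2.
         pure H (tensor_space H V) (w1 * a1 * w5)
           (pure H V (w2 * a2 * w4) (act V w3 v))))))\<rparr>"

definition R_map ::
  "('k, 'h, 'v::ab_group_add, 'a) hmod_scheme \<Rightarrow> ('k, 'h, 'w::ab_group_add, 'b) hmod_scheme \<Rightarrow>
   ('v \<Rightarrow> 'w) \<Rightarrow> ('k, 'h, 'v) tensor \<Rightarrow> ('k, 'h, 'w) tensor" where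
  "R_map V W g = tmap H V H W id g"

definition adj_unit ::
  "('k, 'h, 'v::ab_group_add, 'a) ydmod_scheme \<Rightarrow> 'v \<Rightarrow> ('k, 'h, 'v) tensor" where
  "adj_unit M m = coact M m"

definition adj_counit ::
  "('k, 'h, 'v::ab_group_add, 'a) hmod_scheme \<Rightarrow> ('k, 'h, 'v) tensor \<Rightarrow> 'v" where
  "adj_counit V x = tlift H V x (\<lambda>a v. scale V (counit H a) v)"

definition R0 :: "'k \<Rightarrow> ('k, 'h, 'k) tensor" where
  "R0 = adj_unit unit_yd"

definition R2 ::
  "('k, 'h, 'v::ab_group_add, 'a) hmod_scheme \<Rightarrow> ('k, 'h, 'w::ab_group_add, 'b) hmod_scheme \<Rightarrow>
   ('k, ('k, 'h, 'v) tensor, ('k, 'h, 'w) tensor) tensor \<Rightarrow> ('k, 'h, ('k, 'v, 'w) tensor) tensor"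
where
  "R2 X Y =
     R_map (tensor_hmod (R_obj X) (R_obj Y)) (tensor_hmod X Y)
       (tmap (R_obj X) (R_obj Y) X Y (adj_counit X) (adj_counit Y))
     \<circ> adj_unit (tensor_yd (R_obj X) (R_obj Y))"

section \<open>The algebra \<open>A = R(k)\<close>\<close>

definition A_obj :: "('k, 'h, ('k, 'h, 'k) tensor) ydmod" where
  "A_obj = R_obj unit_hmod"

text \<open>
  The multiplication of the image of an algebra \<open>B\<close> under \<open>R\<close> is \<open>R\<^sup>(\<^sup>2\<^sup>)\<close> followed by \<open>R\<close> of the
  multiplication of \<open>B\<close>; for \<open>B = k\<close> the latter is the identification of \<open>k \<otimes> k\<close> with \<open>k\<close>.
\<close>

definition A_mult :: "('k, 'h, 'k) tensor \<Rightarrow> ('k, 'h, 'k) tensor \<Rightarrow> ('k, 'h, 'k) tensor" where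
  "A_mult x y =
     R_map (tensor_hmod unit_hmod unit_hmod) unit_hmod (\<lambda>t. tlift unit_hmod unit_hmod t (*))
       (R2 unit_hmod unit_hmod (pure A_obj A_obj x y))"

definition A_one :: "('k, 'h, 'k) tensor" where
  "A_one = R0 1"

text \<open>The identification of \<open>H\<close> with \<open>A = H \<otimes> k\<close>.\<close>

definition to_A :: "'h \<Rightarrow> ('k, 'h, 'k) tensor" where
  "to_A a = pure H unit_hmod a 1"

end

end

(*
  Both coaction formulas are instances of the formula for omega with the counit applied to its third
  leg; the first-kind one additionally uses the pentagon and the antipode axiom for alpha.

  For the product, J(a) = phi_1 a S(phi_2) alpha phi_3 is the component at H of the half-braiding of
  R(k) followed by the counit of the adjunction, up to the normalisation (id # eps)(f^-1) = 1.
  It satisfies J(h_1 |> a) h_2 = h J(a), and a # b is expressed through J once the tensor product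
  coaction is composed with the counits.

  This requires f to be invertible. The maps Delta o S, with (Delta alpha, Delta beta), and
  (S # S) o Delta^cop, with elements (gamma, delta) of H # H, are both antipodes for the algebra map
  Delta, and two such antipodes are conjugate by an explicit invertible element, which here is f.
  The two zigzag identities for (gamma, delta) follow from the pentagon.
*)

theory Submission
  imports Defs
begin

text \<open>\<open>f_inv\<close> is a definite description, so neither coaction formula can be
  evaluated under counits before an explicit two-sided inverse of \<open>f_elem\<close> is known;
  this is what puts the antipode theory along \<Delta> ahead of the product formula. The element
  conjugating one antipode into another is a mixed zigzag, built from the left part of one zigzag
  axiom and the right part of the other, and \<open>f_elem\<close> has this shape because \<Delta>
  is multiplicative on the second leg of \<open>pR\<close>. Nearly every long identity follows one
  pattern. A solved form of the pentagon puts the two coproduct halves of one reassociator leg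
  around \<alpha> or \<beta>; the antipode axiom replaces that leg by its counit; the reassociator
  then disappears. For this the counit must be known to kill every leg of \<phi> and of its inverse,
  while only the middle leg of \<phi> is covered by an axiom. Sweedler sums run over a list of
  representatives chosen once per tensor, whatever the summand. Hence sums commute freely, and
  multilinearity matters only when the tensor summed over is itself rewritten.\<close>

lemma sum_list_swap:
  "(\<Sum>p\<leftarrow>l. \<Sum>q\<leftarrow>m. F p q) = (\<Sum>q\<leftarrow>m. \<Sum>p\<leftarrow>l. (F p q :: 'u::ab_group_add))"
  by (induction l) (simp_all add: sum_list_addf)

lemma additive_sum_list:
  fixes h :: "'u::ab_group_add \<Rightarrow> 'v::ab_group_add"
  assumes "\<And>a b. h (a + b) = h a + h b"
  shows "h (\<Sum>p\<leftarrow>l. F p) = (\<Sum>p\<leftarrow>l. h (F p))"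
proof -
  have "h 0 = 0"
    using assms[of 0 0] by simp
  then show ?thesis
    by (induction l) (simp_all add: assms)
qed

section \<open>Calculus of the concrete tensor product\<close>

lemma pure_in_tensor_space [simp]:
  "v \<in> carrier V \<Longrightarrow> w \<in> carrier W \<Longrightarrow> pure V W v w \<in> carrier (tensor_space V W)"
  unfolding tensor_space_def expansion_def
  by (auto intro!: exI[of _ "[(v, w)]"])

lemma zero_in_tensor_space [simp]: "0 \<in> carrier (tensor_space V W)"
  unfolding tensor_space_def expansion_def by (auto intro!: exI[of _ "[]"])

lemma add_in_tensor_space [simp]:
  assumes "x \<in> carrier (tensor_space V W)" "y \<in> carrier (tensor_space V W)"
  shows "x + y \<in> carrier (tensor_space V W)"
proof -
  from assms obtain l m where "expansion V W x l" "expansion V W y m"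
    by (auto simp: tensor_space_def)
  then have "expansion V W (x + y) (l @ m)"
    by (auto simp: expansion_def)
  then show ?thesis
    by (auto simp: tensor_space_def)
qed

lemma sum_list_in_tensor_space:
  "(\<And>p. p \<in> set l \<Longrightarrow> F p \<in> carrier (tensor_space V W)) \<Longrightarrow>
   (\<Sum>p\<leftarrow>l. F p) \<in> carrier (tensor_space V W)"
  by (induction l) auto

lemma tlift_additive_arg:
  assumes "vector_space s" "bilinear_on V W s F"
    "\<And>p. p \<in> set l \<Longrightarrow> G p \<in> carrier (tensor_space V W)"
  shows "tlift V W (\<Sum>p\<leftarrow>l. G p) F = (\<Sum>p\<leftarrow>l. tlift V W (G p) F)"
  using assms(3)
proof (induction l)
  case Nil
  have "expansion V W 0 []"
    by (simp add: expansion_def)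
  from tlift_expansion[OF assms(1,2) this] show ?case
    by simp
next
  case (Cons p l)
  have "tlift V W (G p + (\<Sum>p\<leftarrow>l. G p)) F = tlift V W (G p) F + tlift V W (\<Sum>p\<leftarrow>l. G p) F"
    using Cons.prems by (intro tlift_add[OF assms(1,2)] sum_list_in_tensor_space) auto
  with Cons show ?case by simp
qed

lemma tscale_vector_space: "vector_space (tscale :: 'k::field \<Rightarrow> ('k, 'v, 'w) tensor \<Rightarrow> _)"
  by standard
    (simp_all add: tscale_def plus_tensor_def Tensor_inverse Tensor_inject teval_inverse
      algebra_simps)

lemma tlift_id:
  assumes "x \<in> carrier (tensor_space V W)"
  shows "tlift V W x (pure V W) = x"
proof -
  from assms obtain l where "expansion V W x l"
    by (auto simp: tensor_space_def)
  then have "expansion V W x (SOME l. expansion V W x l)"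
    by (rule someI)
  then show ?thesis
    by (simp add: tlift_def expansion_def)
qed

lemma pure_add_left:
  assumes "v \<in> carrier V" "v' \<in> carrier V" "w \<in> carrier W"
  shows "pure V W (v + v') w = pure V W v w + pure V W v' w"
  using assms
  by (auto simp: pure_def plus_tensor_def bilinear_on_def Tensor_inverse fun_eq_iff Tensor_inject)

lemma pure_add_right:
  assumes "v \<in> carrier V" "w \<in> carrier W" "w' \<in> carrier W"
  shows "pure V W v (w + w') = pure V W v w + pure V W v w'"
  using assms
  by (auto simp: pure_def plus_tensor_def bilinear_on_def Tensor_inverse fun_eq_iff Tensor_inject)

lemma pure_scale_right:
  assumes "v \<in> carrier V" "w \<in> carrier W"
  shows "pure V W v (scale W c w) = tscale c (pure V W v w)"
  using assms by (auto simp: pure_def tscale_def bilinear_on_def Tensor_inverse fun_eq_iff Tensor_inject)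

lemma tscale_in_tensor_space:
  assumes "\<And>c v. v \<in> carrier V \<Longrightarrow> scale V c v \<in> carrier V"
    and "x \<in> carrier (tensor_space V W)"
  shows "tscale c x \<in> carrier (tensor_space V W)"
proof -
  from assms obtain l where l: "expansion V W x l"
    by (auto simp: tensor_space_def)
  have "tscale c x = (\<Sum>(v, w)\<leftarrow>l. tscale c (pure V W v w))"
    using l by (simp add: expansion_def tscale_sum_list)
  also have "\<dots> \<in> carrier (tensor_space V W)"
    using l assms(1)
    by (intro sum_list_in_tensor_space) (auto simp: expansion_def simp flip: pure_scale_left)
  finally show ?thesis .
qed

text \<open>Both sides run over the same chosen expansion, whose entries lie in the carriers, so
  agreement there is enough.\<close>

lemma tlift_cong:
  assumes "x \<in> carrier (tensor_space V W)"
    and "\<And>v w. v \<in> carrier V \<Longrightarrow> w \<in> carrier W \<Longrightarrow> F v w = G v w"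
  shows "tlift V W x F = tlift V W x G"
proof -
  from assms(1) obtain l where "expansion V W x l"
    by (auto simp: tensor_space_def)
  then have "expansion V W x (SOME l. expansion V W x l)"
    by (rule someI)
  then show ?thesis
    unfolding tlift_def expansion_def
    by (intro arg_cong[where f = sum_list] map_cong) (auto intro: assms(2))
qed

lemma tlift_closed:
  assumes "x \<in> carrier (tensor_space V' W')"
    and "\<And>v w. v \<in> carrier V' \<Longrightarrow> w \<in> carrier W' \<Longrightarrow> F v w \<in> carrier (tensor_space V W)"
  shows "tlift V' W' x F \<in> carrier (tensor_space V W)"
proof -
  from assms(1) obtain l where "expansion V' W' x l"
    by (auto simp: tensor_space_def)
  then have "expansion V' W' x (SOME l. expansion V' W' x l)"
    by (rule someI)
  then show ?thesis
    unfolding tlift_def expansion_def by (intro sum_list_in_tensor_space) (auto intro: assms(2))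
qed

text \<open>The inner value is a finite sum along one chosen expansion, and the outer induced map is
  additive on the tensor space.\<close>

lemma tlift_tlift:
  assumes "vector_space s" "bilinear_on V W s G" "x \<in> carrier (tensor_space V' W')"
    and "\<And>v w. v \<in> carrier V' \<Longrightarrow> w \<in> carrier W' \<Longrightarrow> F v w \<in> carrier (tensor_space V W)"
  shows "tlift V W (tlift V' W' x F) G = tlift V' W' x (\<lambda>v w. tlift V W (F v w) G)"
proof -
  from assms(3) obtain l where "expansion V' W' x l"
    by (auto simp: tensor_space_def)
  then have "expansion V' W' x (SOME l. expansion V' W' x l)"
    by (rule someI)
  then show ?thesis
    unfolding tlift_def[of V'] expansion_def
    by (subst tlift_additive_arg[OF assms(1,2)]) (auto simp: split_def intro!: assms(4))
qed

section \<open>Sweedler sums over fixed lists and multilinear summands\<close>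

context quasi_hopf_algebra
begin

abbreviation "S \<equiv> antipode H"
abbreviation "\<alpha> \<equiv> alpha H"
abbreviation "\<beta> \<equiv> beta H"
abbreviation "\<epsilon> \<equiv> counit H"
abbreviation "\<Phi> F \<equiv> sum3 H (reassoc H) F"
abbreviation "\<Psi> F \<equiv> sum3 H (reassoc_inv H) F"
abbreviation "\<DD> h F \<equiv> sum2 H (comult H h) F"
abbreviation "H2 \<equiv> carrier (tpow2 H)"
abbreviation "H3 \<equiv> carrier (tpow3 H)"
abbreviation "H4 \<equiv> carrier (tpow4 H)"

text \<open>The target is given only by its scalar multiplication, without a carrier, so one
  predicate serves \<open>H\<close>, the field and all ambient tensor types.\<close>

definition lin :: "('k \<Rightarrow> 'u::ab_group_add \<Rightarrow> 'u) \<Rightarrow> ('h \<Rightarrow> 'u) \<Rightarrow> bool" where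
  "lin s f \<longleftrightarrow> (\<forall>a b. f (a + b) = f a + f b) \<and> (\<forall>c a. f (scale H c a) = s c (f a))"

text \<open>Sums over tensors use a fixed list of representatives, whatever the summand.\<close>

definition list2 :: "('k, 'h) tensor2 \<Rightarrow> ('h \<times> 'h) list" where
  "list2 x = (SOME l. expansion H H x l)"
definition list3 :: "('k, 'h) tensor3 \<Rightarrow> ('h \<times> 'h \<times> 'h) list" where
  "list3 x = concat (map (\<lambda>(a, y). map (Pair a) (list2 y)) (SOME l. expansion H (tpow2 H) x l))"
definition list4 :: "('k, 'h) tensor4 \<Rightarrow> ('h \<times> 'h \<times> 'h \<times> 'h) list" where
  "list4 x = concat (map (\<lambda>(a, y). map (Pair a) (list3 y)) (SOME l. expansion H (tpow3 H) x l))"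
definition list5 :: "('k, 'h) tensor5 \<Rightarrow> ('h \<times> 'h \<times> 'h \<times> 'h \<times> 'h) list" where
  "list5 x = concat (map (\<lambda>(a, y). map (Pair a) (list4 y)) (SOME l. expansion H (tpow4 H) x l))"

lemma sum_list_concat_map:
  "(\<Sum>p\<leftarrow>concat (map (\<lambda>(a, y). map (Pair a) (L y)) l). F p) = (\<Sum>(a, y)\<leftarrow>l. \<Sum>q\<leftarrow>L y. F (a, q))"
  by (induction l) (auto simp: o_def)

lemma sum2_list: "sum2 H x F = (\<Sum>(a, b)\<leftarrow>list2 x. F a b)"
  by (simp add: sum2_def tlift_def list2_def)
lemma sum3_list: "sum3 H x F = (\<Sum>(a, b, c)\<leftarrow>list3 x. F a b c)"
  by (simp add: sum3_def tlift_def list3_def sum_list_concat_map sum2_list cong: map_cong)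
lemma sum4_list: "sum4 H x F = (\<Sum>(a, b, c, d)\<leftarrow>list4 x. F a b c d)"
  by (simp add: sum4_def tlift_def list4_def sum_list_concat_map sum3_list cong: map_cong)
lemma sum5_list: "sum5 H x F = (\<Sum>(a, b, c, d, e)\<leftarrow>list5 x. F a b c d e)"
  by (simp add: sum5_def tlift_def list5_def sum_list_concat_map sum4_list cong: map_cong)

lemmas sumN_list = sum2_list sum3_list sum4_list sum5_list

text \<open>Each side is a double sum over two lists that do not depend on the summand, so the order
  is immaterial for arbitrary summands.\<close>

lemma sum_swap:
  "sum2 H x (\<lambda>a b. sum2 H y (\<lambda>c d. F2 a b c d)) = sum2 H y (\<lambda>c d. sum2 H x (\<lambda>a b. F2 a b c d))"
  "sum2 H x (\<lambda>a b. sum3 H z (\<lambda>c d e. F3 a b c d e)) = sum3 H z (\<lambda>c d e. sum2 H x (\<lambda>a b. F3 a b c d e))"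
  "sum3 H z (\<lambda>a b c. sum3 H w (\<lambda>d e f. F4 a b c d e f)) =
   sum3 H w (\<lambda>d e f. sum3 H z (\<lambda>a b c. F4 a b c d e f))"
  unfolding sumN_list split_def by (rule sum_list_swap)+

lemma sum_hom:
  assumes "\<And>a b. h (a + b) = h a + h b"
  shows "h (sum2 H x2 F2) = sum2 H x2 (\<lambda>a b. h (F2 a b))"
    "h (sum3 H x3 F3) = sum3 H x3 (\<lambda>a b c. h (F3 a b c))"
    "h (sum4 H x4 F4) = sum4 H x4 (\<lambda>a b c d. h (F4 a b c d))"
    "h (sum5 H x5 F5) = sum5 H x5 (\<lambda>a b c d e. h (F5 a b c d e))"
  unfolding sumN_list by (simp_all add: split_def additive_sum_list[of h, OF assms])

lemma sum_add:
  "sum2 H x2 (\<lambda>a b. F2 a b + G2 a b) = sum2 H x2 F2 + sum2 H x2 G2"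
  "sum3 H x3 (\<lambda>a b c. F3 a b c + G3 a b c) = sum3 H x3 F3 + sum3 H x3 G3"
  "sum4 H x4 (\<lambda>a b c d. F4 a b c d + G4 a b c d) = sum4 H x4 F4 + sum4 H x4 G4"
  "sum5 H x5 (\<lambda>a b c d e. F5 a b c d e + G5 a b c d e) = sum5 H x5 F5 + sum5 H x5 G5"
  unfolding sumN_list by (simp_all add: split_def sum_list_addf)

lemmas vsH = vector_space_H

lemma scale_one [simp]: "scale H 1 a = a"
  and scale_add: "scale H c (a + b) = scale H c a + scale H c b"
  and scale_scale [simp]: "scale H c (scale H d a) = scale H (c * d) a"
  and scale_add_left: "scale H (c + d) a = scale H c a + scale H d a"
  using vector_space.vector_space_assms[OF vsH] by auto

lemma vs_scale_sum:
  assumes "vector_space s"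
  shows "s c (sum2 H x2 F2) = sum2 H x2 (\<lambda>a b. s c (F2 a b))"
    "s c (sum3 H x3 F3) = sum3 H x3 (\<lambda>a b d. s c (F3 a b d))"
    "s c (sum4 H x4 F4) = sum4 H x4 (\<lambda>a b d e. s c (F4 a b d e))"
    "s c (sum5 H x5 F5) = sum5 H x5 (\<lambda>a b d e f. s c (F5 a b d e f))"
  by (rule sum_hom[of "s c"], rule vector_space.vector_space_assms(1)[OF assms])+

lemma UNIV_H [simp]: "x \<in> carrier H"
  by (simp add: carrier_H)

text \<open>The vector space condition is bundled in because evaluating a sum on a new expansion
  rests on \<open>tlift_expansion\<close>, which separates vectors by linear functionals.\<close>

definition lin2 :: "('k \<Rightarrow> 'u::ab_group_add \<Rightarrow> 'u) \<Rightarrow> ('h \<Rightarrow> 'h \<Rightarrow> 'u) \<Rightarrow> bool" where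
  "lin2 s F \<longleftrightarrow> vector_space s \<and> (\<forall>b. lin s (\<lambda>a. F a b)) \<and> (\<forall>a. lin s (\<lambda>b. F a b))"
definition lin3 :: "('k \<Rightarrow> 'u::ab_group_add \<Rightarrow> 'u) \<Rightarrow> ('h \<Rightarrow> 'h \<Rightarrow> 'h \<Rightarrow> 'u) \<Rightarrow> bool" where
  "lin3 s F \<longleftrightarrow> (\<forall>c. lin2 s (\<lambda>a b. F a b c)) \<and> (\<forall>a b. lin s (\<lambda>c. F a b c))"
definition lin4 :: "('k \<Rightarrow> 'u::ab_group_add \<Rightarrow> 'u) \<Rightarrow> ('h \<Rightarrow> 'h \<Rightarrow> 'h \<Rightarrow> 'h \<Rightarrow> 'u) \<Rightarrow> bool" where
  "lin4 s F \<longleftrightarrow> (\<forall>d. lin3 s (\<lambda>a b c. F a b c d)) \<and> (\<forall>a b c. lin s (\<lambda>d. F a b c d))"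
definition lin5 :: "('k \<Rightarrow> 'u::ab_group_add \<Rightarrow> 'u) \<Rightarrow> ('h \<Rightarrow> 'h \<Rightarrow> 'h \<Rightarrow> 'h \<Rightarrow> 'h \<Rightarrow> 'u) \<Rightarrow> bool" where
  "lin5 s F \<longleftrightarrow> (\<forall>e. lin4 s (\<lambda>a b c d. F a b c d e)) \<and> (\<forall>a b c d. lin s (\<lambda>e. F a b c d e))"

lemma linI:
  "(\<And>a b. f (a + b) = f a + f b) \<Longrightarrow> (\<And>c a. f (scale H c a) = s c (f a)) \<Longrightarrow> lin s f"
  by (simp add: lin_def)

lemma lin2_bilinear: "lin2 s F \<Longrightarrow> bilinear_on H H s F"
  by (simp add: lin2_def lin_def bilinear_on_def)

lemma lin2_vs: "lin2 s F \<Longrightarrow> vector_space s"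
  by (simp add: lin2_def)

lemma sum2_pure2:
  assumes "lin2 s F" shows "sum2 H (pure2 H a b) F = F a b"
  unfolding sum2_def pure2_def by (rule tlift_pure[OF lin2_vs[OF assms] lin2_bilinear[OF assms]]) simp_all

lemma sum2_add_arg:
  assumes "lin2 s F" "x \<in> H2" "y \<in> H2"
  shows "sum2 H (x + y) F = sum2 H x F + sum2 H y F"
  using assms(2,3) unfolding sum2_def tpow2_def
  by (rule tlift_add[OF lin2_vs[OF assms(1)] lin2_bilinear[OF assms(1)]])

lemma sum2_scale_arg:
  assumes "lin2 s F" "x \<in> H2"
  shows "sum2 H (tscale c x) F = s c (sum2 H x F)"
  using assms(2) unfolding sum2_def tpow2_def
  by (rule tlift_scale[OF lin2_vs[OF assms(1)] lin2_bilinear[OF assms(1)]]) simp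

lemma scale_tpow [simp]: "scale (tpow2 H) = tscale" "scale (tpow3 H) = tscale" "scale (tpow4 H) = tscale"
  by (simp_all add: tpow2_def tpow3_def tpow4_def tensor_space_def)

text \<open>A triple sum is an iterated \<open>tlift\<close>, so its evaluation rules need
  bilinearity of the outer integrand, which is itself a double sum. The same induction on the number
  of factors is repeated up to five.\<close>

lemma lin3_bilinear: "lin3 s F \<Longrightarrow> bilinear_on H (tpow2 H) s (\<lambda>a y. sum2 H y (F a))"
proof -
  assume F: "lin3 s F"
  have *: "lin2 s (F a)" for a
    using F by (simp add: lin3_def lin2_def)
  have vs: "vector_space s"
    using *[of 0] by (rule lin2_vs)
  have **: "\<And>a b. F (a + b) = (\<lambda>c d. F a c d + F b c d)"
    "\<And>k a. F (scale H k a) = (\<lambda>b c. s k (F a b c))"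
    using F by (simp_all add: fun_eq_iff lin3_def lin2_def lin_def)
  show ?thesis
    unfolding bilinear_on_def
    by (simp add: sum2_add_arg[OF *] sum2_scale_arg[OF *] ** sum_add vs_scale_sum[OF vs])
qed

lemma lin3_vs: "lin3 s F \<Longrightarrow> vector_space s"
  by (simp add: lin3_def lin2_def)

lemma pure2_closed [simp]: "pure2 H a b \<in> H2"
  by (simp add: pure2_def tpow2_def)
lemma pure3_closed [simp]: "pure3 H a b c \<in> H3"
  by (simp add: pure3_def tpow3_def)
lemma pure4_closed [simp]: "pure4 H a b c d \<in> H4"
  by (simp add: pure4_def tpow4_def)

lemma sum3_pure3:
  assumes "lin3 s F" shows "sum3 H (pure3 H a b c) F = F a b c"
proof -
  have *: "lin2 s (F a)" for a
    using assms by (simp add: lin3_def lin2_def)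
  show ?thesis
  unfolding sum3_def pure3_def
  by (subst tlift_pure[OF lin3_vs[OF assms] lin3_bilinear[OF assms]]) (simp_all add: sum2_pure2[OF *])
qed

lemma sum3_add_arg:
  assumes "lin3 s F" "x \<in> H3" "y \<in> H3"
  shows "sum3 H (x + y) F = sum3 H x F + sum3 H y F"
  using assms(2,3) unfolding sum3_def tpow3_def
  by (rule tlift_add[OF lin3_vs[OF assms(1)] lin3_bilinear[OF assms(1)]])

lemma sum3_scale_arg:
  assumes "lin3 s F" "x \<in> H3"
  shows "sum3 H (tscale c x) F = s c (sum3 H x F)"
  using assms(2) unfolding sum3_def tpow3_def
  by (rule tlift_scale[OF lin3_vs[OF assms(1)] lin3_bilinear[OF assms(1)]]) simp

lemma lin4_vs: "lin4 s F \<Longrightarrow> vector_space s"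
  by (simp add: lin4_def lin3_def lin2_def)

lemma lin4_bilinear: "lin4 s F \<Longrightarrow> bilinear_on H (tpow3 H) s (\<lambda>a y. sum3 H y (F a))"
proof -
  assume F: "lin4 s F"
  have *: "lin3 s (F a)" for a
    using F by (simp add: lin4_def lin3_def lin2_def)
  have vs: "vector_space s"
    using *[of 0] by (rule lin3_vs)
  have **: "\<And>a b. F (a + b) = (\<lambda>c d e. F a c d e + F b c d e)"
    "\<And>k a. F (scale H k a) = (\<lambda>b c d. s k (F a b c d))"
    using F by (simp_all add: fun_eq_iff lin4_def lin3_def lin2_def lin_def)
  show ?thesis
    unfolding bilinear_on_def
    by (simp add: sum3_add_arg[OF *] sum3_scale_arg[OF *] ** sum_add vs_scale_sum[OF vs])
qed

lemma sum4_pure4: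
  assumes "lin4 s F" shows "sum4 H (pure4 H a b c d) F = F a b c d"
proof -
  have *: "lin3 s (F a)" for a
    using assms by (simp add: lin4_def lin3_def lin2_def)
  show ?thesis
  unfolding sum4_def pure4_def
  by (subst tlift_pure[OF lin4_vs[OF assms] lin4_bilinear[OF assms]]) (simp_all add: sum3_pure3[OF *])
qed

lemma sum4_add_arg:
  assumes "lin4 s F" "x \<in> H4" "y \<in> H4"
  shows "sum4 H (x + y) F = sum4 H x F + sum4 H y F"
  using assms(2,3) unfolding sum4_def tpow4_def
  by (rule tlift_add[OF lin4_vs[OF assms(1)] lin4_bilinear[OF assms(1)]])

lemma sum4_scale_arg:
  assumes "lin4 s F" "x \<in> H4"
  shows "sum4 H (tscale c x) F = s c (sum4 H x F)"
  using assms(2) unfolding sum4_def tpow4_def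
  by (rule tlift_scale[OF lin4_vs[OF assms(1)] lin4_bilinear[OF assms(1)]]) simp

lemma lin5_vs: "lin5 s F \<Longrightarrow> vector_space s"
  by (simp add: lin5_def lin4_def lin3_def lin2_def)

lemma lin5_bilinear: "lin5 s F \<Longrightarrow> bilinear_on H (tpow4 H) s (\<lambda>a y. sum4 H y (F a))"
proof -
  assume F: "lin5 s F"
  have *: "lin4 s (F a)" for a
    using F by (simp add: lin5_def lin4_def lin3_def lin2_def)
  have vs: "vector_space s"
    using *[of 0] by (rule lin4_vs)
  have **: "\<And>a b. F (a + b) = (\<lambda>c d e f. F a c d e f + F b c d e f)"
    "\<And>k a. F (scale H k a) = (\<lambda>b c d e. s k (F a b c d e))"
    using F by (simp_all add: fun_eq_iff lin5_def lin4_def lin3_def lin2_def lin_def)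
  show ?thesis
    unfolding bilinear_on_def
    by (simp add: sum4_add_arg[OF *] sum4_scale_arg[OF *] ** sum_add vs_scale_sum[OF vs])
qed

lemma sum5_pure5:
  assumes "lin5 s F" shows "sum5 H (pure5 H a b c d e) F = F a b c d e"
proof -
  have *: "lin4 s (F a)" for a
    using assms by (simp add: lin5_def lin4_def lin3_def lin2_def)
  show ?thesis
  unfolding sum5_def pure5_def
  by (subst tlift_pure[OF lin5_vs[OF assms] lin5_bilinear[OF assms]]) (simp_all add: sum4_pure4[OF *])
qed

end

section \<open>Multilinearity by syntactic recursion\<close>

named_theorems lin_intros

context quasi_hopf_algebra
begin

lemma lin2I [lin_intros]:
  "vector_space s \<Longrightarrow> (\<And>b. lin s (\<lambda>a. F a b)) \<Longrightarrow> (\<And>a. lin s (\<lambda>b. F a b)) \<Longrightarrow> lin2 s F"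
  by (simp add: lin2_def)

lemma lin3I [lin_intros]:
  "vector_space s \<Longrightarrow> (\<And>b c. lin s (\<lambda>a. F a b c)) \<Longrightarrow> (\<And>a c. lin s (\<lambda>b. F a b c)) \<Longrightarrow>
   (\<And>a b. lin s (\<lambda>c. F a b c)) \<Longrightarrow> lin3 s F"
  by (simp add: lin2_def lin3_def)

lemma lin4I [lin_intros]:
  "vector_space s \<Longrightarrow> (\<And>b c d. lin s (\<lambda>a. F a b c d)) \<Longrightarrow> (\<And>a c d. lin s (\<lambda>b. F a b c d)) \<Longrightarrow>
   (\<And>a b d. lin s (\<lambda>c. F a b c d)) \<Longrightarrow> (\<And>a b c. lin s (\<lambda>d. F a b c d)) \<Longrightarrow> lin4 s F"
  by (simp add: lin2_def lin3_def lin4_def)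

lemma lin5I [lin_intros]:
  "vector_space s \<Longrightarrow> (\<And>b c d e. lin s (\<lambda>a. F a b c d e)) \<Longrightarrow> (\<And>a c d e. lin s (\<lambda>b. F a b c d e)) \<Longrightarrow>
   (\<And>a b d e. lin s (\<lambda>c. F a b c d e)) \<Longrightarrow> (\<And>a b c e. lin s (\<lambda>d. F a b c d e)) \<Longrightarrow>
   (\<And>a b c d. lin s (\<lambda>e. F a b c d e)) \<Longrightarrow> lin5 s F"
  by (simp add: lin2_def lin3_def lin4_def lin5_def)

lemma linD: "lin s f \<Longrightarrow> lin (scale H) g \<Longrightarrow> lin s (\<lambda>x. f (g x))"
  by (simp add: lin_def)

text \<open>Stated for composites with a linear map so that, for a given multilinear summand, these
  facts can be added to \<open>lin_intros\<close> and let the recursion descend into its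
  arguments.\<close>

lemma lin2D:
  assumes "lin2 s F"
  shows "vector_space s"
    "lin (scale H) f \<Longrightarrow> lin s (\<lambda>x. F (f x) b)"
    "lin (scale H) f \<Longrightarrow> lin s (\<lambda>x. F a (f x))"
  using assms by (simp_all add: lin2_def lin_def)

lemma lin3D:
  assumes "lin3 s F"
  shows "vector_space s"
    "lin (scale H) f \<Longrightarrow> lin s (\<lambda>x. F (f x) b c)"
    "lin (scale H) f \<Longrightarrow> lin s (\<lambda>x. F a (f x) c)"
    "lin (scale H) f \<Longrightarrow> lin s (\<lambda>x. F a b (f x))"
  using assms by (simp_all add: lin2_def lin3_def lin_def)

lemma lin4D:
  assumes "lin4 s F"
  shows "vector_space s"
    "lin (scale H) f \<Longrightarrow> lin s (\<lambda>x. F (f x) b c d)"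
    "lin (scale H) f \<Longrightarrow> lin s (\<lambda>x. F a (f x) c d)"
    "lin (scale H) f \<Longrightarrow> lin s (\<lambda>x. F a b (f x) d)"
    "lin (scale H) f \<Longrightarrow> lin s (\<lambda>x. F a b c (f x))"
  using assms by (simp_all add: lin2_def lin3_def lin4_def lin_def)

lemma lin5D:
  assumes "lin5 s F"
  shows "vector_space s"
    "lin (scale H) f \<Longrightarrow> lin s (\<lambda>x. F (f x) b c d e)"
    "lin (scale H) f \<Longrightarrow> lin s (\<lambda>x. F a (f x) c d e)"
    "lin (scale H) f \<Longrightarrow> lin s (\<lambda>x. F a b (f x) d e)"
    "lin (scale H) f \<Longrightarrow> lin s (\<lambda>x. F a b c (f x) e)"
    "lin (scale H) f \<Longrightarrow> lin s (\<lambda>x. F a b c d (f x))"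
  using assms by (simp_all add: lin2_def lin3_def lin4_def lin5_def lin_def)

declare vsH [lin_intros] tscale_vector_space [lin_intros]

lemma vs_field [lin_intros]: "vector_space ((*) :: 'k \<Rightarrow> 'k \<Rightarrow> 'k)"
  by standard (simp_all add: algebra_simps)

lemma lin_id [lin_intros]: "lin (scale H) (\<lambda>x. x)"
  by (simp add: lin_def)
lemma lin_mult1 [lin_intros]: "lin (scale H) f \<Longrightarrow> lin (scale H) (\<lambda>x. a * f x)"
  by (simp add: lin_def algebra_simps scale_mult_right)
lemma lin_mult2 [lin_intros]: "lin (scale H) f \<Longrightarrow> lin (scale H) (\<lambda>x. f x * a)"
  by (simp add: lin_def algebra_simps scale_mult_left)
lemma lin_S [lin_intros]: "lin (scale H) f \<Longrightarrow> lin (scale H) (\<lambda>x. S (f x))"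
  by (simp add: lin_def antipode_add antipode_scale)
lemma lin_eps [lin_intros]: "lin (scale H) f \<Longrightarrow> lin (*) (\<lambda>x. \<epsilon> (f x))"
  by (simp add: lin_def counit_add counit_scale)
lemma lin_scale_left [lin_intros]:
  assumes "vector_space s" "lin (*) f" shows "lin s (\<lambda>x. s (f x) u)"
proof -
  interpret vector_space s by fact
  show ?thesis using assms(2) by (simp add: lin_def scale_left_distrib)
qed

lemma lin_scale_right [lin_intros]:
  assumes "vector_space s" "lin s f" shows "lin s (\<lambda>x. s c (f x))"
proof -
  interpret vector_space s by fact
  show ?thesis using assms(2) by (simp add: lin_def scale_right_distrib mult.commute)
qed

lemma lin_sum [lin_intros]:
  assumes "vector_space s"
  shows "(\<And>a b. lin s (\<lambda>x. f2 x a b)) \<Longrightarrow> lin s (\<lambda>x. sum2 H t2 (f2 x))"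
    "(\<And>a b c. lin s (\<lambda>x. f3 x a b c)) \<Longrightarrow> lin s (\<lambda>x. sum3 H t3 (f3 x))"
    "(\<And>a b c d. lin s (\<lambda>x. f4 x a b c d)) \<Longrightarrow> lin s (\<lambda>x. sum4 H t4 (f4 x))"
    "(\<And>a b c d e. lin s (\<lambda>x. f5 x a b c d e)) \<Longrightarrow> lin s (\<lambda>x. sum5 H t5 (f5 x))"
proof -
  interpret vector_space s by fact
  have hom: "s c (a + b) = s c a + s c b" for c a b
    by (rule scale_right_distrib)
  show "(\<And>a b. lin s (\<lambda>x. f2 x a b)) \<Longrightarrow> lin s (\<lambda>x. sum2 H t2 (f2 x))"
    "(\<And>a b c. lin s (\<lambda>x. f3 x a b c)) \<Longrightarrow> lin s (\<lambda>x. sum3 H t3 (f3 x))"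
    "(\<And>a b c d. lin s (\<lambda>x. f4 x a b c d)) \<Longrightarrow> lin s (\<lambda>x. sum4 H t4 (f4 x))"
    "(\<And>a b c d e. lin s (\<lambda>x. f5 x a b c d e)) \<Longrightarrow> lin s (\<lambda>x. sum5 H t5 (f5 x))"
    unfolding sumN_list
    by (simp_all add: lin_def split_def sum_list_addf additive_sum_list[of "s c" for c, OF hom])
qed

text \<open>Here the tensor summed over varies with \<open>x\<close>, so linearity of the sum in its
  tensor argument is used; in \<open>lin_sum\<close> only the summand varies.\<close>

lemma lin_comult [lin_intros]:
  "lin (scale H) f \<Longrightarrow> lin2 s G \<Longrightarrow> lin s (\<lambda>x. sum2 H (comult H (f x)) G)"
  by (simp add: lin_def comult_add comult_scale sum2_add_arg sum2_scale_arg comult_closed)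

lemma lin_pure1 [lin_intros]:
  "lin (scale H) f \<Longrightarrow> w \<in> carrier W \<Longrightarrow> lin tscale (\<lambda>x. pure H W (f x) w)"
  by (simp add: lin_def pure_add_left pure_scale_left)
lemma lin_pure2: "lin (scale W) f \<Longrightarrow> (\<And>x. f x \<in> carrier W) \<Longrightarrow> lin tscale (\<lambda>x. pure H W v (f x))"
  by (simp add: lin_def pure_add_right pure_scale_right)

lemma lin_pure2' [lin_intros]:
  assumes "lin (scale H) f"
  shows "lin tscale (\<lambda>x. pure2 H (f x) b)" "lin tscale (\<lambda>x. pure2 H a (f x))"
  unfolding pure2_def by (intro lin_pure1 lin_pure2 assms UNIV_H)+

lemma lin_pure3 [lin_intros]:
  assumes "lin (scale H) f"
  shows "lin tscale (\<lambda>x. pure3 H (f x) b c)" "lin tscale (\<lambda>x. pure3 H a (f x) c)"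
    "lin tscale (\<lambda>x. pure3 H a b (f x))"
  unfolding pure3_def
  by (intro lin_pure1 lin_pure2 lin_pure2' assms pure2_closed | simp only: scale_tpow)+

lemma lin_pure4 [lin_intros]:
  assumes "lin (scale H) f"
  shows "lin tscale (\<lambda>x. pure4 H (f x) b c d)" "lin tscale (\<lambda>x. pure4 H a (f x) c d)"
    "lin tscale (\<lambda>x. pure4 H a b (f x) d)" "lin tscale (\<lambda>x. pure4 H a b c (f x))"
  unfolding pure4_def
  by (intro lin_pure1 lin_pure2 lin_pure3 assms pure3_closed | simp only: scale_tpow)+

lemma sum_closed [simp]:
  "(\<And>a b. F2 a b \<in> carrier (tensor_space V W)) \<Longrightarrow> sum2 H x2 F2 \<in> carrier (tensor_space V W)"
  "(\<And>a b c. F3 a b c \<in> carrier (tensor_space V W)) \<Longrightarrow> sum3 H x3 F3 \<in> carrier (tensor_space V W)"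
  "(\<And>a b c d. F4 a b c d \<in> carrier (tensor_space V W)) \<Longrightarrow> sum4 H x4 F4 \<in> carrier (tensor_space V W)"
  "(\<And>a b c d e. F5 a b c d e \<in> carrier (tensor_space V W)) \<Longrightarrow> sum5 H x5 F5 \<in> carrier (tensor_space V W)"
  unfolding sumN_list by (auto intro!: sum_list_in_tensor_space)

lemmas sum_closed_tpow [simp] =
  sum_closed[of _ H H, folded tpow2_def]
  sum_closed[of _ H "tpow2 H", folded tpow3_def]
  sum_closed[of _ H "tpow3 H", folded tpow4_def]

lemma tlift_sum:
  assumes "vector_space s" "bilinear_on V W s F"
  shows "(\<And>a b. G2 a b \<in> carrier (tensor_space V W)) \<Longrightarrow>
      tlift V W (sum2 H x2 G2) F = sum2 H x2 (\<lambda>a b. tlift V W (G2 a b) F)"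
    "(\<And>a b c. G3 a b c \<in> carrier (tensor_space V W)) \<Longrightarrow>
      tlift V W (sum3 H x3 G3) F = sum3 H x3 (\<lambda>a b c. tlift V W (G3 a b c) F)"
    "(\<And>a b c d. G4 a b c d \<in> carrier (tensor_space V W)) \<Longrightarrow>
      tlift V W (sum4 H x4 G4) F = sum4 H x4 (\<lambda>a b c d. tlift V W (G4 a b c d) F)"
    "(\<And>a b c d e. G5 a b c d e \<in> carrier (tensor_space V W)) \<Longrightarrow>
      tlift V W (sum5 H x5 G5) F = sum5 H x5 (\<lambda>a b c d e. tlift V W (G5 a b c d e) F)"
  unfolding sumN_list
  by (subst tlift_additive_arg[OF assms]; auto simp: split_def)+

lemma sum2_sum:
  assumes "lin2 s F"
  shows "(\<And>a b. G2 a b \<in> H2) \<Longrightarrow>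
      sum2 H (sum2 H x2 G2) F = sum2 H x2 (\<lambda>a b. sum2 H (G2 a b) F)"
    "(\<And>a b c. G3 a b c \<in> H2) \<Longrightarrow>
      sum2 H (sum3 H x3 G3) F = sum3 H x3 (\<lambda>a b c. sum2 H (G3 a b c) F)"
    "(\<And>a b c d. G4 a b c d \<in> H2) \<Longrightarrow>
      sum2 H (sum4 H x4 G4) F = sum4 H x4 (\<lambda>a b c d. sum2 H (G4 a b c d) F)"
  unfolding tpow2_def sum2_def[of H _ F]
  by (rule tlift_sum[OF lin2_vs[OF assms] lin2_bilinear[OF assms]], simp)+

lemma sum3_sum:
  assumes "lin3 s F"
  shows "(\<And>a b. G2 a b \<in> H3) \<Longrightarrow>
      sum3 H (sum2 H x2 G2) F = sum2 H x2 (\<lambda>a b. sum3 H (G2 a b) F)"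
    "(\<And>a b c. G3 a b c \<in> H3) \<Longrightarrow>
      sum3 H (sum3 H x3 G3) F = sum3 H x3 (\<lambda>a b c. sum3 H (G3 a b c) F)"
    "(\<And>a b c d. G4 a b c d \<in> H3) \<Longrightarrow>
      sum3 H (sum4 H x4 G4) F = sum4 H x4 (\<lambda>a b c d. sum3 H (G4 a b c d) F)"
  unfolding tpow3_def sum3_def[of H _ F]
  by (rule tlift_sum[OF lin3_vs[OF assms] lin3_bilinear[OF assms]], simp)+

lemma sum4_sum:
  assumes "lin4 s F"
  shows "(\<And>a b. G2 a b \<in> H4) \<Longrightarrow>
      sum4 H (sum2 H x2 G2) F = sum2 H x2 (\<lambda>a b. sum4 H (G2 a b) F)"
    "(\<And>a b c. G3 a b c \<in> H4) \<Longrightarrow>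
      sum4 H (sum3 H x3 G3) F = sum3 H x3 (\<lambda>a b c. sum4 H (G3 a b c) F)"
    "(\<And>a b c d. G4 a b c d \<in> H4) \<Longrightarrow>
      sum4 H (sum4 H x4 G4) F = sum4 H x4 (\<lambda>a b c d. sum4 H (G4 a b c d) F)"
  unfolding tpow4_def sum4_def[of H _ F]
  by (rule tlift_sum[OF lin4_vs[OF assms] lin4_bilinear[OF assms]], simp)+

lemma sum5_sum:
  assumes "lin5 s F"
  shows "(\<And>a b. G2 a b \<in> carrier (tensor_space H (tpow4 H))) \<Longrightarrow>
      sum5 H (sum2 H x2 G2) F = sum2 H x2 (\<lambda>a b. sum5 H (G2 a b) F)"
    "(\<And>a b c. G3 a b c \<in> carrier (tensor_space H (tpow4 H))) \<Longrightarrow>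
      sum5 H (sum3 H x3 G3) F = sum3 H x3 (\<lambda>a b c. sum5 H (G3 a b c) F)"
    "(\<And>a b c d. G4 a b c d \<in> carrier (tensor_space H (tpow4 H))) \<Longrightarrow>
      sum5 H (sum4 H x4 G4) F = sum4 H x4 (\<lambda>a b c d. sum5 H (G4 a b c d) F)"
    "(\<And>a b c d e. G5 a b c d e \<in> carrier (tensor_space H (tpow4 H))) \<Longrightarrow>
      sum5 H (sum5 H x5 G5) F = sum5 H x5 (\<lambda>a b c d e. sum5 H (G5 a b c d e) F)"
  unfolding sum5_def[of H _ F]
  by (rule tlift_sum[OF lin5_vs[OF assms] lin5_bilinear[OF assms]], simp)+

lemma pure5_closed [simp]: "pure5 H a b c d e \<in> carrier (tensor_space H (tpow4 H))"
  by (simp add: pure5_def)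

lemma sum2_id: "x \<in> H2 \<Longrightarrow> sum2 H x (pure2 H) = x"
  unfolding sum2_def tpow2_def pure2_def[abs_def] by (rule tlift_id)

lemma pure_sum_right:
  assumes "list_all (\<lambda>p. F p \<in> carrier (tensor_space V W)) l"
  shows "pure H (tensor_space V W) a (\<Sum>p\<leftarrow>l. F p) = (\<Sum>p\<leftarrow>l. pure H (tensor_space V W) a (F p))"
  using assms
proof (induction l)
  case Nil
  have "pure H (tensor_space V W) a (0 + 0) = pure H (tensor_space V W) a 0 + pure H (tensor_space V W) a 0"
    by (rule pure_add_right) simp_all
  then show ?case by simp
next
  case (Cons p l)
  have "pure H (tensor_space V W) a (F p + (\<Sum>p\<leftarrow>l. F p)) =
    pure H (tensor_space V W) a (F p) + pure H (tensor_space V W) a (\<Sum>p\<leftarrow>l. F p)"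
    using Cons.prems by (intro pure_add_right sum_list_in_tensor_space) (auto simp: list_all_iff)
  with Cons show ?case by simp
qed

lemma pure_sumN_right:
  "(\<And>a b. F2 a b \<in> carrier (tensor_space V W)) \<Longrightarrow>
    pure H (tensor_space V W) u (sum2 H x2 F2) = sum2 H x2 (\<lambda>a b. pure H (tensor_space V W) u (F2 a b))"
  "(\<And>a b c. F3 a b c \<in> carrier (tensor_space V W)) \<Longrightarrow>
    pure H (tensor_space V W) u (sum3 H x3 F3) = sum3 H x3 (\<lambda>a b c. pure H (tensor_space V W) u (F3 a b c))"
  unfolding sumN_list by (subst pure_sum_right; auto simp: list_all_iff split_def)+

lemma sum3_id:
  assumes "x \<in> H3" shows "sum3 H x (pure3 H) = x"
proof -
  have *: "sum2 H y (pure3 H a) = pure H (tpow2 H) a y" if y: "y \<in> H2" for a y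
    using pure_sumN_right(1)[of "pure2 H" H H a y] sum2_id[OF y]
    by (simp add: pure3_def[abs_def] flip: tpow2_def)
  have "sum3 H x (pure3 H) = tlift H (tpow2 H) x (pure H (tpow2 H))"
    using assms unfolding sum3_def tpow3_def by (rule tlift_cong) (rule *)
  with assms show ?thesis
    by (simp add: tlift_id tpow3_def)
qed

lemma sum4_id:
  assumes "x \<in> H4" shows "sum4 H x (pure4 H) = x"
proof -
  have *: "sum3 H y (pure4 H a) = pure H (tpow3 H) a y" if y: "y \<in> H3" for a y
    using pure_sumN_right(2)[of "pure3 H" H "tpow2 H" a y] sum3_id[OF y]
    by (simp add: pure4_def[abs_def] flip: tpow3_def)
  have "sum4 H x (pure4 H) = tlift H (tpow3 H) x (pure H (tpow3 H))"
    using assms unfolding sum4_def tpow4_def by (rule tlift_cong) (rule *)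
  with assms show ?thesis
    by (simp add: tlift_id tpow4_def)
qed

subsection \<open>Sweedler calculus\<close>

lemma sum2_mult2:
  assumes "lin2 s F"
  shows "sum2 H (mult2 H x y) F = sum2 H x (\<lambda>x1 x2. sum2 H y (\<lambda>y1 y2. F (x1 * y1) (x2 * y2)))"
  by (simp add: mult2_def sum2_sum[OF assms] sum2_pure2[OF assms])

lemma sum3_mult3:
  assumes "lin3 s F"
  shows "sum3 H (mult3 H x y) F =
    sum3 H x (\<lambda>x1 x2 x3. sum3 H y (\<lambda>y1 y2 y3. F (x1 * y1) (x2 * y2) (x3 * y3)))"
  by (simp add: mult3_def sum3_sum[OF assms] sum3_pure3[OF assms])

lemma sum4_mult4:
  assumes "lin4 s F"
  shows "sum4 H (mult4 H x y) F =
    sum4 H x (\<lambda>x1 x2 x3 x4. sum4 H y (\<lambda>y1 y2 y3 y4. F (x1 * y1) (x2 * y2) (x3 * y3) (x4 * y4)))"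
  by (simp add: mult4_def sum4_sum[OF assms] sum4_pure4[OF assms])

lemma sum5_mult5:
  assumes "lin5 s F"
  shows "sum5 H (mult5 H x y) F =
    sum5 H x (\<lambda>x1 x2 x3 x4 x5. sum5 H y (\<lambda>y1 y2 y3 y4 y5.
      F (x1 * y1) (x2 * y2) (x3 * y3) (x4 * y4) (x5 * y5)))"
  by (simp add: mult5_def sum5_sum[OF assms] sum5_pure5[OF assms])

lemma mult2_assoc: "mult2 H (mult2 H x y) z = mult2 H x (mult2 H y z)"
proof -
  have "mult2 H (mult2 H x y) z =
    sum2 H (mult2 H x y) (\<lambda>x1 x2. sum2 H z (\<lambda>y1 y2. pure2 H (x1 * y1) (x2 * y2)))"
    by (rule mult2_def)
  also have "\<dots> = sum2 H x (\<lambda>x1 x2. sum2 H y (\<lambda>y1 y2. sum2 H z (\<lambda>z1 z2.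
      pure2 H (x1 * y1 * z1) (x2 * y2 * z2))))"
    by (rule sum2_mult2[where s = tscale]) (intro lin_intros)+
  also have "\<dots> = sum2 H x (\<lambda>x1 x2. sum2 H (mult2 H y z) (\<lambda>y1 y2. pure2 H (x1 * y1) (x2 * y2)))"
    by (subst sum2_mult2[where s = tscale]) (intro lin_intros, simp add: mult.assoc)
  finally show ?thesis
    by (simp add: mult2_def)
qed

lemma mult3_assoc: "mult3 H (mult3 H x y) z = mult3 H x (mult3 H y z)"
proof -
  have "mult3 H (mult3 H x y) z =
    sum3 H (mult3 H x y) (\<lambda>x1 x2 x3. sum3 H z (\<lambda>y1 y2 y3. pure3 H (x1 * y1) (x2 * y2) (x3 * y3)))"
    by (rule mult3_def)
  also have "\<dots> = sum3 H x (\<lambda>x1 x2 x3. sum3 H y (\<lambda>y1 y2 y3. sum3 H z (\<lambda>z1 z2 z3.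
      pure3 H (x1 * y1 * z1) (x2 * y2 * z2) (x3 * y3 * z3))))"
    by (rule sum3_mult3[where s = tscale]) (intro lin_intros)+
  also have "\<dots> = sum3 H x (\<lambda>x1 x2 x3. sum3 H (mult3 H y z) (\<lambda>y1 y2 y3.
      pure3 H (x1 * y1) (x2 * y2) (x3 * y3)))"
    by (subst sum3_mult3[where s = tscale]) (intro lin_intros, simp add: mult.assoc)
  finally show ?thesis
    by (simp add: mult3_def)
qed

lemma mult4_assoc: "mult4 H (mult4 H x y) z = mult4 H x (mult4 H y z)"
proof -
  have "mult4 H (mult4 H x y) z =
    sum4 H (mult4 H x y) (\<lambda>x1 x2 x3 x4. sum4 H z (\<lambda>y1 y2 y3 y4.
      pure4 H (x1 * y1) (x2 * y2) (x3 * y3) (x4 * y4)))"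
    by (rule mult4_def)
  also have "\<dots> = sum4 H x (\<lambda>x1 x2 x3 x4. sum4 H y (\<lambda>y1 y2 y3 y4. sum4 H z (\<lambda>z1 z2 z3 z4.
      pure4 H (x1 * y1 * z1) (x2 * y2 * z2) (x3 * y3 * z3) (x4 * y4 * z4))))"
    by (rule sum4_mult4[where s = tscale]) (intro lin_intros)+
  also have "\<dots> = sum4 H x (\<lambda>x1 x2 x3 x4. sum4 H (mult4 H y z) (\<lambda>y1 y2 y3 y4.
      pure4 H (x1 * y1) (x2 * y2) (x3 * y3) (x4 * y4)))"
    by (subst sum4_mult4[where s = tscale]) (intro lin_intros, simp add: mult.assoc)
  finally show ?thesis
    by (simp add: mult4_def)
qed

lemma mult_closed [simp]:
  "mult2 H x2 y2 \<in> H2" "mult3 H x3 y3 \<in> H3" "mult4 H x4 y4 \<in> H4"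
  by (simp_all add: mult2_def mult3_def mult4_def)

lemma mult2_one:
  assumes "x \<in> H2"
  shows "mult2 H (pure2 H 1 1) x = x" "mult2 H x (pure2 H 1 1) = x"
proof -
  have "mult2 H (pure2 H 1 1) x = sum2 H x (\<lambda>y1 y2. pure2 H (1 * y1) (1 * y2))"
    unfolding mult2_def by (rule sum2_pure2[where s = tscale]) (intro lin_intros)+
  then show "mult2 H (pure2 H 1 1) x = x"
    by (simp add: sum2_id assms)
  have "mult2 H x (pure2 H 1 1) = sum2 H x (\<lambda>y1 y2. pure2 H (y1 * 1) (y2 * 1))"
    unfolding mult2_def by (subst sum2_pure2[where s = tscale]) (intro lin_intros, rule refl)
  then show "mult2 H x (pure2 H 1 1) = x"
    by (simp add: sum2_id assms)
qed

lemma mult3_one: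
  assumes "x \<in> H3"
  shows "mult3 H (pure3 H 1 1 1) x = x" "mult3 H x (pure3 H 1 1 1) = x"
proof -
  have "mult3 H (pure3 H 1 1 1) x = sum3 H x (\<lambda>y1 y2 y3. pure3 H (1 * y1) (1 * y2) (1 * y3))"
    unfolding mult3_def by (rule sum3_pure3[where s = tscale]) (intro lin_intros)+
  then show "mult3 H (pure3 H 1 1 1) x = x"
    by (simp add: sum3_id assms)
  have "mult3 H x (pure3 H 1 1 1) = sum3 H x (\<lambda>y1 y2 y3. pure3 H (y1 * 1) (y2 * 1) (y3 * 1))"
    unfolding mult3_def by (subst sum3_pure3[where s = tscale]) (intro lin_intros, rule refl)
  then show "mult3 H x (pure3 H 1 1 1) = x"
    by (simp add: sum3_id assms)
qed

lemma mult4_one: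
  assumes "x \<in> H4"
  shows "mult4 H (pure4 H 1 1 1 1) x = x" "mult4 H x (pure4 H 1 1 1 1) = x"
proof -
  have "mult4 H (pure4 H 1 1 1 1) x = sum4 H x (\<lambda>y1 y2 y3 y4. pure4 H (1 * y1) (1 * y2) (1 * y3) (1 * y4))"
    unfolding mult4_def by (rule sum4_pure4[where s = tscale]) (intro lin_intros)+
  then show "mult4 H (pure4 H 1 1 1 1) x = x"
    by (simp add: sum4_id assms)
  have "mult4 H x (pure4 H 1 1 1 1) = sum4 H x (\<lambda>y1 y2 y3 y4. pure4 H (y1 * 1) (y2 * 1) (y3 * 1) (y4 * 1))"
    unfolding mult4_def by (subst sum4_pure4[where s = tscale]) (intro lin_intros, rule refl)
  then show "mult4 H x (pure4 H 1 1 1 1) = x"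
    by (simp add: sum4_id assms)
qed

section \<open>Uniqueness of inverses and naturality of the reassociator\<close>

lemma inverse2_eqI: "is_inverse2 H x y \<Longrightarrow> x \<in> H2 \<Longrightarrow> inverse2 H x = y"
  unfolding inverse2_def
proof (rule the_equality)
  fix z assume "is_inverse2 H x y" "is_inverse2 H x z"
  then show "z = y"
    unfolding is_inverse2_def by (metis mult2_assoc mult2_one)
qed

text \<open>Inverses in an associative unital algebra are unique, so the definite description behind
  \<open>reassoc_inv\<close> denotes the inverse whose existence is assumed.\<close>

lemma is_inverse3_reassoc: "is_inverse3 H (reassoc H) (reassoc_inv H)"
proof -
  obtain y where y: "is_inverse3 H (reassoc H) y"
    using reassoc_invertible by blast
  have "reassoc_inv H = y"
    unfolding reassoc_inv_def inverse3_def
  proof (rule the_equality)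
    fix z assume "is_inverse3 H (reassoc H) z"
    with y show "z = y"
      unfolding is_inverse3_def by (metis mult3_assoc mult3_one)
  qed (rule y)
  with y show ?thesis by simp
qed

lemma reassoc_inv_closed: "reassoc_inv H \<in> H3"
  and reassoc_inverse: "mult3 H (reassoc H) (reassoc_inv H) = pure3 H 1 1 1"
    "mult3 H (reassoc_inv H) (reassoc H) = pure3 H 1 1 1"
  using is_inverse3_reassoc by (auto simp: is_inverse3_def)

lemma comult_mult_sum:
  assumes "lin2 s F"
  shows "\<DD> (a * b) F = \<DD> a (\<lambda>a1 a2. \<DD> b (\<lambda>b1 b2. F (a1 * b1) (a2 * b2)))"
  by (simp add: comult_mult sum2_mult2[OF assms])

lemma comult_one_sum: "lin2 s F \<Longrightarrow> \<DD> 1 F = F 1 1"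
  by (simp add: comult_one sum2_pure2)

lemma \<Phi>\<Psi>: "lin3 s F \<Longrightarrow> \<Phi> (\<lambda>x1 x2 x3. \<Psi> (\<lambda>y1 y2 y3. F (x1 * y1) (x2 * y2) (x3 * y3))) = F 1 1 1"
  and \<Psi>\<Phi>: "lin3 s F \<Longrightarrow> \<Psi> (\<lambda>x1 x2 x3. \<Phi> (\<lambda>y1 y2 y3. F (x1 * y1) (x2 * y2) (x3 * y3))) = F 1 1 1"
  using sum3_mult3[of s F "reassoc H" "reassoc_inv H"] sum3_mult3[of s F "reassoc_inv H" "reassoc H"]
  by (simp_all add: reassoc_inverse sum3_pure3)

text \<open>A normal form: sums over \<open>\<phi>\<close> outermost, then those over \<open>\<phi>\<^sup>-\<^sup>1\<close>.\<close>

lemma front: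
  "sum2 H x (\<lambda>a b. \<Phi> (\<lambda>c d e. F1 a b c d e)) = \<Phi> (\<lambda>c d e. sum2 H x (\<lambda>a b. F1 a b c d e))"
  "sum2 H x (\<lambda>a b. \<Psi> (\<lambda>c d e. F2 a b c d e)) = \<Psi> (\<lambda>c d e. sum2 H x (\<lambda>a b. F2 a b c d e))"
  "\<Psi> (\<lambda>a b c. \<Phi> (\<lambda>d e f. F3 a b c d e f)) = \<Phi> (\<lambda>d e f. \<Psi> (\<lambda>a b c. F3 a b c d e f))"
  by (rule sum_swap)+

text \<open>Quasi-coassociativity with the conjugation cleared, by multiplying with \<phi> on the
  right or with its inverse on the left. In this form the two bracketings of an iterated coproduct
  are exchanged across a reassociator.\<close>

lemma reassoc_nat:
  assumes "lin3 s F"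
  shows "\<Phi> (\<lambda>x1 x2 x3. \<DD> h (\<lambda>h1 h2. \<DD> h2 (\<lambda>h21 h22. F (h1 * x1) (h21 * x2) (h22 * x3)))) =
    \<Phi> (\<lambda>x1 x2 x3. \<DD> h (\<lambda>h1 h2. \<DD> h1 (\<lambda>h11 h12. F (x1 * h11) (x2 * h12) (x3 * h2))))" (is ?A)
  and "\<Psi> (\<lambda>x1 x2 x3. \<DD> h (\<lambda>h1 h2. \<DD> h1 (\<lambda>h11 h12. F (h11 * x1) (h12 * x2) (h2 * x3)))) =
    \<Psi> (\<lambda>x1 x2 x3. \<DD> h (\<lambda>h1 h2. \<DD> h2 (\<lambda>h21 h22. F (x1 * h1) (x2 * h21) (x3 * h22))))" (is ?B)
proof -
  let ?l = "\<DD> h (\<lambda>h1 h2. \<DD> h2 (\<lambda>h21 h22. pure3 H h1 h21 h22))"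
  let ?r = "\<DD> h (\<lambda>h1 h2. \<DD> h1 (\<lambda>h11 h12. pure3 H h11 h12 h2))"
  have "mult3 H ?l (reassoc H) = mult3 H (reassoc H) ?r"
    unfolding quasi_coassoc by (simp add: mult3_assoc reassoc_inverse mult3_one)
  then have "sum3 H (mult3 H ?l (reassoc H)) F = sum3 H (mult3 H (reassoc H) ?r) F"
    by simp
  then show ?A
    by (simp add: sum3_mult3[OF assms] sum3_sum[where s = s] sum3_pure3[where s = s] lin_intros lin3D[OF assms] front)
  have "mult3 H (reassoc_inv H) ?l = mult3 H (reassoc_inv H) (mult3 H (mult3 H (reassoc H) ?r) (reassoc_inv H))"
    unfolding quasi_coassoc ..
  also have "\<dots> = mult3 H ?r (reassoc_inv H)"
    by (simp add: mult3_one reassoc_inverse flip: mult3_assoc)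
  finally have "sum3 H (mult3 H ?r (reassoc_inv H)) F = sum3 H (mult3 H (reassoc_inv H) ?l) F"
    by simp
  then show ?B
    apply (simp add: sum3_mult3[OF assms] sum3_sum[where s = s] sum3_pure3[where s = s] lin_intros lin3D[OF assms] front)
    done
qed

subsection \<open>The pentagon and counit identities\<close>

text \<open>\<open>E0\<close> to \<open>E4\<close> are the five coface maps from the third to the
  fourth tensor power: a unit is inserted at an end, or one leg is comultiplied. All are algebra
  maps, so the pentagon becomes a relation between invertible elements and can be solved for any
  subword.\<close>

definition E0 :: "('k, 'h) tensor3 \<Rightarrow> ('k, 'h) tensor4" where
  "E0 t = sum3 H t (\<lambda>x1 x2 x3. pure4 H 1 x1 x2 x3)"
definition E1 :: "('k, 'h) tensor3 \<Rightarrow> ('k, 'h) tensor4" where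
  "E1 t = sum3 H t (\<lambda>x1 x2 x3. \<DD> x1 (\<lambda>x11 x12. pure4 H x11 x12 x2 x3))"
definition E2 :: "('k, 'h) tensor3 \<Rightarrow> ('k, 'h) tensor4" where
  "E2 t = sum3 H t (\<lambda>x1 x2 x3. \<DD> x2 (\<lambda>x21 x22. pure4 H x1 x21 x22 x3))"
definition E3 :: "('k, 'h) tensor3 \<Rightarrow> ('k, 'h) tensor4" where
  "E3 t = sum3 H t (\<lambda>x1 x2 x3. \<DD> x3 (\<lambda>x31 x32. pure4 H x1 x2 x31 x32))"
definition E4 :: "('k, 'h) tensor3 \<Rightarrow> ('k, 'h) tensor4" where
  "E4 t = sum3 H t (\<lambda>x1 x2 x3. pure4 H x1 x2 x3 1)"

lemmas E_defs = E0_def E1_def E2_def E3_def E4_def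

lemma E_closed [simp]:
  "E0 t \<in> H4" "E1 t \<in> H4" "E2 t \<in> H4"
  "E3 t \<in> H4" "E4 t \<in> H4"
  by (simp_all add: E_defs)

lemma sum4_E:
  assumes "lin4 s F"
  shows "sum4 H (E0 t) F = sum3 H t (\<lambda>x1 x2 x3. F 1 x1 x2 x3)"
    "sum4 H (E1 t) F = sum3 H t (\<lambda>x1 x2 x3. \<DD> x1 (\<lambda>x11 x12. F x11 x12 x2 x3))"
    "sum4 H (E2 t) F = sum3 H t (\<lambda>x1 x2 x3. \<DD> x2 (\<lambda>x21 x22. F x1 x21 x22 x3))"
    "sum4 H (E3 t) F = sum3 H t (\<lambda>x1 x2 x3. \<DD> x3 (\<lambda>x31 x32. F x1 x2 x31 x32))"
    "sum4 H (E4 t) F = sum3 H t (\<lambda>x1 x2 x3. F x1 x2 x3 1)"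
  by (simp_all add: E_defs sum4_sum[OF assms] sum4_pure4[OF assms])

lemma sum4_mult4_E:
  assumes "lin4 s F"
  shows "sum4 H (mult4 H (E0 t) u) F = sum3 H t (\<lambda>x1 x2 x3. sum4 H u (\<lambda>a b c d. F a (x1 * b) (x2 * c) (x3 * d)))"
    "sum4 H (mult4 H (E1 t) u) F = sum3 H t (\<lambda>x1 x2 x3. \<DD> x1 (\<lambda>x11 x12.
       sum4 H u (\<lambda>a b c d. F (x11 * a) (x12 * b) (x2 * c) (x3 * d))))"
    "sum4 H (mult4 H (E2 t) u) F = sum3 H t (\<lambda>x1 x2 x3. \<DD> x2 (\<lambda>x21 x22.
       sum4 H u (\<lambda>a b c d. F (x1 * a) (x21 * b) (x22 * c) (x3 * d))))"
    "sum4 H (mult4 H (E3 t) u) F = sum3 H t (\<lambda>x1 x2 x3. \<DD> x3 (\<lambda>x31 x32.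
       sum4 H u (\<lambda>a b c d. F (x1 * a) (x2 * b) (x31 * c) (x32 * d))))"
    "sum4 H (mult4 H (E4 t) u) F = sum3 H t (\<lambda>x1 x2 x3. sum4 H u (\<lambda>a b c d. F (x1 * a) (x2 * b) (x3 * c) d))"
  by (simp_all add: sum4_mult4[OF assms] sum4_E[where s = s] lin_intros lin4D[OF assms])

abbreviation "Es \<equiv> {E0, E1, E2, E3, E4}"
abbreviation "one4 \<equiv> pure4 H 1 1 1 1"
abbreviation mult4_infix (infixr "\<cdot>" 70) where "x \<cdot> y \<equiv> mult4 H x y"
abbreviation "\<phi> \<equiv> reassoc H"
abbreviation "\<psi> \<equiv> reassoc_inv H"

lemma E_mult: "E \<in> Es \<Longrightarrow> E (mult3 H t u) = E t \<cdot> E u"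
  by (auto simp: E_defs mult4_def sum4_sum[where s = tscale] sum4_pure4[where s = tscale]
      sum3_mult3[where s = tscale] comult_mult_sum[where s = tscale] lin_intros
      sum_swap(2)[of _ u])

lemma E_one: "E \<in> Es \<Longrightarrow> E (pure3 H 1 1 1) = one4"
  by (auto simp: E_defs sum3_pure3[where s = tscale] comult_one_sum[where s = tscale] lin_intros)

lemma E_inverse:
  assumes "E \<in> Es"
  shows "E \<phi> \<cdot> E \<psi> = one4" "E \<psi> \<cdot> E \<phi> = one4"
  using E_mult[OF assms, of \<phi> \<psi>] E_mult[OF assms, of \<psi> \<phi>] by (simp_all add: reassoc_inverse E_one[OF assms])

lemma E_cancel:
  assumes "E \<in> Es" "t \<in> H4"
  shows "E \<phi> \<cdot> E \<psi> \<cdot> t = t" "E \<psi> \<cdot> E \<phi> \<cdot> t = t"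
  by (simp_all add: E_inverse[OF assms(1)] mult4_one[OF assms(2)] flip: mult4_assoc)

lemmas E_simps = mult4_assoc mult4_one
  E_inverse[of E0] E_inverse[of E1] E_inverse[of E2] E_inverse[of E3] E_inverse[of E4]
  E_cancel[of E0] E_cancel[of E1] E_cancel[of E2] E_cancel[of E3] E_cancel[of E4]

lemma pentagon_E: "E3 \<phi> \<cdot> E1 \<phi> = E0 \<phi> \<cdot> E2 \<phi> \<cdot> E4 \<phi>"
  using pentagon by (simp add: E_defs mult4_assoc)

text \<open>Obtained by cancelling invertible factors. The chosen forms are those in which later
  proofs find the two coproduct halves of a leg in neighbouring positions.\<close>

lemma pentagon_E_more:
  "E0 \<phi> \<cdot> E2 \<phi> = E3 \<phi> \<cdot> E1 \<phi> \<cdot> E4 \<psi>"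
  "E4 \<phi> \<cdot> E1 \<psi> = E2 \<psi> \<cdot> E0 \<psi> \<cdot> E3 \<phi>"
  "E4 \<psi> = E1 \<psi> \<cdot> E3 \<psi> \<cdot> E0 \<phi> \<cdot> E2 \<phi>"
  "E0 \<psi> \<cdot> E3 \<phi> = E2 \<phi> \<cdot> E4 \<phi> \<cdot> E1 \<psi>"
  "E1 \<phi> \<cdot> E4 \<psi> = E3 \<psi> \<cdot> E0 \<phi> \<cdot> E2 \<phi>"
  "E3 \<psi> \<cdot> E0 \<phi> = E1 \<phi> \<cdot> E4 \<psi> \<cdot> E2 \<psi>"
  "E2 \<psi> \<cdot> E0 \<psi> = E4 \<phi> \<cdot> E1 \<psi> \<cdot> E3 \<psi>"
proof -
  show 1: "E0 \<phi> \<cdot> E2 \<phi> = E3 \<phi> \<cdot> E1 \<phi> \<cdot> E4 \<psi>"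
    using arg_cong[OF pentagon_E, of "\<lambda>t. t \<cdot> E4 \<psi>"] by (simp add: E_simps)
  show 3: "E4 \<psi> = E1 \<psi> \<cdot> E3 \<psi> \<cdot> E0 \<phi> \<cdot> E2 \<phi>"
    by (simp add: 1 E_simps)
  show 4: "E0 \<psi> \<cdot> E3 \<phi> = E2 \<phi> \<cdot> E4 \<phi> \<cdot> E1 \<psi>"
    using arg_cong[OF pentagon_E, of "\<lambda>t. E0 \<psi> \<cdot> t \<cdot> E1 \<psi>"] by (simp add: E_simps)
  show "E4 \<phi> \<cdot> E1 \<psi> = E2 \<psi> \<cdot> E0 \<psi> \<cdot> E3 \<phi>"
    by (simp add: 4 E_simps)
  show 5: "E1 \<phi> \<cdot> E4 \<psi> = E3 \<psi> \<cdot> E0 \<phi> \<cdot> E2 \<phi>"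
    by (simp add: 1 E_simps)
  show 6: "E3 \<psi> \<cdot> E0 \<phi> = E1 \<phi> \<cdot> E4 \<psi> \<cdot> E2 \<psi>"
    using arg_cong[OF 5, of "\<lambda>t. t \<cdot> E2 \<psi>"] by (simp add: E_simps)
  show "E2 \<psi> \<cdot> E0 \<psi> = E4 \<phi> \<cdot> E1 \<psi> \<cdot> E3 \<psi>"
    using arg_cong[OF 6, of "\<lambda>t. E4 \<phi> \<cdot> E1 \<psi> \<cdot> t \<cdot> E0 \<psi>"]
    by (simp add: E_simps)
qed

text \<open>The pentagon and its seven solved forms evaluated on a quadrilinear summand, in the
  order of \<open>pentagon_E\<close> followed by \<open>pentagon_E_more\<close>.\<close>

lemma pentagon_sum:
  assumes F: "lin4 s F"
  shows
  "\<Phi> (\<lambda>x1 x2 x3. \<Phi> (\<lambda>y1 y2 y3. \<DD> x3 (\<lambda>x31 x32. \<DD> y1 (\<lambda>y11 y12.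
     F (x1 * y11) (x2 * y12) (x31 * y2) (x32 * y3))))) =
   \<Phi> (\<lambda>x1 x2 x3. \<Phi> (\<lambda>y1 y2 y3. \<Phi> (\<lambda>z1 z2 z3. \<DD> y2 (\<lambda>y21 y22.
     F (y1 * z1) (x1 * (y21 * z2)) (x2 * (y22 * z3)) (x3 * y3)))))"
  "\<Phi> (\<lambda>x1 x2 x3. \<Phi> (\<lambda>y1 y2 y3. \<DD> y2 (\<lambda>y21 y22.
     F y1 (x1 * y21) (x2 * y22) (x3 * y3)))) =
   \<Phi> (\<lambda>x1 x2 x3. \<Phi> (\<lambda>y1 y2 y3. \<Psi> (\<lambda>z1 z2 z3. \<DD> x3 (\<lambda>x31 x32. \<DD> y1 (\<lambda>y11 y12.
     F (x1 * (y11 * z1)) (x2 * (y12 * z2)) (x31 * (y2 * z3)) (x32 * y3))))))"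
  "\<Phi> (\<lambda>x1 x2 x3. \<Psi> (\<lambda>y1 y2 y3. \<DD> y1 (\<lambda>y11 y12.
     F (x1 * y11) (x2 * y12) (x3 * y2) y3))) =
   \<Phi> (\<lambda>x1 x2 x3. \<Psi> (\<lambda>y1 y2 y3. \<Psi> (\<lambda>z1 z2 z3. \<DD> y2 (\<lambda>y21 y22. \<DD> x3 (\<lambda>x31 x32.
     F (y1 * x1) (y21 * (z1 * x2)) (y22 * (z2 * x31)) (y3 * (z3 * x32)))))))"
  "\<Psi> (\<lambda>x1 x2 x3. F x1 x2 x3 1) =
   \<Phi> (\<lambda>x1 x2 x3. \<Phi> (\<lambda>y1 y2 y3. \<Psi> (\<lambda>z1 z2 z3. \<Psi> (\<lambda>w1 w2 w3.
     \<DD> z1 (\<lambda>z11 z12. \<DD> w3 (\<lambda>w31 w32. \<DD> y2 (\<lambda>y21 y22.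
     F (z11 * (w1 * y1)) (z12 * (w2 * (x1 * y21))) (z2 * (w31 * (x2 * y22))) (z3 * (w32 * (x3 * y3))))))))))"
  "\<Phi> (\<lambda>x1 x2 x3. \<Psi> (\<lambda>y1 y2 y3. \<DD> x3 (\<lambda>x31 x32.
     F x1 (y1 * x2) (y2 * x31) (y3 * x32)))) =
   \<Phi> (\<lambda>x1 x2 x3. \<Phi> (\<lambda>y1 y2 y3. \<Psi> (\<lambda>z1 z2 z3. \<DD> x2 (\<lambda>x21 x22. \<DD> z1 (\<lambda>z11 z12.
     F (x1 * (y1 * z11)) (x21 * (y2 * z12)) (x22 * (y3 * z2)) (x3 * z3))))))"
  "\<Phi> (\<lambda>x1 x2 x3. \<Psi> (\<lambda>y1 y2 y3. \<DD> x1 (\<lambda>x11 x12.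
     F (x11 * y1) (x12 * y2) (x2 * y3) x3))) =
   \<Phi> (\<lambda>x1 x2 x3. \<Phi> (\<lambda>y1 y2 y3. \<Psi> (\<lambda>z1 z2 z3. \<DD> z3 (\<lambda>z31 z32. \<DD> y2 (\<lambda>y21 y22.
     F (z1 * y1) (z2 * (x1 * y21)) (z31 * (x2 * y22)) (z32 * (x3 * y3)))))))"
  "\<Phi> (\<lambda>x1 x2 x3. \<Psi> (\<lambda>y1 y2 y3. \<DD> y3 (\<lambda>y31 y32.
     F y1 (y2 * x1) (y31 * x2) (y32 * x3)))) =
   \<Phi> (\<lambda>x1 x2 x3. \<Psi> (\<lambda>y1 y2 y3. \<Psi> (\<lambda>z1 z2 z3. \<DD> x1 (\<lambda>x11 x12. \<DD> z2 (\<lambda>z21 z22.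
     F (x11 * (y1 * z1)) (x12 * (y2 * z21)) (x2 * (y3 * z22)) (x3 * z3))))))"
  "\<Psi> (\<lambda>x1 x2 x3. \<Psi> (\<lambda>y1 y2 y3. \<DD> x2 (\<lambda>x21 x22.
     F x1 (x21 * y1) (x22 * y2) (x3 * y3)))) =
   \<Phi> (\<lambda>x1 x2 x3. \<Psi> (\<lambda>y1 y2 y3. \<Psi> (\<lambda>z1 z2 z3. \<DD> y1 (\<lambda>y11 y12. \<DD> z3 (\<lambda>z31 z32.
     F (x1 * (y11 * z1)) (x2 * (y12 * z2)) (x3 * (y2 * z31)) (y3 * z32))))))"
  using arg_cong[OF pentagon_E, of "\<lambda>t. sum4 H t F"]
    pentagon_E_more[THEN arg_cong, of "\<lambda>t. sum4 H t F"]
  by (simp_all only: sum4_mult4_E[where s = s] sum4_E[where s = s] lin_intros lin4D[OF F] front F mult_1_left mult_1_right)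

section \<open>Counits of the reassociator and of its inverse\<close>

lemma lin_hom:
  assumes "lin s f"
  shows "f (sum2 H t2 G2) = sum2 H t2 (\<lambda>a b. f (G2 a b))"
    "f (sum3 H t3 G3) = sum3 H t3 (\<lambda>a b c. f (G3 a b c))"
  using assms by (auto simp: lin_def intro!: sum_hom)

lemma lin_scale: "lin s f \<Longrightarrow> f (scale H c a) = s c (f a)"
  by (simp add: lin_def)

lemma counit_sum:
  assumes "lin s f"
  shows "\<DD> h (\<lambda>h1 h2. s (\<epsilon> h1) (f h2)) = f h" "\<DD> h (\<lambda>h1 h2. s (\<epsilon> h2) (f h1)) = f h"
  using arg_cong[OF counit_left, of f h] arg_cong[OF counit_right, of f h]
  by (simp_all add: lin_hom[OF assms] lin_scale[OF assms])

lemma antipode_sum: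
  assumes "lin s f"
  shows "\<DD> h (\<lambda>h1 h2. f (S h1 * (\<alpha> * h2))) = s (\<epsilon> h) (f \<alpha>)"
    "\<DD> h (\<lambda>h1 h2. f (h1 * (\<beta> * S h2))) = s (\<epsilon> h) (f \<beta>)"
  using arg_cong[OF antipode_left, of f h] arg_cong[OF antipode_right, of f h]
  by (simp_all add: lin_hom[OF assms] lin_scale[OF assms] mult.assoc)

lemma reassoc_counit2:
  assumes "lin2 s F"
  shows "\<Phi> (\<lambda>x1 x2 x3. s (\<epsilon> x2) (F x1 x3)) = F 1 1"
proof -
  have "sum2 H (\<Phi> (\<lambda>x1 x2 x3. tscale (\<epsilon> x2) (pure2 H x1 x3))) F = F 1 1"
    by (simp add: reassoc_counit sum2_pure2[OF assms])
  moreover have "tscale c (pure2 H a b) \<in> H2" for c a b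
    by (simp add: tpow2_def pure2_def tscale_in_tensor_space)
  ultimately show ?thesis
    by (simp add: sum2_sum[OF assms] sum2_scale_arg[OF assms] sum2_pure2[OF assms])
qed

lemma vs_simps:
  assumes "vector_space s"
  shows "s c (s d x) = s (c * d) x" "s 1 x = x"
    "s c (sum2 H x2 F2) = sum2 H x2 (\<lambda>a b. s c (F2 a b))"
    "s c (sum3 H x3 F3) = sum3 H x3 (\<lambda>a b d. s c (F3 a b d))"
  using vector_space.vector_space_assms(3,4)[OF assms] by (auto simp: vs_scale_sum[OF assms])

text \<open>The middle equation comes first, so that the bound sums on both sides of a known identity
  can be reordered by the simplifier after its instantiation.\<close>

lemma via: "b = c \<Longrightarrow> a = b \<Longrightarrow> c = d \<Longrightarrow> a = d"
  by simp

lemmas sweedler = mult.assoc antipode_mult counit_mult front mult.commute[where 'a = 'k]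
  mult.left_commute[where 'a = 'k]

text \<open>The counit on the third leg of the pentagon gives
  \<open>\<phi> = \<phi> (u \<otimes> 1)\<close>, where \<open>u\<close> is \<phi> with the counit
  on its third leg. Cancelling \<phi> on the left leaves \<open>u = 1 \<otimes> 1\<close>.\<close>

lemma reassoc_counit3:
  assumes F: "lin2 s F"
  shows "\<Phi> (\<lambda>x1 x2 x3. s (\<epsilon> x3) (F x1 x2)) = F 1 1"
proof -
  note vs = lin2_vs[OF F]
  note simps = sweedler vs_simps[OF vs]
  have *: "\<Phi> (\<lambda>x1 x2 x3. G x1 x2 x3) =
    \<Phi> (\<lambda>y1 y2 y3. \<Phi> (\<lambda>z1 z2 z3. s (\<epsilon> z3) (G (y1 * z1) (y2 * z2) y3)))" if G: "lin3 s G" for G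
  proof -
    note [lin_intros] = lin3D[OF G]
    have "\<Phi> (\<lambda>x1 x2 x3. G x1 x2 x3) = \<Phi> (\<lambda>x1 x2 x3. \<Phi> (\<lambda>y1 y2 y3. s (\<epsilon> y2) (\<DD> y1 (\<lambda>y11 y12. G (x1 * y11) (x2 * y12) (x3 * y3)))))"
      by (subst reassoc_counit2[where s = s]; (intro lin_intros)?) (simp add: comult_one_sum[where s = s] lin_intros)
    also have "\<dots> = \<Phi> (\<lambda>x1 x2 x3. \<Phi> (\<lambda>y1 y2 y3. \<DD> x3 (\<lambda>x31 x32. s (\<epsilon> x31) (\<DD> y1 (\<lambda>y11 y12. s (\<epsilon> y2) (G (x1 * y11) (x2 * y12) (x32 * y3)))))))"
      by (subst counit_sum[where s = s]; (intro lin_intros vs)?) (simp add: simps)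
    also have "\<dots> = \<Phi> (\<lambda>x1 x2 x3. \<Phi> (\<lambda>y1 y2 y3. \<Phi> (\<lambda>z1 z2 z3. s (\<epsilon> x2) (\<DD> y2 (\<lambda>y21 y22.
        s (\<epsilon> y22) (s (\<epsilon> z3) (G (y1 * z1) (x1 * (y21 * z2)) (x3 * y3))))))))"
      by (rule via[OF pentagon_sum(1)[where s = s and F = "\<lambda>a b c d. s (\<epsilon> c) (G a b d)"]])
        (intro lin_intros vs | simp add: simps)+
    also have "\<dots> = \<Phi> (\<lambda>x1 x2 x3. \<Phi> (\<lambda>y1 y2 y3. \<Phi> (\<lambda>z1 z2 z3. s (\<epsilon> x2) (s (\<epsilon> z3) (G (y1 * z1) (x1 * (y2 * z2)) (x3 * y3))))))"
      by (subst counit_sum[where s = s]; (intro lin_intros vs)?) simp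
    also have "\<dots> = \<Phi> (\<lambda>x1 x2 x3. s (\<epsilon> x2) (\<Phi> (\<lambda>y1 y2 y3. \<Phi> (\<lambda>z1 z2 z3. s (\<epsilon> z3) (G (y1 * z1) (x1 * (y2 * z2)) (x3 * y3))))))"
      by (simp add: simps)
    also have "\<dots> = \<Phi> (\<lambda>y1 y2 y3. \<Phi> (\<lambda>z1 z2 z3. s (\<epsilon> z3) (G (y1 * z1) (1 * (y2 * z2)) (1 * y3))))"
      by (rule reassoc_counit2) (intro lin_intros vs)+
    finally show ?thesis by simp
  qed
  \<comment> \<open>The unit is written as the product of the inverse and \<phi> under the counit,
    so that \<open>*\<close> can be applied to this copy of \<phi>, which is then cancelled
    again.\<close>
  have "F 1 1 = \<Phi> (\<lambda>x1 x2 x3. \<Psi> (\<lambda>w1 w2 w3. s (\<epsilon> (w3 * x3)) (F (w1 * x1) (w2 * x2))))"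
    by (rule via[OF \<Psi>\<Phi>[where s = s and F = "\<lambda>a b c. s (\<epsilon> c) (F a b)", symmetric]])
      (intro lin_intros vs lin2D[OF F] | simp add: counit_one simps)+
  also have "\<dots> = \<Phi> (\<lambda>y1 y2 y3. \<Phi> (\<lambda>z1 z2 z3. s (\<epsilon> z3) (\<Psi> (\<lambda>w1 w2 w3. s (\<epsilon> (w3 * y3)) (F (w1 * (y1 * z1)) (w2 * (y2 * z2)))))))"
    by (rule *) (intro lin_intros vs lin2D[OF F])+
  also have "\<dots> = \<Phi> (\<lambda>z1 z2 z3. s (\<epsilon> z3) (\<Psi> (\<lambda>w1 w2 w3. \<Phi> (\<lambda>y1 y2 y3. s (\<epsilon> (w3 * y3)) (F (w1 * y1 * z1) (w2 * y2 * z2))))))"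
    by (subst sum_swap(3)) (simp add: simps)
  also have "\<dots> = \<Phi> (\<lambda>z1 z2 z3. s (\<epsilon> z3) (s (\<epsilon> 1) (F (1 * z1) (1 * z2))))"
    by (subst \<Psi>\<Phi>[where s = s and F = "\<lambda>a b c. s (\<epsilon> c) (F (a * _) (b * _))"]; (intro lin_intros vs lin2D[OF F])?) simp
  finally show ?thesis by (simp add: counit_one simps)
qed

text \<open>Mirror argument: the counit on the second leg of the pentagon gives
  \<open>\<phi> = (1 \<otimes> u) \<phi>\<close>, and \<phi> is cancelled on the right.\<close>

lemma reassoc_counit1:
  assumes F: "lin2 s F"
  shows "\<Phi> (\<lambda>x1 x2 x3. s (\<epsilon> x1) (F x2 x3)) = F 1 1"
proof -
  note vs = lin2_vs[OF F]
  note simps = sweedler vs_simps[OF vs]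
  have *: "\<Phi> (\<lambda>x1 x2 x3. G x1 x2 x3) =
    \<Phi> (\<lambda>y1 y2 y3. \<Phi> (\<lambda>x1 x2 x3. s (\<epsilon> x1) (G y1 (x2 * y2) (x3 * y3))))" if G: "lin3 s G" for G
  proof -
    note [lin_intros] = lin3D[OF G]
    have "\<Phi> (\<lambda>y1 y2 y3. G y1 y2 y3) = \<Phi> (\<lambda>y1 y2 y3. \<Phi> (\<lambda>x1 x2 x3. s (\<epsilon> x2) (\<DD> x3 (\<lambda>x31 x32. G (x1 * y1) (x31 * y2) (x32 * y3)))))"
      by (subst reassoc_counit2[where s = s]; (intro lin_intros)?) (simp add: comult_one_sum[where s = s] lin_intros)
    also have "\<dots> = \<Phi> (\<lambda>y1 y2 y3. \<Phi> (\<lambda>x1 x2 x3. \<DD> y1 (\<lambda>y11 y12. s (\<epsilon> y12) (\<DD> x3 (\<lambda>x31 x32. s (\<epsilon> x2) (G (x1 * y11) (x31 * y2) (x32 * y3)))))))"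
      by (subst counit_sum[where s = s]; (intro lin_intros vs)?) (simp add: simps)
    also have "\<dots> = \<Phi> (\<lambda>x1 x2 x3. \<Phi> (\<lambda>y1 y2 y3. \<DD> x3 (\<lambda>x31 x32. \<DD> y1 (\<lambda>y11 y12. s (\<epsilon> (x2 * y12)) (G (x1 * y11) (x31 * y2) (x32 * y3))))))"
      apply (subst sum_swap(3)) apply (subst sum_swap(1)) by (simp add: simps)
    also have "\<dots> = \<Phi> (\<lambda>x1 x2 x3. \<Phi> (\<lambda>y1 y2 y3. \<Phi> (\<lambda>z1 z2 z3. s (\<epsilon> z2) (\<DD> y2 (\<lambda>y21 y22.
        s (\<epsilon> y21) (s (\<epsilon> x1) (G (y1 * z1) (x2 * (y22 * z3)) (x3 * y3))))))))"
      by (rule via[OF pentagon_sum(1)[where s = s and F = "\<lambda>a b c d. s (\<epsilon> b) (G a c d)"]])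
        (intro lin_intros vs | simp add: simps)+
    also have "\<dots> = \<Phi> (\<lambda>x1 x2 x3. \<Phi> (\<lambda>y1 y2 y3. \<Phi> (\<lambda>z1 z2 z3. s (\<epsilon> z2) (s (\<epsilon> x1) (G (y1 * z1) (x2 * (y2 * z3)) (x3 * y3))))))"
      by (subst counit_sum[where s = s]; (intro lin_intros vs)?) simp
    also have "\<dots> = \<Phi> (\<lambda>x1 x2 x3. \<Phi> (\<lambda>y1 y2 y3. s (\<epsilon> x1) (G (y1 * 1) (x2 * (y2 * 1)) (x3 * y3))))"
      by (subst reassoc_counit2[where s = s]; (intro lin_intros vs)?) simp
    also have "\<dots> = \<Phi> (\<lambda>y1 y2 y3. \<Phi> (\<lambda>x1 x2 x3. s (\<epsilon> x1) (G y1 (x2 * y2) (x3 * y3))))"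
      by (subst sum_swap(3)) simp
    finally show ?thesis .
  qed
  have "F 1 1 = \<Phi> (\<lambda>x1 x2 x3. \<Psi> (\<lambda>w1 w2 w3. s (\<epsilon> (x1 * w1)) (F (x2 * w2) (x3 * w3))))"
    by (rule via[OF \<Phi>\<Psi>[where s = s and F = "\<lambda>a b c. s (\<epsilon> a) (F b c)", symmetric]])
      (intro lin_intros vs lin2D[OF F] | simp add: counit_one simps)+
  also have "\<dots> = \<Phi> (\<lambda>y1 y2 y3. \<Phi> (\<lambda>z1 z2 z3. s (\<epsilon> z1) (\<Psi> (\<lambda>w1 w2 w3. s (\<epsilon> (y1 * w1)) (F (z2 * y2 * w2) (z3 * y3 * w3))))))"
    by (rule *) (intro lin_intros vs lin2D[OF F])+
  also have "\<dots> = \<Phi> (\<lambda>z1 z2 z3. s (\<epsilon> z1) (\<Phi> (\<lambda>y1 y2 y3. \<Psi> (\<lambda>w1 w2 w3. s (\<epsilon> (y1 * w1)) (F (z2 * (y2 * w2)) (z3 * (y3 * w3)))))))"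
    by (subst sum_swap(3)) (simp add: simps)
  also have "\<dots> = \<Phi> (\<lambda>z1 z2 z3. s (\<epsilon> z1) (s (\<epsilon> 1) (F (z2 * 1) (z3 * 1))))"
    by (subst \<Phi>\<Psi>[where s = s and F = "\<lambda>a b c. s (\<epsilon> a) (F (_ * b) (_ * c))"]; (intro lin_intros vs lin2D[OF F])?) simp
  finally show ?thesis by (simp add: counit_one simps)
qed

text \<open>Applying the counit to one leg is an algebra map, so triviality passes from \<phi> to
  its inverse.\<close>

lemma reassoc_inv_counit:
  assumes F: "lin2 s F"
  shows "\<Psi> (\<lambda>x1 x2 x3. s (\<epsilon> x1) (F x2 x3)) = F 1 1"
    "\<Psi> (\<lambda>x1 x2 x3. s (\<epsilon> x2) (F x1 x3)) = F 1 1"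
    "\<Psi> (\<lambda>x1 x2 x3. s (\<epsilon> x3) (F x1 x2)) = F 1 1"
proof -
  note vs = lin2_vs[OF F]
  note simps = sweedler vs_simps[OF vs] counit_one
  note [lin_intros] = lin2D[OF F]
  have "\<Psi> (\<lambda>x1 x2 x3. s (\<epsilon> x1) (F x2 x3)) =
    \<Phi> (\<lambda>y1 y2 y3. s (\<epsilon> y1) (\<Psi> (\<lambda>x1 x2 x3. s (\<epsilon> x1) (F (x2 * y2) (x3 * y3)))))"
    by (subst reassoc_counit1[where s = s]; (intro lin_intros vs)?) simp
  also have "\<dots> = F 1 1"
    by (rule via[OF \<Psi>\<Phi>[where s = s and F = "\<lambda>a b c. s (\<epsilon> a) (F b c)"]])
      (intro lin_intros vs | simp add: simps)+
  finally show "\<Psi> (\<lambda>x1 x2 x3. s (\<epsilon> x1) (F x2 x3)) = F 1 1" .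
  have "\<Psi> (\<lambda>x1 x2 x3. s (\<epsilon> x2) (F x1 x3)) =
    \<Phi> (\<lambda>y1 y2 y3. s (\<epsilon> y2) (\<Psi> (\<lambda>x1 x2 x3. s (\<epsilon> x2) (F (x1 * y1) (x3 * y3)))))"
    by (subst reassoc_counit2[where s = s]; (intro lin_intros vs)?) simp
  also have "\<dots> = F 1 1"
    by (rule via[OF \<Psi>\<Phi>[where s = s and F = "\<lambda>a b c. s (\<epsilon> b) (F a c)"]])
      (intro lin_intros vs | simp add: simps)+
  finally show "\<Psi> (\<lambda>x1 x2 x3. s (\<epsilon> x2) (F x1 x3)) = F 1 1" .
  have "\<Psi> (\<lambda>x1 x2 x3. s (\<epsilon> x3) (F x1 x2)) =
    \<Phi> (\<lambda>y1 y2 y3. s (\<epsilon> y3) (\<Psi> (\<lambda>x1 x2 x3. s (\<epsilon> x3) (F (x1 * y1) (x2 * y2)))))"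
    by (subst reassoc_counit3[where s = s]; (intro lin_intros vs)?) simp
  also have "\<dots> = F 1 1"
    by (rule via[OF \<Psi>\<Phi>[where s = s and F = "\<lambda>a b c. s (\<epsilon> c) (F a b)"]])
      (intro lin_intros vs | simp add: simps)+
  finally show "\<Psi> (\<lambda>x1 x2 x3. s (\<epsilon> x3) (F x1 x2)) = F 1 1" .
qed

subsection \<open>The elements \<open>\<gamma>\<close> and \<open>\<delta>\<close>\<close>

abbreviation "\<gamma> \<equiv> a_elem H"

text \<open>The companion of \<open>a_elem\<close> built from \<beta>. In the pair antipode on the
  tensor square, \<gamma> takes the role of \<alpha> and this element that of \<beta>.\<close>

definition \<delta> :: "('k, 'h) tensor2" where
  "\<delta> = \<Phi> (\<lambda>x1 x2 x3. \<Psi> (\<lambda>y1 y2 y3. \<DD> x1 (\<lambda>x11 x12.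
     pure2 H (x11 * y1 * \<beta> * S x3) (x12 * y2 * \<beta> * S (x2 * y3)))))"

text \<open>The antipode axiom turns a leg whose halves surround \<alpha> into its counit, and the
  counit of a leg trivialises the whole reassociator. This is the basic move for discarding a
  reassociator that the pentagon produces.\<close>

lemma reassoc_alpha:
  assumes K: "lin3 s K"
  shows "\<Phi> (\<lambda>x1 x2 x3. \<DD> x2 (\<lambda>a b. K x1 (S a * (\<alpha> * b)) x3)) = K 1 \<alpha> 1"
    "\<Phi> (\<lambda>x1 x2 x3. \<DD> x3 (\<lambda>a b. K x1 x2 (S a * (\<alpha> * b)))) = K 1 1 \<alpha>"
    "\<Psi> (\<lambda>x1 x2 x3. \<DD> x2 (\<lambda>a b. K x1 (S a * (\<alpha> * b)) x3)) = K 1 \<alpha> 1"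
    "\<Psi> (\<lambda>x1 x2 x3. \<DD> x3 (\<lambda>a b. K x1 x2 (S a * (\<alpha> * b)))) = K 1 1 \<alpha>"
proof -
  note [lin_intros] = lin3D[OF K]
  have 2: "\<DD> h (\<lambda>a b. K u (S a * (\<alpha> * b)) v) = s (\<epsilon> h) (K u \<alpha> v)" for h u v
    by (rule antipode_sum(1)[where f = "\<lambda>z. K u z v"]) (intro lin_intros)+
  have 3: "\<DD> h (\<lambda>a b. K u v (S a * (\<alpha> * b))) = s (\<epsilon> h) (K u v \<alpha>)" for h u v
    by (rule antipode_sum(1)[where f = "\<lambda>z. K u v z"]) (intro lin_intros)+
  show "\<Phi> (\<lambda>x1 x2 x3. \<DD> x2 (\<lambda>a b. K x1 (S a * (\<alpha> * b)) x3)) = K 1 \<alpha> 1"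
    unfolding 2 by (rule reassoc_counit2) (intro lin_intros)+
  show "\<Phi> (\<lambda>x1 x2 x3. \<DD> x3 (\<lambda>a b. K x1 x2 (S a * (\<alpha> * b)))) = K 1 1 \<alpha>"
    unfolding 3 by (rule reassoc_counit3) (intro lin_intros)+
  show "\<Psi> (\<lambda>x1 x2 x3. \<DD> x2 (\<lambda>a b. K x1 (S a * (\<alpha> * b)) x3)) = K 1 \<alpha> 1"
    unfolding 2 by (rule reassoc_inv_counit) (intro lin_intros)+
  show "\<Psi> (\<lambda>x1 x2 x3. \<DD> x3 (\<lambda>a b. K x1 x2 (S a * (\<alpha> * b)))) = K 1 1 \<alpha>"
    unfolding 3 by (rule reassoc_inv_counit) (intro lin_intros)+
qed

lemma reassoc_beta:
  assumes K: "lin3 s K"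
  shows "\<Phi> (\<lambda>x1 x2 x3. \<DD> x2 (\<lambda>a b. K x1 (a * (\<beta> * S b)) x3)) = K 1 \<beta> 1"
    "\<Phi> (\<lambda>x1 x2 x3. \<DD> x3 (\<lambda>a b. K x1 x2 (a * (\<beta> * S b)))) = K 1 1 \<beta>"
    "\<Psi> (\<lambda>x1 x2 x3. \<DD> x1 (\<lambda>a b. K (a * (\<beta> * S b)) x2 x3)) = K \<beta> 1 1"
    "\<Psi> (\<lambda>x1 x2 x3. \<DD> x3 (\<lambda>a b. K x1 x2 (a * (\<beta> * S b)))) = K 1 1 \<beta>"
proof -
  note [lin_intros] = lin3D[OF K]
  have 1: "\<DD> h (\<lambda>a b. K (a * (\<beta> * S b)) u v) = s (\<epsilon> h) (K \<beta> u v)" for h u v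
    by (rule antipode_sum(2)[where f = "\<lambda>z. K z u v"]) (intro lin_intros)+
  have 2: "\<DD> h (\<lambda>a b. K u (a * (\<beta> * S b)) v) = s (\<epsilon> h) (K u \<beta> v)" for h u v
    by (rule antipode_sum(2)[where f = "\<lambda>z. K u z v"]) (intro lin_intros)+
  have 3: "\<DD> h (\<lambda>a b. K u v (a * (\<beta> * S b))) = s (\<epsilon> h) (K u v \<beta>)" for h u v
    by (rule antipode_sum(2)[where f = "\<lambda>z. K u v z"]) (intro lin_intros)+
  show "\<Phi> (\<lambda>x1 x2 x3. \<DD> x2 (\<lambda>a b. K x1 (a * (\<beta> * S b)) x3)) = K 1 \<beta> 1"
    unfolding 2 by (rule reassoc_counit2) (intro lin_intros)+
  show "\<Phi> (\<lambda>x1 x2 x3. \<DD> x3 (\<lambda>a b. K x1 x2 (a * (\<beta> * S b)))) = K 1 1 \<beta>"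
    unfolding 3 by (rule reassoc_counit3) (intro lin_intros)+
  show "\<Psi> (\<lambda>x1 x2 x3. \<DD> x1 (\<lambda>a b. K (a * (\<beta> * S b)) x2 x3)) = K \<beta> 1 1"
    unfolding 1 by (rule reassoc_inv_counit) (intro lin_intros)+
  show "\<Psi> (\<lambda>x1 x2 x3. \<DD> x3 (\<lambda>a b. K x1 x2 (a * (\<beta> * S b)))) = K 1 1 \<beta>"
    unfolding 3 by (rule reassoc_inv_counit) (intro lin_intros)+
qed

lemma sum_gamma:
  assumes "lin2 s K"
  shows "sum2 H \<gamma> K = \<Phi> (\<lambda>x1 x2 x3. \<Psi> (\<lambda>y1 y2 y3. \<DD> x3 (\<lambda>x31 x32.
    K (S x2 * (S y1 * (\<alpha> * (y2 * x31)))) (S x1 * (\<alpha> * (y3 * x32))))))"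
  unfolding a_elem_def by (simp add: sum2_sum[OF assms] sum2_pure2[OF assms] mult.assoc antipode_mult)

lemma sum_delta:
  assumes "lin2 s K"
  shows "sum2 H \<delta> K = \<Phi> (\<lambda>x1 x2 x3. \<Psi> (\<lambda>y1 y2 y3. \<DD> x1 (\<lambda>x11 x12.
    K (x11 * (y1 * (\<beta> * S x3))) (x12 * (y2 * (\<beta> * (S y3 * S x2)))))))"
  unfolding \<delta>_def by (simp add: sum2_sum[OF assms] sum2_pure2[OF assms] mult.assoc antipode_mult)

lemma gamma_closed [simp]: "\<gamma> \<in> H2"
  by (simp add: a_elem_def)
lemma delta_closed [simp]: "\<delta> \<in> H2"
  by (simp add: \<delta>_def)

text \<open>The pentagon shifts the coproduct from the third leg of \<phi> to the first leg of the
  inverse. The additional \<phi> this creates has its split middle leg around one \<alpha> and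
  collapses.\<close>

lemma sum_gamma_alt:
  assumes K: "lin2 s K"
  shows "sum2 H \<gamma> K = \<Phi> (\<lambda>x1 x2 x3. \<Psi> (\<lambda>y1 y2 y3. \<DD> y1 (\<lambda>y11 y12.
    K (S y12 * (S x2 * (\<alpha> * (x3 * y2)))) (S y11 * (S x1 * (\<alpha> * y3))))))"
proof -
  note [lin_intros] = lin2D[OF K]
  have "sum2 H \<gamma> K = \<Phi> (\<lambda>x1 x2 x3. \<DD> x2 (\<lambda>x21 x22. \<Phi> (\<lambda>y1 y2 y3. \<Psi> (\<lambda>z1 z2 z3. \<DD> z1 (\<lambda>z11 z12.
    K (S z12 * (S y2 * (S x21 * (\<alpha> * (x22 * (y3 * z2)))))) (S z11 * (S y1 * (S x1 * (\<alpha> * (x3 * z3))))))))))"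
    by (rule via[OF pentagon_sum(5)[where s = s and F = "\<lambda>a b c d. K (S b * (\<alpha> * c)) (S a * (\<alpha> * d))"]])
      (intro lin_intros | simp add: sweedler sum_gamma[OF K])+
  also have "\<dots> = \<Phi> (\<lambda>y1 y2 y3. \<Psi> (\<lambda>z1 z2 z3. \<DD> z1 (\<lambda>z11 z12.
    K (S z12 * (S y2 * (\<alpha> * (y3 * z2)))) (S z11 * (S y1 * (\<alpha> * z3))))))"
    by (rule via[OF reassoc_alpha(1)[where s = s and K = "\<lambda>a m c. \<Phi> (\<lambda>y1 y2 y3. \<Psi> (\<lambda>z1 z2 z3. \<DD> z1 (\<lambda>z11 z12.
    K (S z12 * (S y2 * (m * (y3 * z2)))) (S z11 * (S y1 * (S a * (\<alpha> * (c * z3))))))))"]])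
      (intro lin_intros | simp add: sweedler antipode_one)+
  finally show ?thesis .
qed

lemma sum2_cong: "(\<And>a b. F a b = G a b) \<Longrightarrow> sum2 H t F = sum2 H t G"
  by presburger
lemma sum3_cong: "(\<And>a b c. F a b c = G a b c) \<Longrightarrow> sum3 H t F = sum3 H t G"
  by presburger

section \<open>Antipode axioms for gamma and delta, in legs\<close>

lemma alpha_nat:
  assumes K: "lin2 s K"
  shows "\<Psi> (\<lambda>y1 y2 y3. \<DD> h (\<lambda>h1 h2. \<DD> h2 (\<lambda>h21 h22.
      K (S h1 * (S y1 * (\<alpha> * (y2 * h21)))) (y3 * h22)))) =
    \<Psi> (\<lambda>y1 y2 y3. K (S y1 * (\<alpha> * y2)) (h * y3))" (is "?L = ?R")
proof -
  note [lin_intros] = lin2D[OF K]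
  have *: "\<DD> u (\<lambda>u1 u2. K (S y1 * (S u1 * (\<alpha> * (u2 * y2)))) (v * y3)) = s (\<epsilon> u) (K (S y1 * (\<alpha> * y2)) (v * y3))"
    for u v y1 y2 y3
    by (rule via[OF antipode_sum(1)[where h = u and s = s and f = "\<lambda>z. K (S y1 * (z * y2)) (v * y3)"]])
      (intro lin_intros | simp add: sweedler)+
  have "?L =
    \<Psi> (\<lambda>y1 y2 y3. \<DD> h (\<lambda>h1 h2. \<DD> h1 (\<lambda>h11 h12.
      K (S y1 * (S h11 * (\<alpha> * (h12 * y2)))) (h2 * y3))))"
    by (rule via[OF reassoc_nat(2)[symmetric, where h = h and s = s and F = "\<lambda>a b c. K (S a * (\<alpha> * b)) c"]])
      (intro lin_intros | simp add: sweedler)+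
  also have "\<dots> = \<Psi> (\<lambda>y1 y2 y3. \<DD> h (\<lambda>h1 h2. s (\<epsilon> h1) (K (S y1 * (\<alpha> * y2)) (h2 * y3))))"
    by (simp only: *)
  also have "\<dots> = ?R"
    by (subst counit_sum[where s = s]; (intro lin_intros)?) simp
  finally show ?thesis .
qed

text \<open>The two copies of \<alpha> in \<gamma> act in turn: after \<open>reassoc_nat\<close>,
  \<open>alpha_nat\<close> moves the inner coproduct of \<open>h2\<close> past the inverse
  reassociator, and then \<open>S h1\<close> and \<open>h2\<close> meet around the remaining
  \<alpha>. This is the \<alpha>-axiom for the pair antipode.\<close>

lemma gamma_nat:
  assumes K: "lin2 s K"
  shows "sum2 H \<gamma> (\<lambda>g1 g2. \<DD> h (\<lambda>h1 h2. \<DD> h1 (\<lambda>h11 h12. \<DD> h2 (\<lambda>h21 h22.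
    K (S h12 * (g1 * h21)) (S h11 * (g2 * h22)))))) = s (\<epsilon> h) (sum2 H \<gamma> K)" (is "?L = _")
proof -
  note [lin_intros] = lin2D[OF K]
  have inner: "\<Psi> (\<lambda>y1 y2 y3. \<DD> h2 (\<lambda>h21 h22. \<DD> h22 (\<lambda>h221 h222. \<DD> x3 (\<lambda>x31 x32.
     K (S x2 * (S h21 * (S y1 * (\<alpha> * (y2 * (h221 * x31)))))) (S x1 * (S h1 * (\<alpha> * (y3 * (h222 * x32))))))))) =
    \<Psi> (\<lambda>y1 y2 y3. \<DD> x3 (\<lambda>x31 x32.
     K (S x2 * (S y1 * (\<alpha> * (y2 * x31)))) (S x1 * (S h1 * (\<alpha> * (h2 * (y3 * x32)))))))" for x1 x2 x3 h1 h2
    by (rule via[OF alpha_nat[where h = h2 and s = s and K = "\<lambda>a b. \<DD> x3 (\<lambda>x31 x32.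
      K (S x2 * (a * x31)) (S x1 * (S h1 * (\<alpha> * (b * x32)))))"]])
     (intro lin_intros | simp add: sweedler)+
  have collapse: "\<DD> h (\<lambda>h1 h2. \<Psi> (\<lambda>y1 y2 y3. \<DD> x3 (\<lambda>x31 x32.
     K (S x2 * (S y1 * (\<alpha> * (y2 * x31)))) (S x1 * (S h1 * (\<alpha> * (h2 * (y3 * x32)))))))) =
    s (\<epsilon> h) (\<Psi> (\<lambda>y1 y2 y3. \<DD> x3 (\<lambda>x31 x32.
     K (S x2 * (S y1 * (\<alpha> * (y2 * x31)))) (S x1 * (\<alpha> * (y3 * x32))))))" for x1 x2 x3
    by (rule via[OF antipode_sum(1)[where s = s and h = h and f = "\<lambda>z. \<Psi> (\<lambda>y1 y2 y3. \<DD> x3 (\<lambda>x31 x32.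
     K (S x2 * (S y1 * (\<alpha> * (y2 * x31)))) (S x1 * (z * (y3 * x32)))))"]])
     (intro lin_intros | simp add: sweedler)+
  have "?L =
   \<Phi> (\<lambda>x1 x2 x3. \<Psi> (\<lambda>y1 y2 y3. \<DD> h (\<lambda>h1 h2. \<DD> h1 (\<lambda>h11 h12. \<DD> x3 (\<lambda>x31 x32. \<DD> h2 (\<lambda>h21 h22.
     K (S h12 * (S x2 * (S y1 * (\<alpha> * (y2 * (x31 * h21)))))) (S h11 * (S x1 * (\<alpha> * (y3 * (x32 * h22)))))))))))"
    apply (subst sum_gamma[where s = s], (intro lin_intros)?)
    apply (subst sum_swap(1), subst (2) sum_swap(1))
    by (simp add: sweedler)
  also have "\<dots> = \<Phi> (\<lambda>x1 x2 x3. \<Psi> (\<lambda>y1 y2 y3. \<DD> h (\<lambda>h1 h2. \<DD> h2 (\<lambda>h21 h22. \<DD> h22 (\<lambda>h221 h222. \<DD> x3 (\<lambda>x31 x32.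
     K (S x2 * (S h21 * (S y1 * (\<alpha> * (y2 * (h221 * x31)))))) (S x1 * (S h1 * (\<alpha> * (y3 * (h222 * x32)))))))))))"
    by (rule via[OF reassoc_nat(1)[symmetric, where h = h and s = s and F = "\<lambda>a b c. \<Psi> (\<lambda>y1 y2 y3. \<DD> c (\<lambda>c1 c2.
      K (S b * (S y1 * (\<alpha> * (y2 * c1)))) (S a * (\<alpha> * (y3 * c2)))))"]])
     (intro lin_intros | simp add: sweedler comult_mult_sum[where s = s] lin_intros)+
  also have "\<dots> = \<Phi> (\<lambda>x1 x2 x3. s (\<epsilon> h) (\<Psi> (\<lambda>y1 y2 y3. \<DD> x3 (\<lambda>x31 x32.
     K (S x2 * (S y1 * (\<alpha> * (y2 * x31)))) (S x1 * (\<alpha> * (y3 * x32)))))))"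
    by (subst front(2)[symmetric]) (simp only: inner collapse)
  also have "\<dots> = s (\<epsilon> h) (sum2 H \<gamma> K)"
    by (simp add: sum_gamma[OF K] vs_simps[OF lin2_vs[OF K]])
  finally show ?thesis .
qed

lemma front_gamma_delta:
  "\<DD> h (\<lambda>a b. sum2 H \<gamma> (\<lambda>c d. F1 a b c d)) = sum2 H \<gamma> (\<lambda>c d. \<DD> h (\<lambda>a b. F1 a b c d))"
  "\<DD> h (\<lambda>a b. sum2 H \<delta> (\<lambda>c d. F2 a b c d)) = sum2 H \<delta> (\<lambda>c d. \<DD> h (\<lambda>a b. F2 a b c d))"
  "sum2 H \<delta> (\<lambda>a b. sum2 H \<gamma> (\<lambda>c d. F3 a b c d)) = sum2 H \<gamma> (\<lambda>c d. sum2 H \<delta> (\<lambda>a b. F3 a b c d))"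
  by (rule sum_swap)+

text \<open>\<open>reassoc_nat\<close> brings the two halves of the second factor of
  \<open>h\<close> together around \<beta>, where they reduce to a counit; the other factor comes
  out on the right.\<close>

lemma beta_nat:
  assumes K: "lin2 s K"
  shows "\<Psi> (\<lambda>y1 y2 y3. \<DD> h (\<lambda>h1 h2. \<DD> h1 (\<lambda>h11 h12.
      K (h11 * y1) (h12 * (y2 * (\<beta> * (S y3 * S h2))))))) =
    \<Psi> (\<lambda>y1 y2 y3. K (y1 * h) (y2 * (\<beta> * S y3)))" (is "?L = ?R")
proof -
  note [lin_intros] = lin2D[OF K]
  have *: "\<DD> u (\<lambda>u1 u2. K v (y2 * (u1 * (\<beta> * (S u2 * S y3))))) = s (\<epsilon> u) (K v (y2 * (\<beta> * S y3)))"
    for u v y2 y3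
    by (rule via[OF antipode_sum(2)[where h = u and s = s and f = "\<lambda>z. K v (y2 * (z * S y3))"]])
      (intro lin_intros | simp add: sweedler)+
  have "?L =
    \<Psi> (\<lambda>y1 y2 y3. \<DD> h (\<lambda>h1 h2. \<DD> h2 (\<lambda>h21 h22.
      K (y1 * h1) (y2 * (h21 * (\<beta> * (S h22 * S y3)))))))"
    by (rule via[OF reassoc_nat(2)[where h = h and s = s and F = "\<lambda>a b c. K a (b * (\<beta> * S c))"]])
      (intro lin_intros | simp add: sweedler)+
  also have "\<dots> = \<Psi> (\<lambda>y1 y2 y3. \<DD> h (\<lambda>h1 h2. s (\<epsilon> h2) (K (y1 * h1) (y2 * (\<beta> * S y3)))))"
    by (simp only: *)
  also have "\<dots> = ?R"
    by (subst counit_sum[where s = s]; (intro lin_intros)?) simp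
  finally show ?thesis .
qed

text \<open>Mirror image of \<open>gamma_nat\<close>, with \<open>beta_nat\<close> for the inner
  coproduct and the \<beta>-axiom for the outer one.\<close>

lemma delta_nat:
  assumes K: "lin2 s K"
  shows "sum2 H \<delta> (\<lambda>d1 d2. \<DD> h (\<lambda>h1 h2. \<DD> h1 (\<lambda>h11 h12. \<DD> h2 (\<lambda>h21 h22.
    K (h11 * (d1 * S h22)) (h12 * (d2 * S h21)))))) = s (\<epsilon> h) (sum2 H \<delta> K)" (is "?L = _")
proof -
  note [lin_intros] = lin2D[OF K]
  have inner: "\<Psi> (\<lambda>y1 y2 y3. \<DD> h1 (\<lambda>h11 h12. \<DD> h11 (\<lambda>h111 h112. \<DD> x1 (\<lambda>x11 x12.
     K (x11 * (h111 * (y1 * (\<beta> * (S h2 * S x3))))) (x12 * (h112 * (y2 * (\<beta> * (S y3 * (S h12 * S x2))))))))))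
   = \<Psi> (\<lambda>y1 y2 y3. \<DD> x1 (\<lambda>x11 x12.
     K (x11 * (y1 * (h1 * (\<beta> * (S h2 * S x3))))) (x12 * (y2 * (\<beta> * (S y3 * S x2))))))" for x1 x2 x3 h1 h2
    by (rule via[OF beta_nat[where h = h1 and s = s and K = "\<lambda>a b. \<DD> x1 (\<lambda>x11 x12.
      K (x11 * (a * (\<beta> * (S h2 * S x3)))) (x12 * (b * S x2)))"]])
     (intro lin_intros | simp add: sweedler)+
  have collapse: "\<DD> h (\<lambda>h1 h2. \<Psi> (\<lambda>y1 y2 y3. \<DD> x1 (\<lambda>x11 x12.
     K (x11 * (y1 * (h1 * (\<beta> * (S h2 * S x3))))) (x12 * (y2 * (\<beta> * (S y3 * S x2)))))))
   = s (\<epsilon> h) (\<Psi> (\<lambda>y1 y2 y3. \<DD> x1 (\<lambda>x11 x12.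
     K (x11 * (y1 * (\<beta> * S x3))) (x12 * (y2 * (\<beta> * (S y3 * S x2)))))))" for x1 x2 x3
    by (rule via[OF antipode_sum(2)[where s = s and h = h and f = "\<lambda>z. \<Psi> (\<lambda>y1 y2 y3. \<DD> x1 (\<lambda>x11 x12.
     K (x11 * (y1 * (z * S x3))) (x12 * (y2 * (\<beta> * (S y3 * S x2))))))"]])
     (intro lin_intros | simp add: sweedler)+
  have "?L =
   \<Phi> (\<lambda>x1 x2 x3. \<Psi> (\<lambda>y1 y2 y3. \<DD> h (\<lambda>h1 h2. \<DD> h2 (\<lambda>h21 h22. \<DD> h1 (\<lambda>h11 h12. \<DD> x1 (\<lambda>x11 x12.
    K (h11 * (x11 * (y1 * (\<beta> * (S x3 * S h22))))) (h12 * (x12 * (y2 * (\<beta> * (S y3 * (S x2 * S h21))))))))))))"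
    apply (subst sum_delta[where s = s], (intro lin_intros)?)
    apply (subst sum_swap(1), subst (2) sum_swap(1), subst (3) sum_swap(1), subst (2) sum_swap(1))
    by (simp add: sweedler)
  also have "\<dots> = \<Phi> (\<lambda>x1 x2 x3. \<Psi> (\<lambda>y1 y2 y3. \<DD> h (\<lambda>h1 h2. \<DD> h1 (\<lambda>h11 h12. \<DD> x1 (\<lambda>x11 x12. \<DD> h11 (\<lambda>h111 h112.
     K (x11 * (h111 * (y1 * (\<beta> * (S h2 * S x3))))) (x12 * (h112 * (y2 * (\<beta> * (S y3 * (S h12 * S x2))))))))))))"
    by (rule via[OF reassoc_nat(1)[where h = h and s = s and F = "\<lambda>a b c. \<Psi> (\<lambda>y1 y2 y3. \<DD> a (\<lambda>a1 a2.
      K (a1 * (y1 * (\<beta> * S c))) (a2 * (y2 * (\<beta> * (S y3 * S b))))))"]])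
     (intro lin_intros | simp add: sweedler comult_mult_sum[where s = s] lin_intros)+
  also have "\<dots> = \<Phi> (\<lambda>x1 x2 x3. s (\<epsilon> h) (\<Psi> (\<lambda>y1 y2 y3. \<DD> x1 (\<lambda>x11 x12.
     K (x11 * (y1 * (\<beta> * S x3))) (x12 * (y2 * (\<beta> * (S y3 * S x2))))))))"
    by (subst (2) sum_swap(1), subst front(2)[symmetric]) (simp only: inner collapse)
  also have "\<dots> = s (\<epsilon> h) (sum2 H \<delta> K)"
    by (simp add: sum_delta[OF K] vs_simps[OF lin2_vs[OF K]])
  finally show ?thesis .
qed

text \<open>The \<phi> inside \<delta> sits under the coproduct in its first leg and under
  \<open>S\<close> in the other two, exactly like the inverse multiplied on from outside. The two
  cancel, and only the inner inverse of \<delta> survives.\<close>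

lemma delta_cancel:
  assumes K: "lin2 s K"
  shows "\<Psi> (\<lambda>y1 y2 y3. sum2 H \<delta> (\<lambda>d1 d2. \<DD> y1 (\<lambda>y11 y12. K (y11 * (d1 * S y3)) (y12 * (d2 * S y2))))) =
    \<Psi> (\<lambda>y1 y2 y3. K (y1 * \<beta>) (y2 * (\<beta> * S y3)))" (is "?L = ?R")
proof -
  note [lin_intros] = lin2D[OF K]
  have "?L =
    \<Phi> (\<lambda>x1 x2 x3. \<Psi> (\<lambda>y1 y2 y3. \<Psi> (\<lambda>r1 r2 r3. \<DD> y1 (\<lambda>y11 y12. \<DD> x1 (\<lambda>x11 x12.
     K (y11 * (x11 * (r1 * (\<beta> * (S x3 * S y3))))) (y12 * (x12 * (r2 * (\<beta> * (S r3 * (S x2 * S y2)))))))))))"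
    apply (subst sum_delta[where s = s], (intro lin_intros)?)
    by (subst sum_swap(1)) (simp add: sweedler)
  also have "\<dots> = ?R"
    by (rule via[OF \<Psi>\<Phi>[where s = s and F = "\<lambda>a b c. \<Psi> (\<lambda>r1 r2 r3. \<DD> a (\<lambda>a1 a2.
       K (a1 * (r1 * (\<beta> * S c))) (a2 * (r2 * (\<beta> * (S r3 * S b))))))"]])
     (intro lin_intros | simp add: sweedler comult_mult_sum[where s = s] comult_one_sum[where s = s] lin_intros antipode_one)+
  finally show ?thesis .
qed

text \<open>In the alternative form of \<gamma> the inverse reassociator stands next to the outer
  \<phi> in all three legs, so the two cancel.\<close>

lemma gamma_cancel:
  assumes K: "lin2 s K"
  shows "\<Phi> (\<lambda>x1 x2 x3. sum2 H \<gamma> (\<lambda>g1 g2. \<DD> x1 (\<lambda>x11 x12. K (S x12 * (g1 * x2)) (S x11 * (g2 * x3))))) =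
    \<Phi> (\<lambda>t1 t2 t3. K (S t2 * (\<alpha> * t3)) (S t1 * \<alpha>))" (is "?L = ?R")
proof -
  note [lin_intros] = lin2D[OF K]
  have "?L =
    \<Phi> (\<lambda>x1 x2 x3. \<Phi> (\<lambda>t1 t2 t3. \<Psi> (\<lambda>r1 r2 r3. \<DD> r1 (\<lambda>r11 r12. \<DD> x1 (\<lambda>x11 x12.
     K (S x12 * (S r12 * (S t2 * (\<alpha> * (t3 * (r2 * x2)))))) (S x11 * (S r11 * (S t1 * (\<alpha> * (r3 * x3))))))))))"
    by (subst sum_gamma_alt[where s = s], (intro lin_intros)?) (simp add: sweedler)
  also have "\<dots> = \<Phi> (\<lambda>t1 t2 t3. \<Phi> (\<lambda>x1 x2 x3. \<Psi> (\<lambda>r1 r2 r3. \<DD> r1 (\<lambda>r11 r12. \<DD> x1 (\<lambda>x11 x12.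
     K (S x12 * (S r12 * (S t2 * (\<alpha> * (t3 * (r2 * x2)))))) (S x11 * (S r11 * (S t1 * (\<alpha> * (r3 * x3))))))))))"
    by (rule sum_swap)
  also have "\<dots> = ?R"
  proof (rule sum3_cong)
    fix t1 t2 t3
    show "\<Phi> (\<lambda>x1 x2 x3. \<Psi> (\<lambda>r1 r2 r3. \<DD> r1 (\<lambda>r11 r12. \<DD> x1 (\<lambda>x11 x12.
     K (S x12 * (S r12 * (S t2 * (\<alpha> * (t3 * (r2 * x2)))))) (S x11 * (S r11 * (S t1 * (\<alpha> * (r3 * x3))))))))) =
     K (S t2 * (\<alpha> * t3)) (S t1 * \<alpha>)"
      by (rule via[OF \<Psi>\<Phi>[where s = s and F = "\<lambda>a b c. \<DD> a (\<lambda>a1 a2.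
       K (S a2 * (S t2 * (\<alpha> * (t3 * b)))) (S a1 * (S t1 * (\<alpha> * c))))"]])
     (intro lin_intros | simp add: sweedler comult_mult_sum[where s = s] comult_one_sum[where s = s] lin_intros antipode_one)+
  qed
  finally show ?thesis .
qed

section \<open>Zigzag identities\<close>

lemma zigzag_sum:
  assumes "lin s f"
  shows "\<Phi> (\<lambda>x1 x2 x3. f (x1 * (\<beta> * (S x2 * (\<alpha> * x3))))) = f 1"
    "\<Psi> (\<lambda>x1 x2 x3. f (S x1 * (\<alpha> * (x2 * (\<beta> * S x3))))) = f 1"
  using arg_cong[OF reassoc_antipode, of f] arg_cong[OF reassoc_inv_antipode, of f]
  by (simp_all add: lin_hom[OF assms] mult.assoc)

text \<open>The zigzag axiom for \<phi> with a spectator leg. The pentagon adds one reassociator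
  collapsing around \<alpha> and one collapsing around \<beta>; what is left is the original
  axiom.\<close>

lemma zigzag_left:
  assumes K: "lin2 s K"
  shows "\<Phi> (\<lambda>v1 v2 v3. \<Psi> (\<lambda>r1 r2 r3. \<DD> v3 (\<lambda>v31 v32.
    K (v1 * (\<beta> * (S v2 * (S r1 * (\<alpha> * (r2 * v31)))))) (r3 * v32)))) = K 1 1" (is "?L = _")
proof -
  note [lin_intros] = lin2D[OF K]
  have "?L =
   \<Phi> (\<lambda>x1 x2 x3. \<DD> x2 (\<lambda>x21 x22. \<Phi> (\<lambda>y1 y2 y3. \<Psi> (\<lambda>z1 z2 z3. \<DD> z1 (\<lambda>z11 z12.
    K (x1 * (y1 * (z11 * (\<beta> * (S z12 * (S y2 * (S x21 * (\<alpha> * (x22 * (y3 * z2)))))))))) (x3 * z3))))))"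
    by (rule via[OF pentagon_sum(5)[where s = s and F = "\<lambda>a b c d. K (a * (\<beta> * (S b * (\<alpha> * c)))) d"]])
      (intro lin_intros | simp add: sweedler)+
  also have "\<dots> = \<Phi> (\<lambda>y1 y2 y3. \<Psi> (\<lambda>z1 z2 z3. \<DD> z1 (\<lambda>z11 z12.
    K (y1 * (z11 * (\<beta> * (S z12 * (S y2 * (\<alpha> * (y3 * z2))))))) z3)))"
    by (rule via[OF reassoc_alpha(1)[where s = s and K = "\<lambda>a m c. \<Phi> (\<lambda>y1 y2 y3. \<Psi> (\<lambda>z1 z2 z3. \<DD> z1 (\<lambda>z11 z12.
    K (a * (y1 * (z11 * (\<beta> * (S z12 * (S y2 * (m * (y3 * z2)))))))) (c * z3))))"]])
      (intro lin_intros | simp add: sweedler)+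
  also have "\<dots> = \<Phi> (\<lambda>y1 y2 y3. K (y1 * (\<beta> * (S y2 * (\<alpha> * y3)))) 1)"
    by (rule via[OF reassoc_beta(3)[where s = s and K = "\<lambda>m b c. \<Phi> (\<lambda>y1 y2 y3.
    K (y1 * (m * (S y2 * (\<alpha> * (y3 * b))))) c)"]])
      (intro lin_intros | simp add: sweedler)+
  also have "\<dots> = K 1 1"
    by (rule zigzag_sum(1)[where s = s and f = "\<lambda>z. K z 1"]) (intro lin_intros)+
  finally show ?thesis .
qed

text \<open>In terms of p = \<open>pR\<close> and q = \<open>qR\<close> this is the relation
  \<open>\<Delta>(q1) p (1 \<otimes> S(q2)) = 1 \<otimes> 1\<close>, written without the inverse
  antipode because \<open>S(q2)\<close> is \<open>S(\<phi>2) \<alpha> \<phi>3\<close>.\<close>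

lemma zigzag_right:
  assumes K: "lin2 s K"
  shows "\<Phi> (\<lambda>u1 u2 u3. \<Psi> (\<lambda>y1 y2 y3. \<DD> u1 (\<lambda>u11 u12.
    K (u11 * y1) (u12 * (y2 * (\<beta> * (S y3 * (S u2 * (\<alpha> * u3))))))))) = K 1 1" (is "?L = _")
proof -
  note [lin_intros] = lin2D[OF K]
  have "?L =
   \<Phi> (\<lambda>x1 x2 x3. \<Phi> (\<lambda>y1 y2 y3. \<Psi> (\<lambda>z1 z2 z3. \<DD> z3 (\<lambda>z31 z32. \<DD> y2 (\<lambda>y21 y22.
    K (z1 * y1) (z2 * (x1 * (y21 * (\<beta> * (S y22 * (S x2 * (S z31 * (\<alpha> * (z32 * (x3 * y3)))))))))))))))"
    by (rule via[OF pentagon_sum(6)[where s = s and F = "\<lambda>a b c d. K a (b * (\<beta> * (S c * (\<alpha> * d))))"]])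
      (intro lin_intros | simp add: sweedler)+
  also have "\<dots> = \<Phi> (\<lambda>x1 x2 x3. \<Phi> (\<lambda>y1 y2 y3. \<DD> y2 (\<lambda>y21 y22.
    K y1 (x1 * (y21 * (\<beta> * (S y22 * (S x2 * (\<alpha> * (x3 * y3))))))))))"
    by (rule via[OF reassoc_alpha(4)[where s = s and K = "\<lambda>a b m. \<Phi> (\<lambda>x1 x2 x3. \<Phi> (\<lambda>y1 y2 y3. \<DD> y2 (\<lambda>y21 y22.
    K (a * y1) (b * (x1 * (y21 * (\<beta> * (S y22 * (S x2 * (m * (x3 * y3)))))))))))"]])
      (intro lin_intros | simp add: sweedler)+
  also have "\<dots> = \<Phi> (\<lambda>y1 y2 y3. \<DD> y2 (\<lambda>y21 y22. \<Phi> (\<lambda>x1 x2 x3.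
    K y1 (x1 * (y21 * (\<beta> * (S y22 * (S x2 * (\<alpha> * (x3 * y3))))))))))"
    by (subst sum_swap(3)) (simp only: front)
  also have "\<dots> = \<Phi> (\<lambda>x1 x2 x3. K 1 (x1 * (\<beta> * (S x2 * (\<alpha> * x3)))))"
    by (rule via[OF reassoc_beta(1)[where s = s and K = "\<lambda>a m c. \<Phi> (\<lambda>x1 x2 x3.
    K a (x1 * (m * (S x2 * (\<alpha> * (x3 * c))))))"]])
      (intro lin_intros | simp add: sweedler)+
  also have "\<dots> = K 1 1"
    by (rule zigzag_sum(1)[where s = s and f = "\<lambda>z. K 1 z"]) (intro lin_intros)+
  finally show ?thesis .
qed

text \<open>The companion relation of p and q, in which q is multiplied by the coproduct of
  \<open>p1\<close> and closed up with \<open>p2\<close>. The antipode has been applied to the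
  closing leg, so that no inverse antipode occurs.\<close>

lemma zigzag_inv:
  assumes K: "lin2 s K"
  shows "\<Phi> (\<lambda>t1 t2 t3. \<Psi> (\<lambda>w1 w2 w3. \<DD> w1 (\<lambda>w11 w12.
    K (S w12 * (S t2 * (\<alpha> * (t3 * (w2 * (\<beta> * S w3)))))) (t1 * w11)))) = K 1 1" (is "?L = _")
proof -
  note [lin_intros] = lin2D[OF K]
  have "?L =
   \<Psi> (\<lambda>y1 y2 y3. \<DD> y2 (\<lambda>y21 y22. \<Phi> (\<lambda>x1 x2 x3. \<DD> x3 (\<lambda>x31 x32. \<Psi> (\<lambda>z1 z2 z3.
    K (S x2 * (S z1 * (S y21 * (\<alpha> * (y22 * (z2 * (x31 * (\<beta> * (S x32 * (S z3 * S y3)))))))))) (y1 * x1))))))"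
    by (rule via[OF pentagon_sum(3)[where s = s and F = "\<lambda>a b c d. K (S b * (\<alpha> * (c * (\<beta> * S d)))) a"]])
      (intro lin_intros | simp add: sweedler)+
  also have "\<dots> = \<Phi> (\<lambda>x1 x2 x3. \<DD> x3 (\<lambda>x31 x32. \<Psi> (\<lambda>z1 z2 z3.
    K (S x2 * (S z1 * (\<alpha> * (z2 * (x31 * (\<beta> * (S x32 * S z3))))))) x1)))"
    by (rule via[OF reassoc_alpha(3)[where s = s and K = "\<lambda>a m c. \<Phi> (\<lambda>x1 x2 x3. \<DD> x3 (\<lambda>x31 x32. \<Psi> (\<lambda>z1 z2 z3.
    K (S x2 * (S z1 * (m * (z2 * (x31 * (\<beta> * (S x32 * (S z3 * S c)))))))) (a * x1))))"]])
      (intro lin_intros | simp add: sweedler antipode_one)+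
  also have "\<dots> = \<Psi> (\<lambda>x1 x2 x3. K (S x1 * (\<alpha> * (x2 * (\<beta> * S x3)))) 1)"
    by (rule via[OF reassoc_beta(2)[where s = s and K = "\<lambda>a b m. \<Psi> (\<lambda>z1 z2 z3.
    K (S b * (S z1 * (\<alpha> * (z2 * (m * S z3))))) a)"]])
      (intro lin_intros | simp add: sweedler antipode_one)+
  also have "\<dots> = K 1 1"
    by (rule zigzag_sum(2)[where s = s and f = "\<lambda>z. K z 1"]) (intro lin_intros)+
  finally show ?thesis .
qed

text \<open>Prepares the meeting of \<gamma> with \<delta>: the pentagon splits the outer
  reassociator, and \<open>alpha_nat\<close> moves the coproduct of \<open>u3\<close> out of
  \<gamma>. The inverse with legs \<open>z1\<close>, \<open>z2\<close>, \<open>z3\<close> is left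
  exposed, in the position that \<open>delta_cancel\<close> consumes.\<close>

lemma gamma_pentagon:
  assumes K: "lin3 s K"
  shows "\<Phi> (\<lambda>x1 x2 x3. sum2 H \<gamma> (\<lambda>g1 g2. \<DD> x2 (\<lambda>x21 x22. \<DD> x3 (\<lambda>x31 x32.
      K x1 (S x22 * (g1 * x31)) (S x21 * (g2 * x32)))))) =
    \<Phi> (\<lambda>u1 u2 u3. \<Phi> (\<lambda>v1 v2 v3. \<Psi> (\<lambda>z1 z2 z3. \<Psi> (\<lambda>r1 r2 r3. \<DD> v1 (\<lambda>v11 v12. \<DD> v3 (\<lambda>v31 v32.
      K (u1 * (v11 * z1)) (S z3 * (S v2 * (S r1 * (\<alpha> * (r2 * v31)))))
        (S z2 * (S v12 * (S u2 * (\<alpha> * (u3 * (r3 * v32))))))))))))" (is "?L = ?R")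
proof -
  note [lin_intros] = lin3D[OF K]
  have inner: "\<Psi> (\<lambda>r1 r2 r3. \<DD> u3 (\<lambda>u31 u32. \<DD> u32 (\<lambda>u321 u322. \<DD> v1 (\<lambda>v11 v12. \<DD> v3 (\<lambda>v31 v32.
      K (u1 * (v11 * z1)) (S z3 * (S v2 * (S u31 * (S r1 * (\<alpha> * (r2 * (u321 * v31)))))))
        (S z2 * (S v12 * (S u2 * (\<alpha> * (r3 * (u322 * v32)))))))))))
   = \<Psi> (\<lambda>r1 r2 r3. \<DD> v1 (\<lambda>v11 v12. \<DD> v3 (\<lambda>v31 v32.
      K (u1 * (v11 * z1)) (S z3 * (S v2 * (S r1 * (\<alpha> * (r2 * v31)))))
        (S z2 * (S v12 * (S u2 * (\<alpha> * (u3 * (r3 * v32)))))))))"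
    for u1 u2 u3 v1 v2 v3 z1 z2 z3
    by (rule via[OF alpha_nat[where h = u3 and s = s and K = "\<lambda>a b. \<DD> v1 (\<lambda>v11 v12. \<DD> v3 (\<lambda>v31 v32.
      K (u1 * (v11 * z1)) (S z3 * (S v2 * (a * v31)))
        (S z2 * (S v12 * (S u2 * (\<alpha> * (b * v32)))))))"]])
     (intro lin_intros | simp add: sweedler)+
  have "?L =
    \<Phi> (\<lambda>t1 t2 t3. \<Phi> (\<lambda>x1 x2 x3. \<Psi> (\<lambda>r1 r2 r3. \<DD> x2 (\<lambda>x21 x22. \<DD> t3 (\<lambda>t31 t32. \<DD> x3 (\<lambda>x31 x32.
      K x1 (S x22 * (S t2 * (S r1 * (\<alpha> * (r2 * (t31 * x31))))))
         (S x21 * (S t1 * (\<alpha> * (r3 * (t32 * x32)))))))))))"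
    apply (subst sum_gamma[where s = s], (intro lin_intros)?)
    by (subst sum_swap(3), subst sum_swap(1)) (simp add: sweedler)
  also have "\<dots> = \<Phi> (\<lambda>u1 u2 u3. \<Phi> (\<lambda>v1 v2 v3. \<Psi> (\<lambda>z1 z2 z3. \<Psi> (\<lambda>r1 r2 r3. \<DD> u3 (\<lambda>u31 u32. \<DD> v1 (\<lambda>v11 v12. \<DD> u32 (\<lambda>u321 u322. \<DD> v3 (\<lambda>v31 v32.
      K (u1 * (v11 * z1)) (S z3 * (S v2 * (S u31 * (S r1 * (\<alpha> * (r2 * (u321 * v31)))))))
        (S z2 * (S v12 * (S u2 * (\<alpha> * (r3 * (u322 * v32))))))))))))))"
    by (rule via[OF pentagon_sum(2)[where s = s and F = "\<lambda>a b c d. \<Psi> (\<lambda>r1 r2 r3. \<DD> d (\<lambda>d1 d2.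
        K a (S c * (S r1 * (\<alpha> * (r2 * d1)))) (S b * (\<alpha> * (r3 * d2)))))"]])
      (intro lin_intros | simp add: sweedler comult_mult_sum[where s = s] lin_intros)+
  also have "\<dots> = ?R"
    by (subst (2) sum_swap(1)) (simp only: inner)
  finally show ?thesis .
qed

text \<open>Counterpart for \<delta>, with \<open>beta_nat\<close> moving the coproduct of
  \<open>w2\<close> inwards. The leg \<open>u1\<close> ends up spread over an iterated coproduct,
  which is the shape that \<open>gamma_nat\<close> absorbs.\<close>

lemma delta_pentagon:
  assumes K: "lin3 s K"
  shows "\<Psi> (\<lambda>y1 y2 y3. sum2 H \<delta> (\<lambda>d1 d2. \<DD> y2 (\<lambda>y21 y22. \<DD> y3 (\<lambda>y31 y32.
      K y1 (y21 * (d1 * S y32)) (y22 * (d2 * S y31)))))) =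
    \<Phi> (\<lambda>u1 u2 u3. \<Psi> (\<lambda>v1 v2 v3. \<Psi> (\<lambda>w1 w2 w3. \<Psi> (\<lambda>r1 r2 r3. \<DD> u1 (\<lambda>u11 u12. \<DD> u12 (\<lambda>u121 u122. \<DD> v2 (\<lambda>v21 v22.
      K (u11 * (v1 * w1)) (u121 * (v21 * (r1 * (w2 * (\<beta> * (S w3 * S u3))))))
        (u122 * (v22 * (r2 * (\<beta> * (S r3 * (S v3 * S u2)))))))))))))" (is "?L = _")
proof -
  note [lin_intros] = lin3D[OF K]
  have inner: "\<Psi> (\<lambda>r1 r2 r3. \<DD> w2 (\<lambda>w21 w22. \<DD> w21 (\<lambda>w211 w212. \<DD> u1 (\<lambda>u11 u12. \<DD> u12 (\<lambda>u121 u122. \<DD> v2 (\<lambda>v21 v22.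
      K (u11 * (v1 * w1)) (u121 * (v21 * (w211 * (r1 * (\<beta> * (S w3 * S u3))))))
        (u122 * (v22 * (w212 * (r2 * (\<beta> * (S r3 * (S w22 * (S v3 * S u2))))))))))))))
   = \<Psi> (\<lambda>r1 r2 r3. \<DD> u1 (\<lambda>u11 u12. \<DD> u12 (\<lambda>u121 u122. \<DD> v2 (\<lambda>v21 v22.
      K (u11 * (v1 * w1)) (u121 * (v21 * (r1 * (w2 * (\<beta> * (S w3 * S u3))))))
        (u122 * (v22 * (r2 * (\<beta> * (S r3 * (S v3 * S u2))))))))))"
    for u1 u2 u3 v1 v2 v3 w1 w2 w3
    by (rule via[OF beta_nat[where h = w2 and s = s and K = "\<lambda>a b. \<DD> u1 (\<lambda>u11 u12. \<DD> u12 (\<lambda>u121 u122. \<DD> v2 (\<lambda>v21 v22.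
      K (u11 * (v1 * w1)) (u121 * (v21 * (a * (\<beta> * (S w3 * S u3)))))
        (u122 * (v22 * (b * (S v3 * S u2)))))))"]])
     (intro lin_intros | simp add: sweedler)+
  have "?L =
    \<Phi> (\<lambda>x1 x2 x3. \<Psi> (\<lambda>y1 y2 y3. \<Psi> (\<lambda>r1 r2 r3. \<DD> y3 (\<lambda>y31 y32. \<DD> y2 (\<lambda>y21 y22. \<DD> x1 (\<lambda>x11 x12.
      K y1 (y21 * (x11 * (r1 * (\<beta> * (S x3 * S y32)))))
         (y22 * (x12 * (r2 * (\<beta> * (S r3 * (S x2 * S y31))))))))))))"
    apply (subst sum_delta[where s = s], (intro lin_intros)?)
    apply (subst (1) sum_swap(1))
    apply (subst (2) sum_swap(1))
    apply (subst (1) sum_swap(1))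
    by (simp add: sweedler)
  also have "\<dots> = \<Phi> (\<lambda>u1 u2 u3. \<Psi> (\<lambda>v1 v2 v3. \<Psi> (\<lambda>w1 w2 w3. \<Psi> (\<lambda>r1 r2 r3. \<DD> u1 (\<lambda>u11 u12. \<DD> w2 (\<lambda>w21 w22. \<DD> u12 (\<lambda>u121 u122. \<DD> v2 (\<lambda>v21 v22. \<DD> w21 (\<lambda>w211 w212.
      K (u11 * (v1 * w1)) (u121 * (v21 * (w211 * (r1 * (\<beta> * (S w3 * S u3))))))
        (u122 * (v22 * (w212 * (r2 * (\<beta> * (S r3 * (S w22 * (S v3 * S u2)))))))))))))))))"
    by (rule via[OF pentagon_sum(7)[where s = s and F = "\<lambda>a b c d. \<Psi> (\<lambda>r1 r2 r3. \<DD> b (\<lambda>b1 b2.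
        K a (b1 * (r1 * (\<beta> * S d))) (b2 * (r2 * (\<beta> * (S r3 * S c))))))"]])
      (intro lin_intros | simp add: sweedler comult_mult_sum[where s = s] lin_intros)+
  also have "\<dots> = \<Phi> (\<lambda>u1 u2 u3. \<Psi> (\<lambda>v1 v2 v3. \<Psi> (\<lambda>w1 w2 w3. \<Psi> (\<lambda>r1 r2 r3. \<DD> u1 (\<lambda>u11 u12. \<DD> u12 (\<lambda>u121 u122. \<DD> v2 (\<lambda>v21 v22.
      K (u11 * (v1 * w1)) (u121 * (v21 * (r1 * (w2 * (\<beta> * (S w3 * S u3))))))
        (u122 * (v22 * (r2 * (\<beta> * (S r3 * (S v3 * S u2))))))))))))) "
    apply (subst (1) sum_swap(1))
    apply (subst (3) sum_swap(1))
    apply (subst (2) sum_swap(1))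
    apply (subst (2) sum_swap(1))
    by (simp only: inner)
  finally show ?thesis .
qed

text \<open>The version of \<open>alpha_nat\<close> for \<phi> instead of its inverse: the split
  factor now collapses around \<alpha> between the second and third legs.\<close>

lemma alpha_nat':
  assumes K: "lin2 s K"
  shows "\<Phi> (\<lambda>t1 t2 t3. \<DD> h (\<lambda>h1 h2. \<DD> h1 (\<lambda>h11 h12.
      K (S h12 * (S t2 * (\<alpha> * (t3 * h2)))) (t1 * h11)))) =
    \<Phi> (\<lambda>t1 t2 t3. K (S t2 * (\<alpha> * t3)) (h * t1))" (is "?L = ?R")
proof -
  note [lin_intros] = lin2D[OF K]
  have *: "\<DD> u (\<lambda>u1 u2. K (S t2 * (S u1 * (\<alpha> * (u2 * t3)))) (v * t1)) = s (\<epsilon> u) (K (S t2 * (\<alpha> * t3)) (v * t1))"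
    for u v t1 t2 t3
    by (rule via[OF antipode_sum(1)[where h = u and s = s and f = "\<lambda>z. K (S t2 * (z * t3)) (v * t1)"]])
      (intro lin_intros | simp add: sweedler)+
  have "?L =
    \<Phi> (\<lambda>t1 t2 t3. \<DD> h (\<lambda>h1 h2. \<DD> h2 (\<lambda>h21 h22.
      K (S t2 * (S h21 * (\<alpha> * (h22 * t3)))) (h1 * t1))))"
    by (rule via[OF reassoc_nat(1)[symmetric, where h = h and s = s and F = "\<lambda>a b c. K (S b * (\<alpha> * c)) a"]])
      (intro lin_intros | simp add: sweedler)+
  also have "\<dots> = \<Phi> (\<lambda>t1 t2 t3. \<DD> h (\<lambda>h1 h2. s (\<epsilon> h2) (K (S t2 * (\<alpha> * t3)) (h1 * t1))))"
    by (simp only: *)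
  also have "\<dots> = ?R"
    by (subst counit_sum[where s = s]; (intro lin_intros)?) simp
  finally show ?thesis .
qed

text \<open>The pentagon turns the two inverses into three reassociators. One collapses around
  \<beta>, \<open>gamma_cancel\<close> removes the \<phi> next to \<gamma>, and the last one closes
  up to the zigzag axiom.\<close>

lemma gamma_pentagon_inv:
  assumes K: "lin2 s K"
  shows "\<Psi> (\<lambda>v1 v2 v3. \<Psi> (\<lambda>r1 r2 r3. sum2 H \<gamma> (\<lambda>g1 g2. \<DD> v2 (\<lambda>v21 v22. \<DD> v1 (\<lambda>v11 v12.
      K (S v12 * (g1 * (v21 * r1))) (S v11 * (g2 * (v22 * (r2 * (\<beta> * (S r3 * S v3))))))))))) =
    \<Phi> (\<lambda>t1 t2 t3. K (S t2 * (\<alpha> * t3)) (S t1))" (is "?L = _")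
proof -
  note [lin_intros] = lin2D[OF K]
  \<comment> \<open>The iterated coproduct of \<open>p1\<close> surrounds \<gamma>; once
    \<open>gamma_cancel\<close> has simplified the middle, \<open>alpha_nat'\<close> contracts that
    coproduct to a single \<open>p1\<close>.\<close>
  have 1: "\<Phi> (\<lambda>x1 x2 x3. sum2 H \<gamma> (\<lambda>g1 g2. \<DD> p1 (\<lambda>p11 p12. \<DD> x1 (\<lambda>x11 x12. \<DD> p11 (\<lambda>p111 p112.
      K (S p112 * (S x12 * (g1 * (x2 * p12)))) (S p111 * (S x11 * (g2 * (x3 * (p2 * (\<beta> * S p3))))))))))) =
    \<Phi> (\<lambda>t1 t2 t3. K (S t2 * (\<alpha> * t3)) (S t1 * (S p1 * (\<alpha> * (p2 * (\<beta> * S p3))))))" (is "?A = ?B") for p1 p2 p3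
  proof -
    have "?A =
     \<Phi> (\<lambda>t1 t2 t3. \<DD> p1 (\<lambda>p11 p12. \<DD> p11 (\<lambda>p111 p112.
      K (S p112 * (S t2 * (\<alpha> * (t3 * p12)))) (S p111 * (S t1 * (\<alpha> * (p2 * (\<beta> * S p3))))))))"
      apply (subst (2) sum_swap(1))
      by (rule via[OF gamma_cancel[where s = s and K = "\<lambda>a b. \<DD> p1 (\<lambda>p11 p12. \<DD> p11 (\<lambda>p111 p112.
      K (S p112 * (a * p12)) (S p111 * (b * (p2 * (\<beta> * S p3))))))"]])
       (intro lin_intros | simp add: sweedler front_gamma_delta)+
    also have "\<dots> = ?B"
      by (rule via[OF alpha_nat'[where s = s and h = p1 and K = "\<lambda>a b. K a (S b * (\<alpha> * (p2 * (\<beta> * S p3))))"]])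
       (intro lin_intros | simp add: sweedler)+
    finally show ?thesis .
  qed
  have "?L =
    \<Phi> (\<lambda>x1 x2 x3. \<Psi> (\<lambda>p1 p2 p3. \<Psi> (\<lambda>q1 q2 q3. sum2 H \<gamma> (\<lambda>g1 g2.
      \<DD> p1 (\<lambda>p11 p12. \<DD> q3 (\<lambda>q31 q32. \<DD> x1 (\<lambda>x11 x12. \<DD> p11 (\<lambda>p111 p112. \<DD> q1 (\<lambda>q11 q12.
      K (S q12 * (S p112 * (S x12 * (g1 * (x2 * (p12 * q2))))))
        (S q11 * (S p111 * (S x11 * (g2 * (x3 * (p2 * (q31 * (\<beta> * (S q32 * S p3))))))))))))))))))"
    by (rule via[OF pentagon_sum(8)[where s = s and F = "\<lambda>a b c d. sum2 H \<gamma> (\<lambda>g1 g2. \<DD> a (\<lambda>a1 a2.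
        K (S a2 * (g1 * b)) (S a1 * (g2 * (c * (\<beta> * S d))))))"]])
      (intro lin_intros | simp add: sweedler comult_mult_sum[where s = s] lin_intros front_gamma_delta)+
  also have "\<dots> = \<Psi> (\<lambda>q1 q2 q3. \<DD> q3 (\<lambda>q31 q32. \<Phi> (\<lambda>x1 x2 x3. \<Psi> (\<lambda>p1 p2 p3. sum2 H \<gamma> (\<lambda>g1 g2.
      \<DD> p1 (\<lambda>p11 p12. \<DD> x1 (\<lambda>x11 x12. \<DD> p11 (\<lambda>p111 p112. \<DD> q1 (\<lambda>q11 q12.
      K (S q12 * (S p112 * (S x12 * (g1 * (x2 * (p12 * q2))))))
        (S q11 * (S p111 * (S x11 * (g2 * (x3 * (p2 * (q31 * (\<beta> * (S q32 * S p3))))))))))))))))))"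
    apply (subst (2) sum_swap(3), subst (2) sum_swap(1))
    by (simp only: front front_gamma_delta)
  also have "\<dots> = \<Phi> (\<lambda>x1 x2 x3. \<Psi> (\<lambda>p1 p2 p3. sum2 H \<gamma> (\<lambda>g1 g2.
      \<DD> p1 (\<lambda>p11 p12. \<DD> x1 (\<lambda>x11 x12. \<DD> p11 (\<lambda>p111 p112.
      K (S p112 * (S x12 * (g1 * (x2 * p12))))
        (S p111 * (S x11 * (g2 * (x3 * (p2 * (\<beta> * S p3))))))))))))"
    by (rule via[OF reassoc_beta(4)[where s = s and K = "\<lambda>a b m. \<Phi> (\<lambda>x1 x2 x3. \<Psi> (\<lambda>p1 p2 p3. sum2 H \<gamma> (\<lambda>g1 g2.
      \<DD> p1 (\<lambda>p11 p12. \<DD> x1 (\<lambda>x11 x12. \<DD> p11 (\<lambda>p111 p112. \<DD> a (\<lambda>q11 q12.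
      K (S q12 * (S p112 * (S x12 * (g1 * (x2 * (p12 * b))))))
        (S q11 * (S p111 * (S x11 * (g2 * (x3 * (p2 * (m * S p3))))))))))))))"]])
      (intro lin_intros | simp add: mult.assoc comult_one_sum[where s = s] lin_intros antipode_one)+
  also have "\<dots> = \<Phi> (\<lambda>t1 t2 t3. \<Psi> (\<lambda>p1 p2 p3. K (S t2 * (\<alpha> * t3)) (S t1 * (S p1 * (\<alpha> * (p2 * (\<beta> * S p3)))))))"
    by (subst sum_swap(3)) (simp only: 1 front)
  also have "\<dots> = \<Phi> (\<lambda>t1 t2 t3. K (S t2 * (\<alpha> * t3)) (S t1 * 1))"
  proof (rule sum3_cong)
    fix t1 t2 t3
    show "\<Psi> (\<lambda>p1 p2 p3. K (S t2 * (\<alpha> * t3)) (S t1 * (S p1 * (\<alpha> * (p2 * (\<beta> * S p3)))))) = K (S t2 * (\<alpha> * t3)) (S t1 * 1)"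
      by (rule zigzag_sum(2)[where s = s and f = "\<lambda>z. K (S t2 * (\<alpha> * t3)) (S t1 * z)"]) (intro lin_intros)+
  qed
  finally show ?thesis by simp
qed

text \<open>The zigzag in the tensor square is peeled into two ordinary ones: after
  \<open>gamma_pentagon\<close>, \<open>delta_cancel\<close> and \<open>beta_nat\<close>, the sum
  over \<open>v\<close> is \<open>zigzag_left\<close>, nested in a sum over \<open>u\<close> and
  \<open>z\<close> that is \<open>zigzag_right\<close>.\<close>

lemma gamma_delta_zigzag:
  assumes K: "lin2 s K"
  shows "\<Phi> (\<lambda>x1 x2 x3. sum2 H \<gamma> (\<lambda>g1 g2. sum2 H \<delta> (\<lambda>d1 d2. \<DD> x2 (\<lambda>x21 x22. \<DD> x3 (\<lambda>x31 x32. \<DD> x1 (\<lambda>x11 x12.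
    K (x11 * (d1 * (S x22 * (g1 * x31)))) (x12 * (d2 * (S x21 * (g2 * x32)))))))))) = K 1 1" (is "?L = _")
proof -
  note [lin_intros] = lin2D[OF K]
  have 1: "\<Psi> (\<lambda>z1 z2 z3. \<Psi> (\<lambda>r1 r2 r3. sum2 H \<delta> (\<lambda>d1 d2. \<DD> z1 (\<lambda>z11 z12. \<DD> v1 (\<lambda>v11 v12. \<DD> v11 (\<lambda>v111 v112. \<DD> v3 (\<lambda>v31 v32. \<DD> u1 (\<lambda>u11 u12.
      K (u11 * (v111 * (z11 * (d1 * (S z3 * (S v2 * (S r1 * (\<alpha> * (r2 * v31)))))))))
        (u12 * (v112 * (z12 * (d2 * (S z2 * (S v12 * (S u2 * (\<alpha> * (u3 * (r3 * v32))))))))))))))))))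
    = \<Psi> (\<lambda>z1 z2 z3. \<Psi> (\<lambda>r1 r2 r3. \<DD> v3 (\<lambda>v31 v32. \<DD> u1 (\<lambda>u11 u12.
      K (u11 * (z1 * (v1 * (\<beta> * (S v2 * (S r1 * (\<alpha> * (r2 * v31))))))))
        (u12 * (z2 * (\<beta> * (S z3 * (S u2 * (\<alpha> * (u3 * (r3 * v32))))))))))))"
    for u1 u2 u3 v1 v2 v3
    apply (rule via[OF delta_cancel[where s = s and K = "\<lambda>a b. \<Psi> (\<lambda>r1 r2 r3. \<DD> v1 (\<lambda>v11 v12. \<DD> v11 (\<lambda>v111 v112. \<DD> v3 (\<lambda>v31 v32. \<DD> u1 (\<lambda>u11 u12.
      K (u11 * (v111 * (a * (S v2 * (S r1 * (\<alpha> * (r2 * v31)))))))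
        (u12 * (v112 * (b * (S v12 * (S u2 * (\<alpha> * (u3 * (r3 * v32)))))))))))))"]])
      apply (intro lin_intros)
     apply (simp add: sweedler front_gamma_delta)
    apply (rule via[OF beta_nat[where s = s and h = v1 and K = "\<lambda>a b. \<Psi> (\<lambda>r1 r2 r3. \<DD> v3 (\<lambda>v31 v32. \<DD> u1 (\<lambda>u11 u12.
      K (u11 * (a * (\<beta> * (S v2 * (S r1 * (\<alpha> * (r2 * v31)))))))
        (u12 * (b * (S u2 * (\<alpha> * (u3 * (r3 * v32)))))))))"]])
    by (intro lin_intros | simp add: sweedler)+
  have 2: "\<Phi> (\<lambda>v1 v2 v3. \<Psi> (\<lambda>r1 r2 r3. \<DD> v3 (\<lambda>v31 v32. \<DD> u1 (\<lambda>u11 u12.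
      K (u11 * (z1 * (v1 * (\<beta> * (S v2 * (S r1 * (\<alpha> * (r2 * v31))))))))
        (u12 * (z2 * (\<beta> * (S z3 * (S u2 * (\<alpha> * (u3 * (r3 * v32))))))))))))
    = \<DD> u1 (\<lambda>u11 u12. K (u11 * z1) (u12 * (z2 * (\<beta> * (S z3 * (S u2 * (\<alpha> * u3)))))))"
    for u1 u2 u3 z1 z2 z3
    apply (rule via[OF zigzag_left[where s = s and K = "\<lambda>a b. \<DD> u1 (\<lambda>u11 u12.
      K (u11 * (z1 * a)) (u12 * (z2 * (\<beta> * (S z3 * (S u2 * (\<alpha> * (u3 * b))))))))"]])
     by (intro lin_intros | simp add: sweedler)+
  have "?L
    = \<Phi> (\<lambda>u1 u2 u3. \<Phi> (\<lambda>v1 v2 v3. \<Psi> (\<lambda>z1 z2 z3. \<Psi> (\<lambda>r1 r2 r3. sum2 H \<delta> (\<lambda>d1 d2. \<DD> v1 (\<lambda>v11 v12. \<DD> v3 (\<lambda>v31 v32. \<DD> u1 (\<lambda>u11 u12. \<DD> v11 (\<lambda>v111 v112. \<DD> z1 (\<lambda>z11 z12.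
      K (u11 * (v111 * (z11 * (d1 * (S z3 * (S v2 * (S r1 * (\<alpha> * (r2 * v31)))))))))
        (u12 * (v112 * (z12 * (d2 * (S z2 * (S v12 * (S u2 * (\<alpha> * (u3 * (r3 * v32))))))))))))))))))))"
    apply (rule via[OF gamma_pentagon[where s = s and K = "\<lambda>a b c. sum2 H \<delta> (\<lambda>d1 d2. \<DD> a (\<lambda>a1 a2.
      K (a1 * (d1 * b)) (a2 * (d2 * c))))"]])
     by (intro lin_intros | simp add: sweedler front_gamma_delta comult_mult_sum[where s = s] lin_intros)+
  also have "\<dots> = \<Phi> (\<lambda>u1 u2 u3. \<Psi> (\<lambda>z1 z2 z3. \<Phi> (\<lambda>v1 v2 v3. \<Psi> (\<lambda>r1 r2 r3. \<DD> v3 (\<lambda>v31 v32. \<DD> u1 (\<lambda>u11 u12.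
      K (u11 * (z1 * (v1 * (\<beta> * (S v2 * (S r1 * (\<alpha> * (r2 * v31))))))))
        (u12 * (z2 * (\<beta> * (S z3 * (S u2 * (\<alpha> * (u3 * (r3 * v32))))))))))))))"
    apply (subst (4) sum_swap(1), subst (3) sum_swap(1), subst (4) sum_swap(1), subst (3) sum_swap(1),
      subst (2) sum_swap(1), subst (2) sum_swap(1))
    by (simp only: 1 front)
  also have "\<dots> = K 1 1"
    unfolding 2 by (rule zigzag_right) fact
  finally show ?thesis .
qed

text \<open>After \<open>delta_pentagon\<close> one \<phi> is attached to \<gamma> only through an
  iterated coproduct and vanishes by \<open>gamma_nat\<close>; \<open>gamma_pentagon_inv\<close> and
  \<open>zigzag_inv\<close> dispose of the rest.\<close>

lemma gamma_delta_zigzag_inv: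
  assumes K: "lin2 s K"
  shows "\<Psi> (\<lambda>y1 y2 y3. sum2 H \<gamma> (\<lambda>g1 g2. sum2 H \<delta> (\<lambda>d1 d2. \<DD> y2 (\<lambda>y21 y22. \<DD> y3 (\<lambda>y31 y32. \<DD> y1 (\<lambda>y11 y12.
    K (S y12 * (g1 * (y21 * (d1 * S y32)))) (S y11 * (g2 * (y22 * (d2 * S y31)))))))))) = K 1 1" (is "?L = _")
proof -
  note [lin_intros] = lin2D[OF K]
  \<comment> \<open>The whole coproduct of \<open>u1\<close> is absorbed as its counit, so the
    reassociator with legs \<open>u1\<close>, \<open>u2\<close>, \<open>u3\<close> becomes trivial
    by \<open>reassoc_counit1\<close>.\<close>
  have 1: "sum2 H \<gamma> (\<lambda>g1 g2. \<DD> u1 (\<lambda>u11 u12. \<DD> u11 (\<lambda>u111 u112. \<DD> u12 (\<lambda>u121 u122. \<DD> v2 (\<lambda>v21 v22. \<DD> v1 (\<lambda>v11 v12. \<DD> w1 (\<lambda>w11 w12.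
    K (S w12 * (S v12 * (S u112 * (g1 * (u121 * (v21 * (r1 * (w2 * (\<beta> * (S w3 * S u3))))))))))
      (S w11 * (S v11 * (S u111 * (g2 * (u122 * (v22 * (r2 * (\<beta> * (S r3 * (S v3 * S u2)))))))))))))))))
   = s (\<epsilon> u1) (sum2 H \<gamma> (\<lambda>g1 g2. \<DD> v2 (\<lambda>v21 v22. \<DD> v1 (\<lambda>v11 v12. \<DD> w1 (\<lambda>w11 w12.
    K (S w12 * (S v12 * (g1 * (v21 * (r1 * (w2 * (\<beta> * (S w3 * S u3))))))))
      (S w11 * (S v11 * (g2 * (v22 * (r2 * (\<beta> * (S r3 * (S v3 * S u2)))))))))))))"
    for u1 u2 u3 v1 v2 v3 w1 w2 w3 r1 r2 r3
    apply (rule via[OF gamma_nat[where s = s and h = u1 and K = "\<lambda>a b. \<DD> v2 (\<lambda>v21 v22. \<DD> v1 (\<lambda>v11 v12. \<DD> w1 (\<lambda>w11 w12.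
    K (S w12 * (S v12 * (a * (v21 * (r1 * (w2 * (\<beta> * (S w3 * S u3))))))))
      (S w11 * (S v11 * (b * (v22 * (r2 * (\<beta> * (S r3 * (S v3 * S u2)))))))))))"]])
     by (intro lin_intros | simp add: sweedler)+
  have "?L
   = \<Phi> (\<lambda>u1 u2 u3. \<Psi> (\<lambda>v1 v2 v3. \<Psi> (\<lambda>w1 w2 w3. \<Psi> (\<lambda>r1 r2 r3. sum2 H \<gamma> (\<lambda>g1 g2. \<DD> u1 (\<lambda>u11 u12. \<DD> u12 (\<lambda>u121 u122. \<DD> v2 (\<lambda>v21 v22. \<DD> u11 (\<lambda>u111 u112. \<DD> v1 (\<lambda>v11 v12. \<DD> w1 (\<lambda>w11 w12.
    K (S w12 * (S v12 * (S u112 * (g1 * (u121 * (v21 * (r1 * (w2 * (\<beta> * (S w3 * S u3))))))))))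
      (S w11 * (S v11 * (S u111 * (g2 * (u122 * (v22 * (r2 * (\<beta> * (S r3 * (S v3 * S u2)))))))))))))))))))))"
    apply (rule via[OF delta_pentagon[where s = s and K = "\<lambda>a b c. sum2 H \<gamma> (\<lambda>g1 g2. \<DD> a (\<lambda>a1 a2.
      K (S a2 * (g1 * b)) (S a1 * (g2 * c))))"]])
     by (intro lin_intros | simp add: sweedler front_gamma_delta comult_mult_sum[where s = s] lin_intros)+
  also have "\<dots> = \<Phi> (\<lambda>u1 u2 u3. s (\<epsilon> u1) (\<Psi> (\<lambda>v1 v2 v3. \<Psi> (\<lambda>w1 w2 w3. \<Psi> (\<lambda>r1 r2 r3. sum2 H \<gamma> (\<lambda>g1 g2. \<DD> v2 (\<lambda>v21 v22. \<DD> v1 (\<lambda>v11 v12. \<DD> w1 (\<lambda>w11 w12.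
    K (S w12 * (S v12 * (g1 * (v21 * (r1 * (w2 * (\<beta> * (S w3 * S u3))))))))
      (S w11 * (S v11 * (g2 * (v22 * (r2 * (\<beta> * (S r3 * (S v3 * S u2)))))))))))))))))"
    apply (subst (3) sum_swap(1), subst (2) sum_swap(1))
    by (simp only: 1 vs_simps[OF lin2_vs[OF K]])
  also have "\<dots> = \<Psi> (\<lambda>w1 w2 w3. \<Psi> (\<lambda>v1 v2 v3. \<Psi> (\<lambda>r1 r2 r3. sum2 H \<gamma> (\<lambda>g1 g2. \<DD> v2 (\<lambda>v21 v22. \<DD> v1 (\<lambda>v11 v12. \<DD> w1 (\<lambda>w11 w12.
    K (S w12 * (S v12 * (g1 * (v21 * (r1 * (w2 * (\<beta> * S w3)))))))
      (S w11 * (S v11 * (g2 * (v22 * (r2 * (\<beta> * (S r3 * S v3))))))))))))))"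
    apply (rule via[OF reassoc_counit1[where s = s and F = "\<lambda>b c. \<Psi> (\<lambda>v1 v2 v3. \<Psi> (\<lambda>w1 w2 w3. \<Psi> (\<lambda>r1 r2 r3. sum2 H \<gamma> (\<lambda>g1 g2. \<DD> v2 (\<lambda>v21 v22. \<DD> v1 (\<lambda>v11 v12. \<DD> w1 (\<lambda>w11 w12.
    K (S w12 * (S v12 * (g1 * (v21 * (r1 * (w2 * (\<beta> * (S w3 * S c))))))))
      (S w11 * (S v11 * (g2 * (v22 * (r2 * (\<beta> * (S r3 * (S v3 * S b)))))))))))))))"]])
      apply (intro lin_intros)
     apply simp
    apply (simp add: antipode_one)
    by (rule sum_swap)
  also have "\<dots> = \<Psi> (\<lambda>w1 w2 w3. \<Phi> (\<lambda>t1 t2 t3. \<DD> w1 (\<lambda>w11 w12.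
    K (S w12 * (S t2 * (\<alpha> * (t3 * (w2 * (\<beta> * S w3)))))) (S w11 * S t1))))"
    (is "_ = \<Psi> ?t")
  proof (rule sum3_cong)
    fix w1 w2 w3
    show "\<Psi> (\<lambda>v1 v2 v3. \<Psi> (\<lambda>r1 r2 r3. sum2 H \<gamma> (\<lambda>g1 g2. \<DD> v2 (\<lambda>v21 v22. \<DD> v1 (\<lambda>v11 v12. \<DD> w1 (\<lambda>w11 w12.
    K (S w12 * (S v12 * (g1 * (v21 * (r1 * (w2 * (\<beta> * S w3)))))))
      (S w11 * (S v11 * (g2 * (v22 * (r2 * (\<beta> * (S r3 * S v3))))))))))))) =
     ?t w1 w2 w3"
    apply (rule via[OF gamma_pentagon_inv[where s = s and K = "\<lambda>a b. \<DD> w1 (\<lambda>w11 w12.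
    K (S w12 * (a * (w2 * (\<beta> * S w3)))) (S w11 * b))"]])
     by (intro lin_intros | simp add: sweedler)+
  qed
  also have "\<dots> = K 1 1"
    apply (rule via[OF zigzag_inv[where s = s and K = "\<lambda>a b. K a (S b)"]])
     by (intro lin_intros | simp add: sweedler antipode_one)+
  finally show ?thesis .
qed

subsection \<open>Antipodes along the comultiplication and invertibility of \<open>f\<close>\<close>

abbreviation tmult (infixr "\<odot>" 70) where "x \<odot> y \<equiv> mult2 H x y"
abbreviation "\<Delta> \<equiv> comult H"

lemma lin_mult2_right [lin_intros]:
  assumes "lin tscale f" "\<And>x. f x \<in> H2"
  shows "lin tscale (\<lambda>x. u \<odot> f x)"
proof -
  have *: "lin2 tscale (\<lambda>y1 y2. pure2 H (x1 * y1) (x2 * y2))" for x1 x2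
    by (intro lin_intros)
  show ?thesis
    unfolding mult2_def
    by (intro lin_intros, rule linI; insert assms)
      (simp_all add: lin_def sum2_add_arg[OF *] sum2_scale_arg[OF *])
qed

lemma lin_mult2_left [lin_intros]:
  assumes "lin tscale f" "\<And>x. f x \<in> H2"
  shows "lin tscale (\<lambda>x. f x \<odot> u)"
proof -
  have *: "lin2 tscale (\<lambda>x1 x2. sum2 H u (\<lambda>y1 y2. pure2 H (x1 * y1) (x2 * y2)))"
    by (intro lin_intros)
  show ?thesis
    unfolding mult2_def
    by (rule linI; insert assms)
      (simp_all add: lin_def sum2_add_arg[OF *] sum2_scale_arg[OF *])
qed

lemma lin_comult_self [lin_intros]: "lin (scale H) f \<Longrightarrow> lin tscale (\<lambda>x. \<Delta> (f x))"
  by (simp add: lin_def comult_add comult_scale)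

lemma mult2_sum_right:
  "(\<And>a b. G2 a b \<in> H2) \<Longrightarrow> u \<odot> sum2 H t2 G2 = sum2 H t2 (\<lambda>a b. u \<odot> G2 a b)"
  "(\<And>a b c. G3 a b c \<in> H2) \<Longrightarrow> u \<odot> sum3 H t3 G3 = sum3 H t3 (\<lambda>a b c. u \<odot> G3 a b c)"
proof -
  have *: "lin2 tscale (\<lambda>y1 y2. pure2 H (x1 * y1) (x2 * y2))" for x1 x2
    by (intro lin_intros)
  show "(\<And>a b. G2 a b \<in> H2) \<Longrightarrow> u \<odot> sum2 H t2 G2 = sum2 H t2 (\<lambda>a b. u \<odot> G2 a b)"
    unfolding mult2_def by (simp only: sum2_sum[OF *]) (rule sum_swap)
  show "(\<And>a b c. G3 a b c \<in> H2) \<Longrightarrow> u \<odot> sum3 H t3 G3 = sum3 H t3 (\<lambda>a b c. u \<odot> G3 a b c)"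
    unfolding mult2_def by (simp only: sum2_sum[OF *]) (rule sum_swap)
qed

lemma mult2_sum_left:
  "(\<And>a b. G2 a b \<in> H2) \<Longrightarrow> sum2 H t2 G2 \<odot> u = sum2 H t2 (\<lambda>a b. G2 a b \<odot> u)"
  "(\<And>a b c. G3 a b c \<in> H2) \<Longrightarrow> sum3 H t3 G3 \<odot> u = sum3 H t3 (\<lambda>a b c. G3 a b c \<odot> u)"
  unfolding mult2_def
  by (subst sum2_sum[where s = tscale]; (intro lin_intros)?; simp)+

lemma mult2_scale:
  "x \<in> H2 \<Longrightarrow> u \<odot> tscale c x = tscale c (u \<odot> x)"
  "x \<in> H2 \<Longrightarrow> tscale c x \<odot> u = tscale c (x \<odot> u)"
  unfolding mult2_def
  by (subst sum2_scale_arg[where s = tscale]; (intro lin_intros)?; simp add: vs_simps[OF tscale_vector_space])+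

text \<open>
  A second antipode for the algebra map \<open>\<Delta>\<close>: the data \<open>(\<Delta> \<circ> S, \<Delta> \<alpha>, \<Delta> \<beta>)\<close> and
  \<open>((S \<otimes> S) \<circ> \<Delta>\<^sup>c\<^sup>o\<^sup>p, \<gamma>, \<delta>)\<close> are both of this kind, and any two such data are conjugate.
\<close>

definition antipodal :: "('h \<Rightarrow> ('k, 'h) tensor2) \<Rightarrow> ('k, 'h) tensor2 \<Rightarrow> ('k, 'h) tensor2 \<Rightarrow> bool" where
  "antipodal \<sigma> a b \<longleftrightarrow>
     lin tscale \<sigma> \<and> (\<forall>h. \<sigma> h \<in> H2) \<and> a \<in> H2 \<and> b \<in> H2 \<and>
     (\<forall>g h. \<sigma> (g * h) = \<sigma> h \<odot> \<sigma> g) \<and> \<sigma> 1 = pure2 H 1 1 \<and>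
     (\<forall>h. \<DD> h (\<lambda>h1 h2. \<sigma> h1 \<odot> a \<odot> \<Delta> h2) = tscale (\<epsilon> h) a) \<and>
     (\<forall>h. \<DD> h (\<lambda>h1 h2. \<Delta> h1 \<odot> b \<odot> \<sigma> h2) = tscale (\<epsilon> h) b) \<and>
     \<Phi> (\<lambda>x1 x2 x3. \<Delta> x1 \<odot> b \<odot> \<sigma> x2 \<odot> a \<odot> \<Delta> x3) = pure2 H 1 1 \<and>
     \<Psi> (\<lambda>x1 x2 x3. \<sigma> x1 \<odot> a \<odot> \<Delta> x2 \<odot> b \<odot> \<sigma> x3) = pure2 H 1 1"

text \<open>The second zigzag of an antipode \<sigma> with the \<beta>-element and the last factor
  taken from a second antipode \<tau>. For equal data it is the unit; in general it conjugates
  \<tau> into \<sigma>.\<close>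

definition gauge where
  "gauge \<sigma> a b \<tau> = \<Psi> (\<lambda>x1 x2 x3. \<sigma> x1 \<odot> a \<odot> \<Delta> x2 \<odot> b \<odot> \<tau> x3)"

lemma antipodalD:
  assumes "antipodal \<sigma> a b"
  shows "lin (scale H) f \<Longrightarrow> lin tscale (\<lambda>x. \<sigma> (f x))" "\<sigma> h \<in> H2"
    "a \<in> H2" "b \<in> H2" "\<sigma> (g * h) = \<sigma> h \<odot> \<sigma> g" "\<sigma> 1 = pure2 H 1 1"
    "\<Phi> (\<lambda>x1 x2 x3. \<Delta> x1 \<odot> b \<odot> \<sigma> x2 \<odot> a \<odot> \<Delta> x3) = pure2 H 1 1"
    "\<Psi> (\<lambda>x1 x2 x3. \<sigma> x1 \<odot> a \<odot> \<Delta> x2 \<odot> b \<odot> \<sigma> x3) = pure2 H 1 1"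
  using assms by (simp_all add: antipodal_def lin_def)

lemma antipodal_collapse:
  assumes "antipodal \<sigma> a b"
  shows "\<DD> h (\<lambda>h1 h2. m \<odot> \<sigma> h1 \<odot> a \<odot> \<Delta> h2 \<odot> n) = tscale (\<epsilon> h) (m \<odot> a \<odot> n)"
    "\<DD> h (\<lambda>h1 h2. m \<odot> \<Delta> h1 \<odot> b \<odot> \<sigma> h2 \<odot> n) = tscale (\<epsilon> h) (m \<odot> b \<odot> n)"
proof -
  have 1: "\<DD> h (\<lambda>h1 h2. \<sigma> h1 \<odot> a \<odot> \<Delta> h2) = tscale (\<epsilon> h) a"
    and 2: "\<DD> h (\<lambda>h1 h2. \<Delta> h1 \<odot> b \<odot> \<sigma> h2) = tscale (\<epsilon> h) b"
    using assms by (simp_all add: antipodal_def)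
  show "\<DD> h (\<lambda>h1 h2. m \<odot> \<sigma> h1 \<odot> a \<odot> \<Delta> h2 \<odot> n) = tscale (\<epsilon> h) (m \<odot> a \<odot> n)"
    using arg_cong[OF 1, of "\<lambda>t. m \<odot> t \<odot> n"]
    by (simp add: mult2_sum_left mult2_sum_right mult2_assoc mult2_scale antipodalD[OF assms])
  show "\<DD> h (\<lambda>h1 h2. m \<odot> \<Delta> h1 \<odot> b \<odot> \<sigma> h2 \<odot> n) = tscale (\<epsilon> h) (m \<odot> b \<odot> n)"
    using arg_cong[OF 2, of "\<lambda>t. m \<odot> t \<odot> n"]
    by (simp add: mult2_sum_left mult2_sum_right mult2_assoc mult2_scale antipodalD[OF assms])
qed

context
  fixes \<sigma> \<tau> a b c d
  assumes \<sigma>: "antipodal \<sigma> a b" and \<tau>: "antipodal \<tau> c d"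
begin

lemma antipodal_lin:
  "lin (scale H) f \<Longrightarrow> lin tscale (\<lambda>x. \<sigma> (f x))" "lin (scale H) f \<Longrightarrow> lin tscale (\<lambda>x. \<tau> (f x))"
  "\<sigma> h \<in> H2" "\<tau> h \<in> H2" "\<Delta> h \<in> H2"
  "a \<in> H2" "b \<in> H2" "c \<in> H2" "d \<in> H2"
  "x \<odot> y \<in> H2"
  using antipodalD[OF \<sigma>] antipodalD[OF \<tau>] comult_closed by simp_all

lemma gauge_closed: "gauge \<sigma> a d \<tau> \<in> H2"
  by (simp add: gauge_def)

text \<open>The uniqueness argument for antipodes. Part of \<open>h\<close> is inserted as a counit
  in the form \<open>\<Delta> h21 \<odot> d \<odot> \<tau> h22\<close>; \<open>reassoc_nat\<close>
  regroups the coproduct, the halves around \<open>a\<close> collapse, and the remaining factor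
  emerges as \<open>\<tau> h\<close>.\<close>

lemma gauge_conj: "\<sigma> h \<odot> gauge \<sigma> a d \<tau> = gauge \<sigma> a d \<tau> \<odot> \<tau> h" (is "_ = ?R")
proof -
  note [lin_intros] = antipodal_lin
  have 1: "\<DD> u (\<lambda>u1 u2. \<sigma> v \<odot> \<sigma> y1 \<odot> a \<odot> \<Delta> y2 \<odot> \<Delta> u1 \<odot> d \<odot> \<tau> u2 \<odot> \<tau> y3) =
    tscale (\<epsilon> u) (\<sigma> v \<odot> \<sigma> y1 \<odot> a \<odot> \<Delta> y2 \<odot> d \<odot> \<tau> y3)" for u v y1 y2 y3
    using antipodal_collapse(2)[OF \<tau>, of u "\<sigma> v \<odot> \<sigma> y1 \<odot> a \<odot> \<Delta> y2" "\<tau> y3"] by (simp add: mult2_assoc)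
  have 2: "\<DD> u (\<lambda>u1 u2. \<sigma> y1 \<odot> \<sigma> u1 \<odot> a \<odot> \<Delta> u2 \<odot> \<Delta> y2 \<odot> d \<odot> \<tau> y3 \<odot> \<tau> v) =
    tscale (\<epsilon> u) (\<sigma> y1 \<odot> a \<odot> \<Delta> y2 \<odot> d \<odot> \<tau> y3 \<odot> \<tau> v)" for u v y1 y2 y3
    by (rule antipodal_collapse[OF \<sigma>])
  have "\<sigma> h \<odot> gauge \<sigma> a d \<tau> = \<Psi> (\<lambda>y1 y2 y3. \<sigma> h \<odot> \<sigma> y1 \<odot> a \<odot> \<Delta> y2 \<odot> d \<odot> \<tau> y3)"
    by (simp add: gauge_def mult2_sum_right)
  also have "\<dots> = \<Psi> (\<lambda>y1 y2 y3. \<DD> h (\<lambda>h1 h2. tscale (\<epsilon> h2) (\<sigma> h1 \<odot> \<sigma> y1 \<odot> a \<odot> \<Delta> y2 \<odot> d \<odot> \<tau> y3)))"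
    by (subst counit_sum[where s = tscale]; (intro lin_intros)?) simp
  also have "\<dots> = \<Psi> (\<lambda>y1 y2 y3. \<DD> h (\<lambda>h1 h2. \<DD> h2 (\<lambda>h21 h22.
      \<sigma> h1 \<odot> \<sigma> y1 \<odot> a \<odot> \<Delta> y2 \<odot> \<Delta> h21 \<odot> d \<odot> \<tau> h22 \<odot> \<tau> y3)))"
    by (simp only: 1)
  also have "\<dots> = \<Psi> (\<lambda>y1 y2 y3. \<DD> h (\<lambda>h1 h2. \<DD> h1 (\<lambda>h11 h12.
      \<sigma> y1 \<odot> \<sigma> h11 \<odot> a \<odot> \<Delta> h12 \<odot> \<Delta> y2 \<odot> d \<odot> \<tau> y3 \<odot> \<tau> h2)))"
    by (rule via[OF reassoc_nat(2)[symmetric, where h = h and s = tscale and F = "\<lambda>x y z. \<sigma> x \<odot> a \<odot> \<Delta> y \<odot> d \<odot> \<tau> z"]])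
      (intro lin_intros | simp add: antipodalD(5)[OF \<sigma>] antipodalD(5)[OF \<tau>] comult_mult mult2_assoc)+
  also have "\<dots> = \<Psi> (\<lambda>y1 y2 y3. \<DD> h (\<lambda>h1 h2. tscale (\<epsilon> h1) (\<sigma> y1 \<odot> a \<odot> \<Delta> y2 \<odot> d \<odot> \<tau> y3 \<odot> \<tau> h2)))"
    by (simp only: 2)
  also have "\<dots> = \<Psi> (\<lambda>y1 y2 y3. \<sigma> y1 \<odot> a \<odot> \<Delta> y2 \<odot> d \<odot> \<tau> y3 \<odot> \<tau> h)"
    by (subst counit_sum[where s = tscale]; (intro lin_intros)?) simp
  also have "\<dots> = ?R"
    by (simp add: gauge_def mult2_sum_left mult2_assoc)
  finally show ?thesis .
qed

text \<open>Of the four reassociators that replace the inverse tensored with 1, three have a split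
  leg around \<open>a\<close>, \<open>c\<close> or \<open>d\<close> and collapse. The fourth closes
  to the zigzag axiom of \<tau>.\<close>

lemma gauge_alpha: "gauge \<sigma> a d \<tau> \<odot> c = a"
proof -
  note [lin_intros] = antipodal_lin
  have 1: "\<DD> u (\<lambda>u1 u2. \<sigma> y1 \<odot> \<sigma> w1 \<odot> \<sigma> u1 \<odot> a \<odot> \<Delta> u2 \<odot> n) =
    tscale (\<epsilon> u) (\<sigma> y1 \<odot> \<sigma> w1 \<odot> a \<odot> n)" for u y1 w1 n
    using antipodal_collapse(1)[OF \<sigma>, of u "\<sigma> y1 \<odot> \<sigma> w1" n] by (simp add: mult2_assoc)
  have 2: "\<DD> u (\<lambda>u1 u2. \<sigma> y1 \<odot> \<sigma> w1 \<odot> a \<odot> \<Delta> w2 \<odot> \<Delta> x1 \<odot> \<Delta> y21 \<odot> d \<odot> \<tau> y22 \<odot> \<tau> x2 \<odot> \<tau> u1 \<odot> c \<odot> \<Delta> u2 \<odot> n) =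
    tscale (\<epsilon> u) (\<sigma> y1 \<odot> \<sigma> w1 \<odot> a \<odot> \<Delta> w2 \<odot> \<Delta> x1 \<odot> \<Delta> y21 \<odot> d \<odot> \<tau> y22 \<odot> \<tau> x2 \<odot> c \<odot> n)"
    for u y1 w1 w2 n y21 y22 x1 x2
    using antipodal_collapse(1)[OF \<tau>, of u "\<sigma> y1 \<odot> \<sigma> w1 \<odot> a \<odot> \<Delta> w2 \<odot> \<Delta> x1 \<odot> \<Delta> y21 \<odot> d \<odot> \<tau> y22 \<odot> \<tau> x2" n]
    by (simp add: mult2_assoc)
  have 3: "\<DD> u (\<lambda>u1 u2. \<sigma> y1 \<odot> a \<odot> \<Delta> x1 \<odot> \<Delta> u1 \<odot> d \<odot> \<tau> u2 \<odot> n) =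
    tscale (\<epsilon> u) (\<sigma> y1 \<odot> a \<odot> \<Delta> x1 \<odot> d \<odot> n)" for u y1 x1 n
    using antipodal_collapse(2)[OF \<tau>, of u "\<sigma> y1 \<odot> a \<odot> \<Delta> x1" n] by (simp add: mult2_assoc)
  \<comment> \<open>The summand ends in a further factor \<open>\<Delta> w\<close>, which is 1 on
    the left-hand side of the pentagon and so leaves the gauge element times \<open>c\<close>
    there.\<close>
  have "gauge \<sigma> a d \<tau> \<odot> c = \<Phi> (\<lambda>x1 x2 x3. \<Phi> (\<lambda>y1 y2 y3. \<Psi> (\<lambda>z1 z2 z3. \<Psi> (\<lambda>w1 w2 w3.
     \<DD> z1 (\<lambda>z11 z12. \<DD> w3 (\<lambda>w31 w32. \<DD> y2 (\<lambda>y21 y22.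
       \<sigma> y1 \<odot> \<sigma> w1 \<odot> \<sigma> z11 \<odot> a \<odot> \<Delta> z12 \<odot> \<Delta> w2 \<odot> \<Delta> x1 \<odot> \<Delta> y21 \<odot> d \<odot> \<tau> y22 \<odot> \<tau> x2 \<odot> \<tau> w31 \<odot> \<tau> z2 \<odot> c \<odot>
         \<Delta> z3 \<odot> \<Delta> w32 \<odot> \<Delta> x3 \<odot> \<Delta> y3)))))))"
    by (rule via[OF pentagon_sum(4)[where s = tscale and F = "\<lambda>x y z w. \<sigma> x \<odot> a \<odot> \<Delta> y \<odot> d \<odot> \<tau> z \<odot> c \<odot> \<Delta> w"]])
      (intro lin_intros | simp add: antipodalD(5)[OF \<sigma>] antipodalD(5)[OF \<tau>] comult_mult mult2_assoc
        gauge_def mult2_sum_left comult_one mult2_one antipodalD[OF \<tau>])+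
  also have "\<dots> = \<Phi> (\<lambda>x1 x2 x3. \<Phi> (\<lambda>y1 y2 y3. \<Psi> (\<lambda>z1 z2 z3. tscale (\<epsilon> z1) (\<Psi> (\<lambda>w1 w2 w3.
     \<DD> w3 (\<lambda>w31 w32. \<DD> y2 (\<lambda>y21 y22.
       \<sigma> y1 \<odot> \<sigma> w1 \<odot> a \<odot> \<Delta> w2 \<odot> \<Delta> x1 \<odot> \<Delta> y21 \<odot> d \<odot> \<tau> y22 \<odot> \<tau> x2 \<odot> \<tau> w31 \<odot> \<tau> z2 \<odot> c \<odot>
         \<Delta> z3 \<odot> \<Delta> w32 \<odot> \<Delta> x3 \<odot> \<Delta> y3)))))))"
    by (subst sum_swap(1), subst (2) sum_swap(1)) (simp only: 1 vs_simps[OF tscale_vector_space])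
  also have "\<dots> = \<Phi> (\<lambda>x1 x2 x3. \<Phi> (\<lambda>y1 y2 y3. \<Psi> (\<lambda>w1 w2 w3.
     \<DD> w3 (\<lambda>w31 w32. \<DD> y2 (\<lambda>y21 y22.
       \<sigma> y1 \<odot> \<sigma> w1 \<odot> a \<odot> \<Delta> w2 \<odot> \<Delta> x1 \<odot> \<Delta> y21 \<odot> d \<odot> \<tau> y22 \<odot> \<tau> x2 \<odot> \<tau> w31 \<odot> c \<odot>
         \<Delta> w32 \<odot> \<Delta> x3 \<odot> \<Delta> y3)))))"
    by (subst reassoc_inv_counit(1)[where s = tscale]; (intro lin_intros)?)
      (simp add: antipodalD[OF \<tau>] comult_one mult2_one comult_closed)
  also have "\<dots> = \<Phi> (\<lambda>x1 x2 x3. \<Phi> (\<lambda>y1 y2 y3. \<Psi> (\<lambda>w1 w2 w3. tscale (\<epsilon> w3) (\<DD> y2 (\<lambda>y21 y22.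
       \<sigma> y1 \<odot> \<sigma> w1 \<odot> a \<odot> \<Delta> w2 \<odot> \<Delta> x1 \<odot> \<Delta> y21 \<odot> d \<odot> \<tau> y22 \<odot> \<tau> x2 \<odot> c \<odot> \<Delta> x3 \<odot> \<Delta> y3)))))"
    by (subst sum_swap(1)) (simp only: 2 vs_simps[OF tscale_vector_space])
  also have "\<dots> = \<Phi> (\<lambda>x1 x2 x3. \<Phi> (\<lambda>y1 y2 y3. \<DD> y2 (\<lambda>y21 y22.
       \<sigma> y1 \<odot> a \<odot> \<Delta> x1 \<odot> \<Delta> y21 \<odot> d \<odot> \<tau> y22 \<odot> \<tau> x2 \<odot> c \<odot> \<Delta> x3 \<odot> \<Delta> y3)))"
    by (subst reassoc_inv_counit(3)[where s = tscale]; (intro lin_intros)?)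
      (simp add: antipodalD[OF \<sigma>] comult_one mult2_one comult_closed)
  also have "\<dots> = \<Phi> (\<lambda>x1 x2 x3. \<Phi> (\<lambda>y1 y2 y3. tscale (\<epsilon> y2)
       (\<sigma> y1 \<odot> a \<odot> \<Delta> x1 \<odot> d \<odot> \<tau> x2 \<odot> c \<odot> \<Delta> x3 \<odot> \<Delta> y3)))"
    by (simp only: 3)
  also have "\<dots> = \<Phi> (\<lambda>x1 x2 x3. a \<odot> \<Delta> x1 \<odot> d \<odot> \<tau> x2 \<odot> c \<odot> \<Delta> x3)"
    by (subst reassoc_counit2[where s = tscale]; (intro lin_intros)?)
      (simp add: antipodalD[OF \<sigma>] comult_one mult2_one comult_closed)
  also have "\<dots> = a \<odot> \<Phi> (\<lambda>x1 x2 x3. \<Delta> x1 \<odot> d \<odot> \<tau> x2 \<odot> c \<odot> \<Delta> x3)"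
    by (simp add: mult2_sum_right)
  also have "\<dots> = a"
    by (simp add: antipodalD[OF \<tau>] antipodalD[OF \<sigma>] mult2_one)
  finally show ?thesis .
qed

text \<open>The first gauge element is moved through \<open>\<tau> x1\<close> by
  \<open>gauge_conj\<close> and absorbs \<open>c\<close> by \<open>gauge_alpha\<close>; the
  remainder is the zigzag of \<sigma>. Exchanging the two antipodes gives the inverse on the other
  side.\<close>

lemma gauge_mult: "gauge \<sigma> a d \<tau> \<odot> gauge \<tau> c b \<sigma> = pure2 H 1 1" (is "?L = _")
proof -
  have "?L =
    \<Psi> (\<lambda>x1 x2 x3. (gauge \<sigma> a d \<tau> \<odot> \<tau> x1) \<odot> c \<odot> \<Delta> x2 \<odot> b \<odot> \<sigma> x3)"
    by (simp add: gauge_def[of \<tau>] mult2_sum_right mult2_assoc)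
  also have "\<dots> = \<Psi> (\<lambda>x1 x2 x3. \<sigma> x1 \<odot> (gauge \<sigma> a d \<tau> \<odot> c) \<odot> \<Delta> x2 \<odot> b \<odot> \<sigma> x3)"
    by (simp add: mult2_assoc flip: gauge_conj)
  also have "\<dots> = pure2 H 1 1"
    by (simp add: gauge_alpha antipodalD[OF \<sigma>])
  finally show ?thesis .
qed

end

section \<open>The pair antipode and the explicit inverse of f\<close>

definition twisted_antipode :: "'h \<Rightarrow> ('k, 'h) tensor2" ("\<sigma>") where
  "\<sigma> h = \<DD> h (\<lambda>h1 h2. pure2 H (S h2) (S h1))"

lemma sum2_sigma: "lin2 s K \<Longrightarrow> sum2 H (\<sigma> h) K = \<DD> h (\<lambda>h1 h2. K (S h2) (S h1))"
  by (simp add: twisted_antipode_def sum2_sum sum2_pure2)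

lemma sigma_closed [simp]: "\<sigma> h \<in> H2"
  by (simp add: twisted_antipode_def)

lemma comult_closed' [simp]: "\<Delta> h \<in> H2"
  by (rule comult_closed)

lemma tensor2_eqI:
  assumes "x \<in> H2" "y \<in> H2" "sum2 H x (pure2 H) = sum2 H y (pure2 H)"
  shows "x = y"
  using assms by (simp add: sum2_id)

lemma lin2_pure2 [simp]: "lin2 tscale (pure2 H)"
  using lin_pure2'[OF lin_id] by (intro lin2I tscale_vector_space)

lemma sum2_sigma_products:
  assumes K: "lin2 s K"
  shows "sum2 H (\<sigma> h \<odot> x) K = \<DD> h (\<lambda>h1 h2. sum2 H x (\<lambda>x1 x2. K (S h2 * x1) (S h1 * x2)))"
    "sum2 H (\<Delta> h \<odot> x) K = \<DD> h (\<lambda>h1 h2. sum2 H x (\<lambda>x1 x2. K (h1 * x1) (h2 * x2)))"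
proof -
  note [lin_intros] = lin2D[OF K]
  have "lin2 s (\<lambda>u1 u2. sum2 H x (\<lambda>x1 x2. K (u1 * x1) (u2 * x2)))"
    by (intro lin_intros)
  then show "sum2 H (\<sigma> h \<odot> x) K = \<DD> h (\<lambda>h1 h2. sum2 H x (\<lambda>x1 x2. K (S h2 * x1) (S h1 * x2)))"
    "sum2 H (\<Delta> h \<odot> x) K = \<DD> h (\<lambda>h1 h2. sum2 H x (\<lambda>x1 x2. K (h1 * x1) (h2 * x2)))"
    by (simp_all add: sum2_mult2[OF K] sum2_sigma)
qed

text \<open>The identities for \<gamma> and \<delta> proved leg by leg are reassembled as equations
  in the tensor square, by testing both sides against \<open>pure2\<close>.\<close>

lemma antipodal_sigma: "antipodal \<sigma> \<gamma> \<delta>"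
proof -
  have K: "lin2 tscale (\<lambda>x1 x2. pure2 H (u1 * x1) (u2 * x2))" for u1 u2
    by (intro lin_intros)
  note P = lin2_pure2 K
  note simps = sum2_sigma_products[OF K] sum2_sigma_products[OF lin2_pure2] sum2_mult2[OF K, of \<gamma>] sum2_mult2[OF K, of \<delta>]
    sum2_sum[OF lin2_pure2] sum2_sigma[OF K] sum2_sigma[OF lin2_pure2] mult.assoc[symmetric]
  have tscale_closed: "tscale k x \<in> H2" if "x \<in> H2" for k and x :: "('k, 'h) tensor2"
    using that unfolding tpow2_def by (rule tscale_in_tensor_space[rotated]) simp
  have 1: "lin tscale \<sigma>"
    unfolding twisted_antipode_def by (intro lin_intros)
  have 2: "\<sigma> (g * h) = \<sigma> h \<odot> \<sigma> g" for g h
  proof (rule tensor2_eqI)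
    have "lin2 tscale (\<lambda>h1 h2. pure2 H (S h2) (S h1))"
      by (intro lin_intros)
    from comult_mult_sum[OF this]
    show "sum2 H (\<sigma> (g * h)) (pure2 H) = sum2 H (\<sigma> h \<odot> \<sigma> g) (pure2 H)"
      by (simp add: simps antipode_mult) (rule sum_swap)
  qed simp_all
  have 3: "\<sigma> 1 = pure2 H 1 1"
    by (simp add: twisted_antipode_def comult_one_sum[where s = tscale] lin_intros antipode_one)
  have 4: "\<DD> h (\<lambda>h1 h2. \<sigma> h1 \<odot> \<gamma> \<odot> \<Delta> h2) = tscale (\<epsilon> h) \<gamma>" for h
  proof (rule tensor2_eqI)
    show "sum2 H (\<DD> h (\<lambda>h1 h2. \<sigma> h1 \<odot> \<gamma> \<odot> \<Delta> h2)) (pure2 H) = sum2 H (tscale (\<epsilon> h) \<gamma>) (pure2 H)"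
      using gamma_nat[OF lin2_pure2, of h]
      by (simp add: simps front_gamma_delta sum2_scale_arg[OF lin2_pure2])
  qed (simp_all add: tscale_closed)
  have 5: "\<DD> h (\<lambda>h1 h2. \<Delta> h1 \<odot> \<delta> \<odot> \<sigma> h2) = tscale (\<epsilon> h) \<delta>" for h
  proof (rule tensor2_eqI)
    show "sum2 H (\<DD> h (\<lambda>h1 h2. \<Delta> h1 \<odot> \<delta> \<odot> \<sigma> h2)) (pure2 H) = sum2 H (tscale (\<epsilon> h) \<delta>) (pure2 H)"
      using delta_nat[OF lin2_pure2, of h]
      by (simp add: simps front_gamma_delta sum2_scale_arg[OF lin2_pure2])
  qed (simp_all add: tscale_closed)
  have 6: "\<Phi> (\<lambda>x1 x2 x3. \<Delta> x1 \<odot> \<delta> \<odot> \<sigma> x2 \<odot> \<gamma> \<odot> \<Delta> x3) = pure2 H 1 1"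
  proof (rule tensor2_eqI)
    show "sum2 H (\<Phi> (\<lambda>x1 x2 x3. \<Delta> x1 \<odot> \<delta> \<odot> \<sigma> x2 \<odot> \<gamma> \<odot> \<Delta> x3)) (pure2 H) = sum2 H (pure2 H 1 1) (pure2 H)"
      apply (rule via[OF gamma_delta_zigzag[OF lin2_pure2]])
      apply (simp add: simps front_gamma_delta)
      apply (subst (3) sum_swap(1), subst (4) sum_swap(1), rule refl)
      by (simp add: sum2_pure2[OF lin2_pure2])
  qed simp_all
  have 7: "\<Psi> (\<lambda>x1 x2 x3. \<sigma> x1 \<odot> \<gamma> \<odot> \<Delta> x2 \<odot> \<delta> \<odot> \<sigma> x3) = pure2 H 1 1"
  proof (rule tensor2_eqI)
    show "sum2 H (\<Psi> (\<lambda>x1 x2 x3. \<sigma> x1 \<odot> \<gamma> \<odot> \<Delta> x2 \<odot> \<delta> \<odot> \<sigma> x3)) (pure2 H) = sum2 H (pure2 H 1 1) (pure2 H)"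
      apply (rule via[OF gamma_delta_zigzag_inv[OF lin2_pure2]])
      apply (simp add: simps front_gamma_delta)
      apply (subst (3) sum_swap(1), subst (4) sum_swap(1), rule refl)
      by (simp add: sum2_pure2[OF lin2_pure2])
  qed simp_all
  show ?thesis
    unfolding antipodal_def by (simp add: 1 2 3 4 5 6 7)
qed

text \<open>The image of the antipode axioms for \<open>S\<close>, \<alpha> and \<beta> under the
  algebra map \<Delta>.\<close>

lemma antipodal_comult: "antipodal (\<lambda>h. \<Delta> (S h)) (\<Delta> \<alpha>) (\<Delta> \<beta>)"
proof -
  have lin: "lin tscale \<Delta>"
    using lin_comult_self[OF lin_id] .
  show ?thesis
    unfolding antipodal_def
    using antipode_sum[OF lin] zigzag_sum[OF lin]
    by (simp add: antipode_mult antipode_one comult_one lin_intros flip: comult_mult)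
qed

definition f_inverse where
  "f_inverse = gauge (\<lambda>h. \<Delta> (S h)) (\<Delta> \<alpha>) \<delta> \<sigma>"

text \<open>The second leg of \<open>pR\<close> is a product containing \<beta>, and \<Delta> splits
  it into the last three factors of a gauge element.\<close>

lemma f_elem_gauge: "f_elem H = gauge \<sigma> \<gamma> (\<Delta> \<beta>) (\<lambda>h. \<Delta> (S h))"
proof -
  have "sum2 H (pR H) (\<lambda>p1 p2. \<sigma> p1 \<odot> \<gamma> \<odot> \<Delta> p2) = gauge \<sigma> \<gamma> (\<Delta> \<beta>) (\<lambda>h. \<Delta> (S h))"
    unfolding pR_def gauge_def
    by (subst sum2_sum[where s = tscale];
       (intro lin_intros antipodalD(1)[OF antipodal_sigma] mult_closed comult_closed')?)
      (simp_all add: sum2_pure2[where s = tscale] lin_intros antipodalD[OF antipodal_sigma] comult_mult mult2_assoc)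
  then show ?thesis
    by (simp add: f_elem_def twisted_antipode_def mult2_assoc)
qed

text \<open>The gauge element with exchanged roles is a two-sided inverse by
  \<open>gauge_mult\<close>, and uniqueness identifies it with the definite description.\<close>

lemma f_inv_eq: "f_inv H = f_inverse"
  unfolding f_inv_def
proof (rule inverse2_eqI)
  show "is_inverse2 H (f_elem H) f_inverse"
    unfolding is_inverse2_def f_elem_gauge f_inverse_def
    using gauge_mult[OF antipodal_sigma antipodal_comult] gauge_mult[OF antipodal_comult antipodal_sigma]
      gauge_closed[OF antipodal_comult antipodal_sigma] by simp
  show "f_elem H \<in> H2"
    unfolding f_elem_gauge by (rule gauge_closed[OF antipodal_sigma antipodal_comult])
qed

lemma f_inv_closed [simp]: "f_inv H \<in> H2"
  and f_elem_mult_inv: "f_elem H \<odot> f_inv H = pure2 H 1 1"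
  using gauge_mult[OF antipodal_sigma antipodal_comult] gauge_closed[OF antipodal_comult antipodal_sigma]
  by (simp_all add: f_elem_gauge f_inv_eq f_inverse_def)

section \<open>Normalisation of f under the counit\<close>

lemma counit_antipode: "\<epsilon> (S h) = \<epsilon> h"
proof -
  have lin: "lin (*) \<epsilon>"
    using lin_eps[OF lin_id] .
  have "\<DD> h (\<lambda>h1 h2. \<epsilon> (S h1 * (\<alpha> * h2))) = \<epsilon> h * \<epsilon> \<alpha>"
    by (rule antipode_sum(1)[OF lin])
  then have "\<DD> h (\<lambda>h1 h2. \<epsilon> h2 * \<epsilon> (S h1)) = \<epsilon> h"
    by (simp add: counit_mult counit_alpha mult.commute)
  moreover have "\<DD> h (\<lambda>h1 h2. \<epsilon> h2 * \<epsilon> (S h1)) = \<epsilon> (S h)"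
    by (rule counit_sum(2)[where s = "(*)" and f = "\<lambda>x. \<epsilon> (S x)"]) (intro lin_intros)
  ultimately show ?thesis by simp
qed

text \<open>The algebra map applying the counit to the second leg. It sends
  \<open>\<Delta> h\<close> to \<open>h\<close>, \<open>\<sigma> h\<close> to \<open>S h\<close> and
  \<gamma> to \<alpha>.\<close>

definition counit_second :: "('k, 'h) tensor2 \<Rightarrow> 'h" where
  "counit_second t = sum2 H t (\<lambda>a b. scale H (\<epsilon> b) a)"

lemma lin2_counit_second: "lin2 (scale H) (\<lambda>a b. scale H (\<epsilon> b) a)"
  by (intro lin_intros)

lemma counit_second_mult: "counit_second (x \<odot> y) = counit_second x * counit_second y"
proof -
  have *: "c * (sum2 H y F) = sum2 H y (\<lambda>a b. c * F a b)" "(sum2 H x F) * c = sum2 H x (\<lambda>a b. F a b * c)" for c :: 'h and F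
    using sum_hom(1)[of "\<lambda>z. c * z" y F] sum_hom(1)[of "\<lambda>z. z * c" x F] by (simp_all add: algebra_simps)
  show ?thesis
    unfolding counit_second_def sum2_mult2[OF lin2_counit_second] *(2)
    unfolding *(1) by (simp add: scale_mult_left scale_mult_right counit_mult mult.commute)
qed

lemma counit_second_comult: "counit_second (\<Delta> h) = h"
  by (simp add: counit_second_def counit_right)

text \<open>Applied factor by factor to the gauge form of \<open>f_elem\<close>, the map yields the
  zigzag axiom for the inverse reassociator. The standing normalisation of \<alpha> enters through
  the value on \<gamma>.\<close>

lemma counit_second_f: "counit_second (f_elem H) = 1"
proof -
  have \<sigma>: "counit_second (\<sigma> h) = S h" for h
    using counit_sum(1)[where s = "scale H" and f = S and h = h] lin_S[OF lin_id]
    by (simp add: counit_second_def sum2_sigma[OF lin2_counit_second] counit_antipode)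
  note simps = sweedler vs_simps[OF vsH] counit_one counit_alpha counit_antipode antipode_one
  have "counit_second \<gamma> = \<Phi> (\<lambda>x1 x2 x3. scale H (\<epsilon> x1) (\<Psi> (\<lambda>y1 y2 y3. scale H (\<epsilon> y3) (\<DD> x3 (\<lambda>x31 x32.
      scale H (\<epsilon> x32) (S x2 * (S y1 * (\<alpha> * (y2 * x31)))))))))"
    unfolding counit_second_def sum_gamma[OF lin2_counit_second] by (simp add: simps)
  also have "\<dots> = \<Phi> (\<lambda>x1 x2 x3. scale H (\<epsilon> x1) (\<Psi> (\<lambda>y1 y2 y3. scale H (\<epsilon> y3) (S x2 * (S y1 * (\<alpha> * (y2 * x3)))))))"
    by (subst counit_sum(2)[where s = "scale H"]; (intro lin_intros)?) simp
  also have "\<dots> = \<Phi> (\<lambda>x1 x2 x3. scale H (\<epsilon> x1) (S x2 * (\<alpha> * x3)))"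
    by (subst reassoc_inv_counit(3)[where s = "scale H"]; (intro lin_intros)?) (simp add: simps)
  also have "\<dots> = \<alpha>"
    by (subst reassoc_counit1[where s = "scale H"]; (intro lin_intros)?) (simp add: simps)
  finally have "counit_second \<gamma> = \<alpha>" .
  then have "counit_second (f_elem H) = \<Psi> (\<lambda>x1 x2 x3. S x1 * (\<alpha> * (x2 * (\<beta> * S x3))))"
    unfolding f_elem_gauge gauge_def
    by (simp add: counit_second_def sum2_sum[OF lin2_counit_second])
      (simp add: counit_second_mult counit_second_comult \<sigma> flip: counit_second_def)
  also have "\<dots> = 1"
    by (rule zigzag_sum(2)[where f = "\<lambda>x. x" and s = "scale H"]) (intro lin_intros)
  finally show ?thesis .
qed

lemma f_inv_counit:
  assumes "lin s K"
  shows "sum2 H (f_inv H) (\<lambda>f1 f2. s (\<epsilon> f2) (K f1)) = K 1"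
proof -
  have "counit_second (f_elem H) * counit_second (f_inv H) = 1"
    unfolding counit_second_mult[symmetric] f_elem_mult_inv
    by (simp add: counit_second_def sum2_pure2[OF lin2_counit_second] counit_one)
  then have "counit_second (f_inv H) = 1"
    by (simp add: counit_second_f)
  from arg_cong[OF this, of K] show ?thesis
    by (simp add: counit_second_def lin_hom[OF assms] lin_scale[OF assms])
qed

subsection \<open>The coactions and the product\<close>

abbreviation "\<kappa> \<equiv> unit_hmod H"
abbreviation "\<iota> \<equiv> to_A H"
abbreviation "A \<equiv> A_obj H"

lemma unit_hmod_simps [simp]:
  "carrier \<kappa> = UNIV" "scale \<kappa> = (*)" "act \<kappa> h k = \<epsilon> h * k"
  by (simp_all add: unit_hmod_def)

lemma A_simps [simp]: "carrier A = carrier (tensor_space H \<kappa>)" "scale A = tscale"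
  by (simp_all add: A_obj_def R_obj_def)

lemma pure_unit: "pure H \<kappa> x k = \<iota> (scale H k x)"
  using pure_scale_left[of x H 1 \<kappa> k] pure_scale_right[of x H 1 \<kappa> k] by (simp add: to_A_def)

lemma lin_iota [lin_intros]: "lin (scale H) f \<Longrightarrow> lin tscale (\<lambda>x. \<iota> (f x))"
  unfolding to_A_def by (intro lin_intros) simp_all

lemma iota_closed [simp]: "\<iota> x \<in> carrier (tensor_space H \<kappa>)"
  by (simp add: to_A_def)

lemma iota_sum: "\<iota> (sum2 H t2 G2) = sum2 H t2 (\<lambda>a b. \<iota> (G2 a b))" "\<iota> (sum3 H t3 G3) = sum3 H t3 (\<lambda>a b c. \<iota> (G3 a b c))"
  using lin_hom[OF lin_iota[OF lin_id]] by auto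

lemma iota_surj:
  assumes "x \<in> carrier (tensor_space H \<kappa>)" obtains a where "x = \<iota> a"
proof -
  from assms obtain l where "expansion H \<kappa> x l"
    by (auto simp: tensor_space_def)
  then have "x = (\<Sum>(a, k)\<leftarrow>l. \<iota> (scale H k a))"
    by (simp add: expansion_def pure_unit)
  also have "\<dots> = \<iota> (\<Sum>(a, k)\<leftarrow>l. scale H k a)"
    using lin_iota[OF lin_id] by (subst additive_sum_list[of \<iota>]) (simp_all add: lin_def split_def)
  finally show ?thesis by (rule that)
qed

lemma tlift_iota:
  assumes "vector_space s" and G: "lin s G" and F: "\<And>a k. F a k = s k (G a)"
  shows "tlift H \<kappa> (\<iota> a) F = G a"
proof -
  interpret vector_space s by fact
  have "F = (\<lambda>a k. s k (G a))"
    by (simp add: F fun_eq_iff)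
  then have "bilinear_on H \<kappa> s F"
    using G by (simp add: bilinear_on_def lin_def scale_right_distrib scale_left_distrib mult.commute)
  then show ?thesis
    unfolding to_A_def by (subst tlift_pure[OF assms(1)]) (simp_all add: F)
qed

text \<open>The inverse is induced by scalar multiplication, sending \<open>x \<otimes> k\<close> to
  \<open>k x\<close>.\<close>

lemma iota_inj: "inj \<iota>"
proof (rule inj_on_inverseI)
  fix a
  show "tlift H \<kappa> (\<iota> a) (\<lambda>x k. scale H k x) = a"
    by (rule tlift_iota[where s = "scale H" and G = "\<lambda>x. x"]) (intro lin_intros | rule refl)+
qed

text \<open>Since \<iota> is linear and onto the carrier of \<open>A\<close>, bilinearity can be
  tested on its images, where \<open>lin_intros\<close> applies.\<close>

lemma bilinear_iota:
  assumes "vector_space s" and W: "W = A" and F: "lin2 s (\<lambda>h a. F h (\<iota> a))"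
  shows "bilinear_on H W s F"
  unfolding bilinear_on_def W
proof (intro conjI allI ballI)
  note F' = F[unfolded lin2_def lin_def]
  have i: "\<iota> (a + b) = \<iota> a + \<iota> b" "\<iota> (scale H k a) = tscale k (\<iota> a)" for a b k
    using lin_iota[OF lin_id] by (simp_all add: lin_def)
  fix v v' w w' c
  assume "w \<in> carrier A"
  then obtain x where x: "w = \<iota> x"
    using iota_surj by auto
  show "F (v + v') w = F v w + F v' w" "F (scale H c v) w = s c (F v w)" "F v (scale A c w) = s c (F v w)"
    using F' by (simp_all add: x flip: i)
  assume "w' \<in> carrier A"
  then obtain x' where "w' = \<iota> x'"
    using iota_surj by auto
  then show "F v (w + w') = F v w + F v w'"
    using F' by (simp add: x flip: i)
qed

lemma bilinear_iota2:
  assumes "carrier V = carrier A" "carrier W = carrier A" "scale V = tscale" "scale W = tscale"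
    and F: "lin2 s (\<lambda>a b. F (\<iota> a) (\<iota> b))"
  shows "bilinear_on V W s F"
  unfolding bilinear_on_def assms(1-4)
proof (intro conjI allI ballI)
  note F' = F[unfolded lin2_def lin_def]
  have i: "\<iota> (a + b) = \<iota> a + \<iota> b" "\<iota> (scale H k a) = tscale k (\<iota> a)" for a b k
    using lin_iota[OF lin_id] by (simp_all add: lin_def)
  fix v v' w w' c
  assume "w \<in> carrier A" "v \<in> carrier A"
  then obtain x y where x: "w = \<iota> x" "v = \<iota> y"
    using iota_surj by (metis A_simps(1))
  show "F (tscale c v) w = s c (F v w)" "F v (tscale c w) = s c (F v w)"
    using F' by (simp_all add: x flip: i)
  {
    assume "w' \<in> carrier A"
    then obtain x' where "w' = \<iota> x'"
      using iota_surj by auto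
    then show "F v (w + w') = F v w + F v w'"
      using F' by (simp add: x flip: i)
  next
    assume "v' \<in> carrier A"
    then obtain x' where "v' = \<iota> x'"
      using iota_surj by auto
    then show "F (v + v') w = F v w + F v' w"
      using F' by (simp add: x flip: i)
  }
qed

lemma lin_pureA [lin_intros]:
  "lin (scale H) f \<Longrightarrow> lin tscale (\<lambda>x. pure H A (f x) (\<iota> b))"
  "lin (scale H) f \<Longrightarrow> lin tscale (\<lambda>x. pure H A a (\<iota> (f x)))"
  using lin_iota[of f] by (intro lin_pure1 lin_pure2; simp)+

lemma pureA_sum: "pure H A u (\<iota> (sum2 H t2 G2)) = sum2 H t2 (\<lambda>a b. pure H A u (\<iota> (G2 a b)))"
  using lin_hom[OF lin_pureA(2)[OF lin_id]] by auto

text \<open>On the trivial module the leg \<open>h12\<close> acts through its counit, which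
  contracts the inner coproduct to \<open>h1\<close>.\<close>

lemma act_A: "act A h (\<iota> a) = \<iota> (\<DD> h (\<lambda>h1 h2. h1 * a * S h2))"
proof -
  have "act A h (\<iota> a) = tlift H \<kappa> (\<iota> a) (\<lambda>a v. \<DD> h (\<lambda>h1 h2. \<DD> h1 (\<lambda>h11 h12. pure H \<kappa> (h11 * a * S h2) (\<epsilon> h12 * v))))"
    by (simp add: A_obj_def R_obj_def)
  also have "\<dots> = \<DD> h (\<lambda>h1 h2. \<DD> h1 (\<lambda>h11 h12. tscale (\<epsilon> h12) (\<iota> (h11 * a * S h2))))"
    by (rule tlift_iota[where s = tscale])
      (intro lin_intros | simp add: vs_simps[OF tscale_vector_space] pure_unit lin_scale[OF lin_iota[OF lin_id]] mult.commute)+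
  also have "\<dots> = \<DD> h (\<lambda>h1 h2. \<iota> (h1 * a * S h2))"
    by (subst counit_sum(2)[where s = tscale]; (intro lin_intros)?) simp
  finally show ?thesis
    by (simp add: iota_sum)
qed

text \<open>Pure tensors depend only on the carrier and the scalar multiplication, so the bare space
  used inside \<open>R_obj\<close> may be replaced by the record \<open>A\<close>, and later by the
  tensor square of \<open>A\<close> as a module.\<close>

lemma pure_space_cong:
  "carrier W = carrier W' \<Longrightarrow> scale W = scale W' \<Longrightarrow> pure V W = pure V W'"
  by (simp add: pure_def bilinear_on_def fun_eq_iff)

lemma pure_A: "pure H (tensor_space H \<kappa>) = pure H A"
  by (rule pure_space_cong) (simp_all add: tensor_space_def)

section \<open>Evaluating omega and the coactions\<close>

lemma sum4_chi:
  assumes "lin4 s G"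
  shows "sum4 H (chi H) G = \<Phi> (\<lambda>x1 x2 x3. \<Psi> (\<lambda>y1 y2 y3. \<DD> y1 (\<lambda>y11 y12. G (x1 * y11) (x2 * y12) (x3 * y2) y3)))"
proof -
  have "chi H = mult4 H (E4 \<phi>) (E1 \<psi>)"
    by (simp add: chi_def E_defs)
  with assms show ?thesis
    by (simp add: sum4_mult4_E[where s = s] sum4_E[where s = s] lin_intros lin4D[OF assms] front)
qed

lemma sum5_omega:
  assumes F: "lin5 s F"
  shows "sum5 H (omega H) F = sum2 H (f_inv H) (\<lambda>f1 f2. sum4 H (chi H) (\<lambda>x1 x2 x3 x4. \<DD> x2 (\<lambda>x21 x22.
    \<Phi> (\<lambda>y1 y2 y3. F (x1 * y1) (x21 * y2) (x22 * y3) (f2 * S x3) (f1 * S x4)))))"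
proof -
  note [lin_intros] = lin5D[OF F]
  \<comment> \<open>The threefold product defining \<open>omega\<close> is evaluated from the right:
    \<open>F1\<close> absorbs the trailing reassociator and \<open>F2\<close> the factor coming from
    \<open>chi\<close>.\<close>
  define F1 where "F1 = (\<lambda>a b c d e. \<Phi> (\<lambda>y1 y2 y3. F (a * y1) (b * y2) (c * y3) d e))"
  have F1: "lin5 s F1"
    unfolding F1_def by (intro lin_intros)
  define F2 where "F2 = (\<lambda>a b c d e. sum4 H (chi H) (\<lambda>x1 x2 x3 x4. \<DD> x2 (\<lambda>x21 x22. F1 (a * x1) (b * x21) (c * x22) (d * S x3) (e * S x4))))"
  have F2: "lin5 s F2"
    unfolding F2_def by (intro lin_intros lin5D[OF F1])
  have 1: "lin5 s (\<lambda>y1 y2 y3 y4 y5. F (x1 * y1) (x2 * y2) (x3 * y3) (x4 * y4) (x5 * y5))" for x1 x2 x3 x4 x5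
    by (intro lin_intros)
  have 2: "lin5 s (\<lambda>y1 y2 y3 y4 y5. F1 (x1 * y1) (x2 * y2) (x3 * y3) (x4 * y4) (x5 * y5))" for x1 x2 x3 x4 x5
    by (intro lin_intros lin5D[OF F1])
  let ?C = "\<Phi> (\<lambda>x1 x2 x3. pure5 H x1 x2 x3 1 1)"
  let ?B = "sum4 H (chi H) (\<lambda>x1 x2 x3 x4. \<DD> x2 (\<lambda>x21 x22. pure5 H x1 x21 x22 (S x3) (S x4)))"
  have "sum5 H (omega H) F = sum5 H (mult5 H (sum2 H (f_inv H) (\<lambda>f1 f2. pure5 H 1 1 1 f2 f1)) ?B) F1"
    by (simp add: omega_def sum5_mult5[OF F] sum5_sum[OF 1] sum5_pure5[OF 1] flip: F1_def)
  also have "\<dots> = sum5 H (sum2 H (f_inv H) (\<lambda>f1 f2. pure5 H 1 1 1 f2 f1)) F2"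
    by (simp add: sum5_mult5[OF F1] sum5_sum[OF 2] sum5_pure5[OF 2] flip: F2_def)
  also have "\<dots> = sum2 H (f_inv H) (\<lambda>f1 f2. F2 1 1 1 f2 f1)"
    by (simp add: sum5_sum[OF F2] sum5_pure5[OF F2])
  finally show ?thesis
    by (simp add: F2_def F1_def)
qed

text \<open>The third leg consists of the third leg of the trailing \<phi> and one coproduct half
  from \<open>chi\<close>. The counit trivialises the former and contracts the latter, so only
  \<open>chi\<close> and the inverse of \<open>f_elem\<close> remain.\<close>

lemma sum5_omega_counit:
  assumes Q: "lin4 s Q"
  shows "sum5 H (omega H) (\<lambda>w1 w2 w3 w4 w5. s (\<epsilon> w3) (Q w1 w2 w4 w5)) =
    \<Phi> (\<lambda>x1 x2 x3. \<Psi> (\<lambda>y1 y2 y3. \<DD> y1 (\<lambda>y11 y12. sum2 H (f_inv H) (\<lambda>f1 f2.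
      Q (x1 * y11) (x2 * y12) (f2 * S (x3 * y2)) (f1 * S y3)))))" (is "?L = ?R")
proof -
  note [lin_intros] = lin4D[OF Q]
  note vs = lin4_vs[OF Q]
  have F: "lin5 s (\<lambda>w1 w2 w3 w4 w5. s (\<epsilon> w3) (Q w1 w2 w4 w5))"
    by (intro lin_intros)
  have "?L =
    sum2 H (f_inv H) (\<lambda>f1 f2. sum4 H (chi H) (\<lambda>x1 x2 x3 x4. \<DD> x2 (\<lambda>x21 x22. s (\<epsilon> x22)
      (\<Phi> (\<lambda>y1 y2 y3. s (\<epsilon> y3) (Q (x1 * y1) (x21 * y2) (f2 * S x3) (f1 * S x4)))))))"
    by (simp add: sum5_omega[OF F] counit_mult vs_simps[OF vs])
  also have "\<dots> = sum2 H (f_inv H) (\<lambda>f1 f2. sum4 H (chi H) (\<lambda>x1 x2 x3 x4. \<DD> x2 (\<lambda>x21 x22. s (\<epsilon> x22)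
      (Q x1 x21 (f2 * S x3) (f1 * S x4)))))"
    by (subst reassoc_counit3[where s = s]; (intro lin_intros)?) simp
  also have "\<dots> = sum2 H (f_inv H) (\<lambda>f1 f2. sum4 H (chi H) (\<lambda>x1 x2 x3 x4. Q x1 x2 (f2 * S x3) (f1 * S x4)))"
    by (subst counit_sum(2)[where s = s]; (intro lin_intros)?) simp
  also have "\<dots> = sum2 H (f_inv H) (\<lambda>f1 f2. \<Phi> (\<lambda>x1 x2 x3. \<Psi> (\<lambda>y1 y2 y3. \<DD> y1 (\<lambda>y11 y12.
      Q (x1 * y11) (x2 * y12) (f2 * S (x3 * y2)) (f1 * S y3)))))"
    by (subst sum4_chi[where s = s]; (intro lin_intros)?) simp
  also have "\<dots> = ?R"
    by (simp only: front sum_swap(1)[of "f_inv H"])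
  finally show ?thesis .
qed

lemma coact_A: "coact A (\<iota> a) =
  \<Phi> (\<lambda>x1 x2 x3. \<Psi> (\<lambda>y1 y2 y3. \<DD> y1 (\<lambda>y11 y12. \<DD> a (\<lambda>a1 a2. sum2 H (f_inv H) (\<lambda>f1 f2.
    pure H A (x1 * y11 * a1 * f1 * S y3) (\<iota> (x2 * y12 * a2 * f2 * S (x3 * y2))))))))"
proof -
  have 1: "pure H (tensor_space H \<kappa>) u (pure H \<kappa> x k) = tscale k (pure H A u (\<iota> x))" for u x k
    using lin_scale[OF lin_pureA(2)[OF lin_id]] by (simp add: pure_A pure_unit)
  have "coact A (\<iota> a) = tlift H \<kappa> (\<iota> a) (\<lambda>a v. sum5 H (omega H) (\<lambda>w1 w2 w3 w4 w5. \<DD> a (\<lambda>a1 a2.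
    pure H (tensor_space H \<kappa>) (w1 * a1 * w5) (pure H \<kappa> (w2 * a2 * w4) (\<epsilon> w3 * v)))))"
    by (simp add: A_obj_def R_obj_def)
  also have "\<dots> = sum5 H (omega H) (\<lambda>w1 w2 w3 w4 w5. tscale (\<epsilon> w3) (\<DD> a (\<lambda>a1 a2.
    pure H A (w1 * a1 * w5) (\<iota> (w2 * a2 * w4)))))"
    by (rule tlift_iota[where s = tscale])
      (intro lin_intros | simp add: 1 vs_simps[OF tscale_vector_space] vs_scale_sum[OF tscale_vector_space] mult.commute)+
  also have "\<dots> = \<Phi> (\<lambda>x1 x2 x3. \<Psi> (\<lambda>y1 y2 y3. \<DD> y1 (\<lambda>y11 y12. sum2 H (f_inv H) (\<lambda>f1 f2. \<DD> a (\<lambda>a1 a2.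
    pure H A (x1 * y11 * a1 * (f1 * S y3)) (\<iota> (x2 * y12 * a2 * (f2 * S (x3 * y2)))))))))"
    by (rule sum5_omega_counit) (intro lin_intros)
  finally show ?thesis
    by (simp only: mult.assoc sum_swap(1)[of "f_inv H"])
qed

lemma tlift_A:
  assumes "lin2 s (\<lambda>h a. F h (\<iota> a))"
  shows "tlift H A (pure H A h (\<iota> a)) F = F h (\<iota> a)"
  using lin2_vs[OF assms] by (intro tlift_pure[OF _ bilinear_iota[OF _ refl assms]]) simp_all

lemma tlift_coact_A:
  assumes "lin2 s (\<lambda>h a. F h (\<iota> a))"
  shows "tlift H A (coact A (\<iota> a)) F =
  \<Phi> (\<lambda>x1 x2 x3. \<Psi> (\<lambda>y1 y2 y3. \<DD> y1 (\<lambda>y11 y12. \<DD> a (\<lambda>a1 a2. sum2 H (f_inv H) (\<lambda>f1 f2.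
    F (x1 * y11 * a1 * f1 * S y3) (\<iota> (x2 * y12 * a2 * f2 * S (x3 * y2))))))))"
  using tlift_sum[OF lin2_vs[OF assms] bilinear_iota[OF lin2_vs[OF assms] refl assms]]
  unfolding coact_A by (simp add: tlift_A[OF assms])

context
  assumes bij: "bij S"
begin

lemma antipode_inv: "S (inv S x) = x"
  using bij by (simp add: bij_is_surj surj_f_inv_f)

lemma sum_qR:
  assumes "lin2 s K"
  shows "sum2 H (qR H) K = \<Phi> (\<lambda>x1 x2 x3. K x1 (inv S (\<alpha> * x3) * x2))"
  unfolding qR_def by (simp add: sum2_sum[OF assms] sum2_pure2[OF assms])

text \<open>Trades the inverse reassociator of the second-kind formula for the additional copy of
  \<phi> in the first-kind one. Bijectivity of \<open>S\<close> turns \<open>S q2\<close> into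
  \<open>S x2 * \<alpha> * x3\<close>; after the pentagon one \<phi> collapses around this
  \<alpha>.\<close>

lemma qR_pentagon:
  assumes G: "lin3 s G"
  shows "sum2 H (qR H) (\<lambda>q1 q2. \<Psi> (\<lambda>y1 y2 y3. \<DD> q1 (\<lambda>q11 q12. G (q11 * y1) (q12 * y2) (S y3 * S q2)))) =
    sum2 H (qR H) (\<lambda>q1 q2. \<Phi> (\<lambda>y1 y2 y3. \<DD> y2 (\<lambda>y21 y22. G y1 (q1 * y21) (S y22 * (S q2 * y3)))))"
proof -
  note [lin_intros] = lin3D[OF G]
  have "sum2 H (qR H) (\<lambda>q1 q2. \<Phi> (\<lambda>y1 y2 y3. \<DD> y2 (\<lambda>y21 y22. G y1 (q1 * y21) (S y22 * (S q2 * y3))))) =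
    \<Phi> (\<lambda>x1 x2 x3. \<Phi> (\<lambda>y1 y2 y3. \<DD> y2 (\<lambda>y21 y22. G y1 (x1 * y21) (S y22 * (S x2 * (\<alpha> * (x3 * y3)))))))"
    by (subst sum_qR[where s = s]; (intro lin_intros)?) (simp add: sweedler antipode_inv)
  also have "\<dots> = \<Phi> (\<lambda>x1 x2 x3. \<DD> x3 (\<lambda>x31 x32. \<Phi> (\<lambda>y1 y2 y3. \<Psi> (\<lambda>z1 z2 z3. \<DD> y1 (\<lambda>y11 y12.
      G (x1 * (y11 * z1)) (x2 * (y12 * z2)) (S z3 * (S y2 * (S x31 * (\<alpha> * (x32 * y3))))))))))"
    by (rule via[OF pentagon_sum(2)[where s = s and F = "\<lambda>a b c d. G a b (S c * (\<alpha> * d))"]])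
      (intro lin_intros | simp add: sweedler)+
  also have "\<dots> = \<Phi> (\<lambda>y1 y2 y3. \<Psi> (\<lambda>z1 z2 z3. \<DD> y1 (\<lambda>y11 y12.
      G (y11 * z1) (y12 * z2) (S z3 * (S y2 * (\<alpha> * y3))))))"
    by (rule via[OF reassoc_alpha(2)[where s = s and K = "\<lambda>a b m. \<Phi> (\<lambda>y1 y2 y3. \<Psi> (\<lambda>z1 z2 z3. \<DD> y1 (\<lambda>y11 y12.
      G (a * (y11 * z1)) (b * (y12 * z2)) (S z3 * (S y2 * (m * y3))))))"]])
      (intro lin_intros | simp add: sweedler)+
  also have "\<dots> = sum2 H (qR H) (\<lambda>q1 q2. \<Psi> (\<lambda>y1 y2 y3. \<DD> q1 (\<lambda>q11 q12. G (q11 * y1) (q12 * y2) (S y3 * S q2))))"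
    by (subst sum_qR[where s = s]; (intro lin_intros)?) (simp add: sweedler antipode_inv)
  finally show ?thesis by simp
qed

lemma coact_first_A: "coact_first H A (\<iota> a) =
  \<Phi> (\<lambda>x1 x2 x3. \<Phi> (\<lambda>y1 y2 y3. \<DD> y1 (\<lambda>y11 y12. \<DD> y2 (\<lambda>y21 y22. \<DD> a (\<lambda>a1 a2.
   sum2 H (f_inv H) (\<lambda>f1 f2. sum2 H (qR H) (\<lambda>q1 q2.
    pure H A (x1 * y11 * a1 * f1 * S (q2 * y22) * y3) (\<iota> (x2 * y12 * a2 * f2 * S (x3 * q1 * y21))))))))))"
proof -
  have 1: "lin2 tscale (\<lambda>h b. pure H A (q11 * h * S q2) (act A q12 (\<iota> b)))" for q11 q12 q2
    by (simp only: act_A, intro lin_intros)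
  \<comment> \<open>The action of \<open>q12\<close> adds a factor on each side of the
    \<open>A\<close>-leg. Moving the iterated coproduct of \<open>q1\<close> past \<phi> brings
    \<open>q1\<close> and \<open>q2\<close> into the shape to which \<open>qR_pentagon\<close>
    applies.\<close>
  have nat: "\<Phi> (\<lambda>x1 x2 x3. \<Psi> (\<lambda>y1 y2 y3. \<DD> q1 (\<lambda>q11 q12. \<DD> q12 (\<lambda>q121 q122. \<DD> y1 (\<lambda>y11 y12. \<DD> a (\<lambda>a1 a2.
     sum2 H (f_inv H) (\<lambda>f1 f2.
      pure H A (q11 * (x1 * (y11 * (a1 * (f1 * (S y3 * S q2))))))
        (\<iota> (q121 * (x2 * (y12 * (a2 * (f2 * (S y2 * (S x3 * S q122))))))))))))))) =
    \<Psi> (\<lambda>y1 y2 y3. \<DD> q1 (\<lambda>q11 q12. \<Phi> (\<lambda>x1 x2 x3. \<DD> (q11 * y1) (\<lambda>y11 y12. \<DD> a (\<lambda>a1 a2.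
     sum2 H (f_inv H) (\<lambda>f1 f2.
      pure H A (x1 * (y11 * (a1 * (f1 * (S y3 * S q2)))))
        (\<iota> (x2 * (y12 * (a2 * (f2 * (S (q12 * y2) * S x3))))))))))))" for q1 q2
    by (rule via[OF reassoc_nat(1)[where h = q1 and s = tscale and F = "\<lambda>u v w. \<Psi> (\<lambda>y1 y2 y3. \<DD> y1 (\<lambda>y11 y12. \<DD> a (\<lambda>a1 a2.
     sum2 H (f_inv H) (\<lambda>f1 f2.
      pure H A (u * (y11 * (a1 * (f1 * (S y3 * S q2)))))
        (\<iota> (v * (y12 * (a2 * (f2 * (S y2 * S w))))))))))"]])
     (intro lin_intros | simp add: sweedler comult_mult_sum[where s = tscale] lin_intros)+
  have "coact_first H A (\<iota> a) = sum2 H (qR H) (\<lambda>q1 q2. \<DD> q1 (\<lambda>q11 q12. tlift H A (coact A (\<iota> a)) (\<lambda>g v0.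
    pure H A (q11 * g * S q2) (act A q12 v0))))"
    by (simp add: coact_first_def)
  also have "\<dots> = sum2 H (qR H) (\<lambda>q1 q2. \<Phi> (\<lambda>x1 x2 x3. \<Psi> (\<lambda>y1 y2 y3. \<DD> q1 (\<lambda>q11 q12. \<DD> q12 (\<lambda>q121 q122. \<DD> y1 (\<lambda>y11 y12. \<DD> a (\<lambda>a1 a2.
     sum2 H (f_inv H) (\<lambda>f1 f2.
      pure H A (q11 * (x1 * (y11 * (a1 * (f1 * (S y3 * S q2))))))
        (\<iota> (q121 * (x2 * (y12 * (a2 * (f2 * (S y2 * (S x3 * S q122))))))))))))))))"
    apply (subst tlift_coact_A[OF 1])
    apply (simp add: act_A sweedler pureA_sum)
    by (subst (4) sum_swap(1), subst (3) sum_swap(1), subst (2) sum_swap(1)) (rule refl)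
  also have "\<dots> = sum2 H (qR H) (\<lambda>q1 q2. \<Phi> (\<lambda>y1 y2 y3. \<DD> y2 (\<lambda>y21 y22. \<Phi> (\<lambda>x1 x2 x3. \<DD> y1 (\<lambda>y11 y12. \<DD> a (\<lambda>a1 a2.
     sum2 H (f_inv H) (\<lambda>f1 f2.
      pure H A (x1 * (y11 * (a1 * (f1 * (S y22 * (S q2 * y3))))))
        (\<iota> (x2 * (y12 * (a2 * (f2 * (S (q1 * y21) * S x3)))))))))))))"
    unfolding nat
    by (rule qR_pentagon[where s = tscale and G = "\<lambda>u v w. \<Phi> (\<lambda>x1 x2 x3. \<DD> u (\<lambda>y11 y12. \<DD> a (\<lambda>a1 a2.
     sum2 H (f_inv H) (\<lambda>f1 f2.
      pure H A (x1 * (y11 * (a1 * (f1 * w))))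
        (\<iota> (x2 * (y12 * (a2 * (f2 * (S v * S x3))))))))))"]) (intro lin_intros)
  finally show ?thesis
    apply (simp only: front sum_swap(1)[of "qR H"] mult.assoc antipode_mult)
    apply (subst sum_swap(3)) apply (subst sum_swap(1))
    by (rule refl)
qed

end

text \<open>The first leg of \<open>pR\<close> acts on the trivial module by its counit, and this
  counit reduces \<open>pR\<close> to \<beta>.\<close>

lemma A_one_eq: "A_one H = \<iota> \<beta>"
proof -
  have 1: "lin2 tscale (\<lambda>x1 x2. tscale (\<epsilon> x1) (\<iota> x2))"
    by (intro lin_intros)
  have "tlift H \<kappa> (\<iota> k) (\<lambda>g v. pure H \<kappa> (g * p) v) = \<iota> (k * p)" for k p
    by (rule tlift_iota[where s = tscale])
      (intro lin_intros | simp add: pure_unit scale_mult_left lin_scale[OF lin_iota[OF lin_id]])+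
  then have "tlift H \<kappa> (pure H \<kappa> 1 c) (\<lambda>g v. pure H \<kappa> (g * p) v) = tscale c (\<iota> p)" for c p
    by (simp only: pure_unit scale_mult_left) (simp add: lin_scale[OF lin_iota[OF lin_id]])
  then have "A_one H = sum2 H (pR H) (\<lambda>p1 p2. tscale (\<epsilon> p1) (\<iota> p2))"
    by (simp add: A_one_def R0_def adj_unit_def unit_yd_def hmod.defs ydmod.defs second_of_first_def)
  also have "\<dots> = \<Psi> (\<lambda>x1 x2 x3. tscale (\<epsilon> x1) (\<iota> (x2 * \<beta> * S x3)))"
    unfolding pR_def by (simp add: sum2_sum[OF 1] sum2_pure2[OF 1])
  also have "\<dots> = \<iota> (1 * \<beta> * S 1)"
    by (rule reassoc_inv_counit) (intro lin_intros)
  finally show ?thesis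
    by (simp add: antipode_one)
qed

section \<open>The adjoint action and the map J\<close>

definition ad :: "'h \<Rightarrow> 'h \<Rightarrow> 'h" where
  "ad h a = \<DD> h (\<lambda>h1 h2. h1 * (a * S h2))"

lemma act_A': "act A h (\<iota> a) = \<iota> (ad h a)"
  by (simp add: act_A ad_def mult.assoc)

lemma lin_ad [lin_intros]:
  "lin (scale H) f \<Longrightarrow> lin (scale H) (\<lambda>x. ad (f x) c)"
  "lin (scale H) f \<Longrightarrow> lin (scale H) (\<lambda>x. ad h (f x))"
  unfolding ad_def by (intro lin_intros; assumption)+

lemma mult_sum:
  fixes u :: 'h
  shows "u * sum2 H t2 F2 = sum2 H t2 (\<lambda>a b. u * F2 a b)" "sum2 H t2 F2 * u = sum2 H t2 (\<lambda>a b. F2 a b * u)"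
    "u * sum3 H t3 F3 = sum3 H t3 (\<lambda>a b c. u * F3 a b c)" "sum3 H t3 F3 * u = sum3 H t3 (\<lambda>a b c. F3 a b c * u)"
proof -
  show "u * sum2 H t2 F2 = sum2 H t2 (\<lambda>a b. u * F2 a b)" "u * sum3 H t3 F3 = sum3 H t3 (\<lambda>a b c. u * F3 a b c)"
    by (rule sum_hom[of "\<lambda>z. u * z"], simp add: algebra_simps)+
  show "sum2 H t2 F2 * u = sum2 H t2 (\<lambda>a b. F2 a b * u)" "sum3 H t3 F3 * u = sum3 H t3 (\<lambda>a b c. F3 a b c * u)"
    by (rule sum_hom[of "\<lambda>z. z * u"], simp add: algebra_simps)+
qed

lemma ad_ad: "ad h (ad k a) = ad (h * k) a"
proof -
  have 1: "lin2 (scale H) (\<lambda>h1 h2. h1 * (a * S h2))"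
    by (intro lin_intros)
  show ?thesis
    by (simp add: ad_def comult_mult_sum[OF 1] mult_sum antipode_mult mult.assoc)
qed

text \<open>The component \<open>R(k) \<otimes> H \<rightarrow> H\<close> of the half-braiding of \<open>R(k)\<close>, followed by the counit of the adjunction.\<close>

definition J :: "'h \<Rightarrow> 'h" where
  "J a = \<Phi> (\<lambda>x1 x2 x3. x1 * (a * (S x2 * (\<alpha> * x3))))"

lemma lin_J [lin_intros]: "lin (scale H) f \<Longrightarrow> lin (scale H) (\<lambda>x. J (f x))"
  unfolding J_def by (intro lin_intros; assumption)

text \<open>\<open>reassoc_nat\<close> carries \<open>h\<close> to the left of \<phi>, and the
  leftover coproduct halves collapse around the \<alpha> inside \<open>J\<close>.\<close>

lemma J_nat: "\<DD> h (\<lambda>h1 h2. J (ad h1 a) * h2) = h * J a"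
proof -
  have 1: "\<DD> u (\<lambda>u1 u2. h1 * (x1 * (a * (S x2 * (S u1 * (\<alpha> * (u2 * x3))))))) =
    scale H (\<epsilon> u) (h1 * (x1 * (a * (S x2 * (\<alpha> * x3)))))" for u h1 x1 x2 x3
    by (rule via[OF antipode_sum(1)[where h = u and s = "scale H" and f = "\<lambda>z. h1 * (x1 * (a * (S x2 * (z * x3))))"]])
      (intro lin_intros | simp add: sweedler)+
  have "\<DD> h (\<lambda>h1 h2. J (ad h1 a) * h2) = \<Phi> (\<lambda>x1 x2 x3. \<DD> h (\<lambda>h1 h2. \<DD> h2 (\<lambda>h21 h22.
    h1 * (x1 * (a * (S x2 * (S h21 * (\<alpha> * (h22 * x3)))))))))"
    by (rule via[OF reassoc_nat(1)[symmetric, where h = h and s = "scale H" and F = "\<lambda>b c d. b * (a * (S c * (\<alpha> * d)))"]])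
      (intro lin_intros | simp add: J_def ad_def sweedler mult_sum)+
  also have "\<dots> = \<Phi> (\<lambda>x1 x2 x3. \<DD> h (\<lambda>h1 h2. scale H (\<epsilon> h2) (h1 * (x1 * (a * (S x2 * (\<alpha> * x3)))))))"
    by (simp only: 1)
  also have "\<dots> = \<Phi> (\<lambda>x1 x2 x3. h * (x1 * (a * (S x2 * (\<alpha> * x3)))))"
    by (subst counit_sum(2)[where s = "scale H"]; (intro lin_intros)?) simp
  finally show ?thesis
    by (simp add: J_def mult_sum)
qed

text \<open>The element \<open>pR\<close> recovers \<open>b\<close> from \<open>J\<close>: this is
  the passage from the first to the second kind of coaction, seen after the counit. One reassociator
  collapses around \<alpha>, one around \<beta>, and a zigzag remains.\<close>

lemma J_beta: "\<Psi> (\<lambda>z1 z2 z3. J (ad z1 b) * (z2 * (\<beta> * S z3))) = b" (is "?L = _")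
proof -
  have "?L =
    \<Psi> (\<lambda>y1 y2 y3. \<DD> y2 (\<lambda>y21 y22. \<Phi> (\<lambda>x1 x2 x3. \<DD> x3 (\<lambda>x31 x32. \<Psi> (\<lambda>z1 z2 z3.
    y1 * (x1 * (b * (S x2 * (S z1 * (S y21 * (\<alpha> * (y22 * (z2 * (x31 * (\<beta> * (S x32 * (S z3 * S y3)))))))))))))))))"
    by (rule via[OF pentagon_sum(3)[where s = "scale H" and F = "\<lambda>a' b' c d. a' * (b * (S b' * (\<alpha> * (c * (\<beta> * S d)))))"]])
      (intro lin_intros | simp add: J_def ad_def sweedler mult_sum)+
  also have "\<dots> = \<Phi> (\<lambda>x1 x2 x3. \<DD> x3 (\<lambda>x31 x32. \<Psi> (\<lambda>z1 z2 z3.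
    x1 * (b * (S x2 * (S z1 * (\<alpha> * (z2 * (x31 * (\<beta> * (S x32 * S z3)))))))))))"
    by (rule via[OF reassoc_alpha(3)[where s = "scale H" and K = "\<lambda>a m c. \<Phi> (\<lambda>x1 x2 x3. \<DD> x3 (\<lambda>x31 x32. \<Psi> (\<lambda>z1 z2 z3.
    a * (x1 * (b * (S x2 * (S z1 * (m * (z2 * (x31 * (\<beta> * (S x32 * (S z3 * S c)))))))))))))"]])
      (intro lin_intros | simp add: sweedler antipode_one)+
  also have "\<dots> = \<Psi> (\<lambda>x1 x2 x3. b * (S x1 * (\<alpha> * (x2 * (\<beta> * S x3)))))"
    by (rule via[OF reassoc_beta(2)[where s = "scale H" and K = "\<lambda>a c m. \<Psi> (\<lambda>z1 z2 z3.
    a * (b * (S c * (S z1 * (\<alpha> * (z2 * (m * S z3)))))))"]])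
      (intro lin_intros | simp add: sweedler antipode_one)+
  also have "\<dots> = b * 1"
    by (rule zigzag_sum(2)[where s = "scale H" and f = "\<lambda>z. b * z"]) (intro lin_intros)
  finally show ?thesis by simp
qed

text \<open>The left side is the product as delivered by the tensor coaction under the counits. The
  pentagon separates the two occurrences of \<open>J\<close>; \<open>J_nat\<close> and
  \<open>J_beta\<close> eliminate the one applied to \<open>b\<close>, and only the one applied to
  \<open>a\<close> is unfolded.\<close>

lemma J_mult: "sum2 H (pR H) (\<lambda>p1 p2. \<DD> p1 (\<lambda>h1 h2. \<Phi> (\<lambda>z1 z2 z3.
    J (ad (z1 * h1) a) * (J (ad (z2 * h2) b) * (z3 * p2))))) =
  \<Phi> (\<lambda>x1 x2 x3. \<Psi> (\<lambda>y1 y2 y3. \<DD> x3 (\<lambda>x31 x32.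
    x1 * a * S (y1 * x2) * \<alpha> * y2 * x31 * b * S (y3 * x32))))" (is "?L = _")
proof -
  have 1: "lin2 (scale H) (\<lambda>p1 p2. \<DD> p1 (\<lambda>h1 h2. \<Phi> (\<lambda>z1 z2 z3.
    J (ad (z1 * h1) a) * (J (ad (z2 * h2) b) * (z3 * p2)))))"
    by (intro lin_intros)
  \<comment> \<open>Naturality of \<open>J\<close> moves the coproduct of \<open>u\<close> to its
    left, which leaves exactly the sum contracted by \<open>J_beta\<close> in the next fact.\<close>
  have 2: "\<DD> u (\<lambda>u1 u2. J y1 * (J (ad (u1 * z1) b) * (u2 * (z2 * (\<beta> * (S z3 * S y3)))))) =
    J y1 * (u * (J (ad z1 b) * (z2 * (\<beta> * (S z3 * S y3)))))" for u y1 y3 z1 z2 z3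
  proof -
    have "\<DD> u (\<lambda>u1 u2. J (ad u1 (ad z1 b)) * u2) * v = u * (J (ad z1 b) * v)" for v
      unfolding J_nat mult.assoc ..
    then show ?thesis
      unfolding ad_ad mult_sum(2) mult_sum(1)[symmetric] mult.assoc by presburger
  qed
  have 3: "\<Psi> (\<lambda>z1 z2 z3. J y1 * (y2 * (J (ad z1 b) * (z2 * (\<beta> * (S z3 * S y3)))))) =
    J y1 * (y2 * (b * S y3))" for y1 y2 y3
    using arg_cong[OF J_beta[of b], of "\<lambda>t. J y1 * (y2 * (t * S y3))"]
    by (simp only: mult_sum(3,4) mult.assoc)
  have "?L =
    \<Phi> (\<lambda>x1 x2 x3. \<Psi> (\<lambda>y1 y2 y3. \<DD> y1 (\<lambda>y11 y12.
    J (ad (x1 * y11) a) * (J (ad (x2 * y12) b) * (x3 * (y2 * (\<beta> * S y3)))))))"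
    unfolding pR_def
    apply (subst sum2_sum[OF 1], simp)
    apply (subst sum2_pure2[OF 1])
    by (simp only: front mult.assoc)
  also have "\<dots> = \<Phi> (\<lambda>x1 x2 x3. \<DD> x3 (\<lambda>x31 x32. \<Psi> (\<lambda>y1 y2 y3. \<Psi> (\<lambda>z1 z2 z3. \<DD> y2 (\<lambda>y21 y22.
    J (ad (y1 * x1) a) * (J (ad (y21 * (z1 * x2)) b) * (y22 * (z2 * (x31 * (\<beta> * (S x32 * (S z3 * S y3))))))))))))"
    apply (rule via[OF pentagon_sum(3)[where s = "scale H" and F = "\<lambda>a' b' c d. J (ad a' a) * (J (ad b' b) * (c * (\<beta> * S d)))"]])
      apply (intro lin_intros)
     apply (simp only: sweedler)
    apply (simp only: sweedler)
    apply (subst sum_swap(1), rule refl)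
    done
  also have "\<dots> = \<Psi> (\<lambda>y1 y2 y3. \<Psi> (\<lambda>z1 z2 z3. \<DD> y2 (\<lambda>y21 y22.
    J (ad y1 a) * (J (ad (y21 * z1) b) * (y22 * (z2 * (\<beta> * (S z3 * S y3))))))))"
    by (rule via[OF reassoc_beta(2)[where s = "scale H" and K = "\<lambda>u v m. \<Psi> (\<lambda>y1 y2 y3. \<Psi> (\<lambda>z1 z2 z3. \<DD> y2 (\<lambda>y21 y22.
    J (ad (y1 * u) a) * (J (ad (y21 * (z1 * v)) b) * (y22 * (z2 * (m * (S z3 * S y3))))))))"]])
      (intro lin_intros | simp add: mult.assoc)+
  also have "\<dots> = \<Psi> (\<lambda>y1 y2 y3. J (ad y1 a) * (y2 * (b * S y3)))"
    by (simp only: 2 3)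
  \<comment> \<open>Unfolding the remaining \<open>J\<close> and its adjoint action gives the left
    side of the pentagon form used earlier in this proof, now with \<open>b\<close> in the place of
    \<beta>. The split leg \<open>y2\<close> surrounds \<alpha> and collapses next.\<close>
  also have "\<dots> = \<Psi> (\<lambda>y1 y2 y3. \<DD> y2 (\<lambda>y21 y22. \<Phi> (\<lambda>x1 x2 x3. \<Psi> (\<lambda>z1 z2 z3. \<DD> x3 (\<lambda>x31 x32.
    y1 * (x1 * (a * (S x2 * (S z1 * (S y21 * (\<alpha> * (y22 * (z2 * (x31 * (b * (S x32 * (S z3 * S y3)))))))))))))))))"
    by (rule via[OF pentagon_sum(3)[where s = "scale H" and F = "\<lambda>a' b' c d. a' * (a * (S b' * (\<alpha> * (c * (b * S d)))))"]])
      (intro lin_intros | simp add: J_def ad_def sweedler mult_sum)+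
  also have "\<dots> = \<Phi> (\<lambda>x1 x2 x3. \<Psi> (\<lambda>z1 z2 z3. \<DD> x3 (\<lambda>x31 x32.
    x1 * (a * (S x2 * (S z1 * (\<alpha> * (z2 * (x31 * (b * (S x32 * S z3)))))))))))"
    by (rule via[OF reassoc_alpha(3)[where s = "scale H" and K = "\<lambda>u m v. \<Phi> (\<lambda>x1 x2 x3. \<Psi> (\<lambda>z1 z2 z3. \<DD> x3 (\<lambda>x31 x32.
    u * (x1 * (a * (S x2 * (S z1 * (m * (z2 * (x31 * (b * (S x32 * (S z3 * S v)))))))))))))"]])
      (intro lin_intros | simp add: sweedler antipode_one)+
  finally show ?thesis
    by (simp add: mult.assoc antipode_mult)
qed

section \<open>Coactions in continuation form\<close>

definition coact_sum :: "'h \<Rightarrow> ('h \<Rightarrow> 'h \<Rightarrow> 'u::ab_group_add) \<Rightarrow> 'u" where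
  "coact_sum a G = \<Phi> (\<lambda>x1 x2 x3. \<Psi> (\<lambda>y1 y2 y3. \<DD> y1 (\<lambda>y11 y12. \<DD> a (\<lambda>a1 a2. sum2 H (f_inv H) (\<lambda>f1 f2.
    G (x1 * y11 * a1 * f1 * S y3) (x2 * y12 * a2 * f2 * S (x3 * y2)))))))"

text \<open>Like \<open>coact_sum\<close>, a coaction whose two legs are read in \<open>H\<close>
  and handed to an arbitrary continuation. Nested coactions can then be followed by counits without
  forming tensors over \<open>A\<close>.\<close>

definition coact_first_sum :: "'h \<Rightarrow> ('h \<Rightarrow> 'h \<Rightarrow> 'u::ab_group_add) \<Rightarrow> 'u" where
  "coact_first_sum a G = sum2 H (qR H) (\<lambda>q1 q2. \<DD> q1 (\<lambda>q11 q12.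
    coact_sum a (\<lambda>g c. G (q11 * g * S q2) (ad q12 c))))"

lemma lin_coact_sum [lin_intros]:
  "lin (scale H) f \<Longrightarrow> lin2 s G \<Longrightarrow> lin s (\<lambda>x. coact_sum (f x) G)"
  "vector_space s \<Longrightarrow> (\<And>g c. lin s (\<lambda>x. F x g c)) \<Longrightarrow> lin s (\<lambda>x. coact_sum a (F x))"
proof -
  assume G: "lin2 s G" and f: "lin (scale H) f"
  show "lin s (\<lambda>x. coact_sum (f x) G)"
    unfolding coact_sum_def by (intro lin_intros lin2D[OF G] f)
next
  assume s: "vector_space s" and F: "\<And>g c. lin s (\<lambda>x. F x g c)"
  show "lin s (\<lambda>x. coact_sum a (F x))"
    unfolding coact_sum_def by (intro lin_sum s F)
qed

lemma lin_coact_first_sum [lin_intros]: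
  "lin (scale H) f \<Longrightarrow> lin2 s G \<Longrightarrow> lin s (\<lambda>x. coact_first_sum (f x) G)"
  "vector_space s \<Longrightarrow> (\<And>g c. lin s (\<lambda>x. F x g c)) \<Longrightarrow> lin s (\<lambda>x. coact_first_sum a (F x))"
proof -
  assume G: "lin2 s G" and f: "lin (scale H) f"
  show "lin s (\<lambda>x. coact_first_sum (f x) G)"
    unfolding coact_first_sum_def by (intro lin_intros lin2D[OF G] f)
next
  assume s: "vector_space s" and F: "\<And>g c. lin s (\<lambda>x. F x g c)"
  show "lin s (\<lambda>x. coact_first_sum a (F x))"
    unfolding coact_first_sum_def by (intro lin_sum lin_coact_sum(2) s F)
qed

text \<open>The triangle identity for the adjunction at the trivial module. The counit meets every
  factor of the second leg; for the inverse of \<open>f_elem\<close> this uses the normalisation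
  \<open>f_inv_counit\<close>.\<close>

lemma coact_sum_counit:
  assumes M: "lin s M" and vs: "vector_space s"
  shows "coact_sum a (\<lambda>g c. s (\<epsilon> c) (M g)) = M a" (is "?L = _")
proof -
  note [lin_intros] = linD[OF M] vs
  note simps = sweedler vs_simps[OF vs] counit_antipode
  have "?L =
    \<Phi> (\<lambda>x1 x2 x3. s (\<epsilon> x3) (s (\<epsilon> x2) (\<Psi> (\<lambda>y1 y2 y3. s (\<epsilon> y2) (\<DD> y1 (\<lambda>y11 y12. s (\<epsilon> y12)
      (\<DD> a (\<lambda>a1 a2. s (\<epsilon> a2) (sum2 H (f_inv H) (\<lambda>f1 f2. s (\<epsilon> f2) (M (x1 * (y11 * (a1 * (f1 * S y3)))))))))))))))"
    by (simp add: coact_sum_def simps)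
  also have "\<dots> = \<Phi> (\<lambda>x1 x2 x3. s (\<epsilon> x3) (s (\<epsilon> x2) (\<Psi> (\<lambda>y1 y2 y3. s (\<epsilon> y2) (\<DD> y1 (\<lambda>y11 y12. s (\<epsilon> y12)
      (\<DD> a (\<lambda>a1 a2. s (\<epsilon> a2) (M (x1 * (y11 * (a1 * (1 * S y3)))))))))))))"
    by (subst f_inv_counit[where s = s]; (intro lin_intros)?) simp
  also have "\<dots> = \<Phi> (\<lambda>x1 x2 x3. s (\<epsilon> x3) (s (\<epsilon> x2) (\<Psi> (\<lambda>y1 y2 y3. s (\<epsilon> y2) (\<DD> y1 (\<lambda>y11 y12. s (\<epsilon> y12)
      (M (x1 * (y11 * (a * (1 * S y3)))))))))))"
    by (subst counit_sum(2)[where s = s and h = a]; (intro lin_intros)?) simp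
  also have "\<dots> = \<Phi> (\<lambda>x1 x2 x3. s (\<epsilon> x3) (s (\<epsilon> x2) (\<Psi> (\<lambda>y1 y2 y3. s (\<epsilon> y2) (M (x1 * (y1 * (a * (1 * S y3)))))))))"
    by (subst counit_sum(2)[where s = s]; (intro lin_intros)?) simp
  also have "\<dots> = \<Phi> (\<lambda>x1 x2 x3. s (\<epsilon> x3) (s (\<epsilon> x2) (M (x1 * (1 * (a * (1 * S 1)))))))"
    by (subst reassoc_inv_counit(2)[where s = s]; (intro lin_intros)?) simp
  also have "\<dots> = s (\<epsilon> 1) (M (1 * (1 * (a * (1 * S 1)))))"
    by (subst reassoc_counit3[where s = s]; (intro lin_intros)?) simp
  finally show ?thesis
    by (simp add: counit_one antipode_one vs_simps[OF vs])
qed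

lemma counit_ad: "\<epsilon> (ad h c) = \<epsilon> h * \<epsilon> c"
proof -
  have "\<epsilon> (ad h c) = \<DD> h (\<lambda>h1 h2. \<epsilon> h2 * (\<epsilon> h1 * \<epsilon> c))"
    unfolding ad_def lin_hom[OF lin_eps[OF lin_id]] by (simp add: counit_mult counit_antipode mult_ac)
  also have "\<dots> = \<epsilon> h * \<epsilon> c"
    by (rule counit_sum(2)[where s = "(*)" and f = "\<lambda>x. \<epsilon> x * \<epsilon> c"]) (intro lin_intros)
  finally show ?thesis .
qed

lemma tlift_coact_A':
  assumes "lin2 s (\<lambda>h a. F h (\<iota> a))"
  shows "tlift H A (coact A (\<iota> a)) F = coact_sum a (\<lambda>g c. F g (\<iota> c))"
  by (simp only: tlift_coact_A[OF assms] coact_sum_def)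

lemma tlift_coact_sum:
  assumes "vector_space s" "bilinear_on V W s F" "\<And>g c. G g c \<in> carrier (tensor_space V W)"
  shows "tlift V W (coact_sum a G) F = coact_sum a (\<lambda>g c. tlift V W (G g c) F)"
    "tlift V W (coact_first_sum a G) F = coact_first_sum a (\<lambda>g c. tlift V W (G g c) F)"
  using assms(3) unfolding coact_sum_def coact_first_sum_def
  by (simp_all add: tlift_sum[OF assms(1,2)])

lemma coact_sum_closed [simp]:
  assumes "\<And>g c. G g c \<in> carrier (tensor_space V W)"
  shows "coact_sum a G \<in> carrier (tensor_space V W)" "coact_first_sum a G \<in> carrier (tensor_space V W)"
  using assms unfolding coact_sum_def coact_first_sum_def by simp_all

lemma coact_first_A_sum: "coact_first H A (\<iota> a) = coact_first_sum a (\<lambda>g c. pure H A g (\<iota> c))"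
proof -
  have 1: "lin2 tscale (\<lambda>h b. pure H A (q11 * h * S q2) (act A q12 (\<iota> b)))" for q11 q12 q2
    by (simp only: act_A', intro lin_intros)
  show ?thesis
    by (simp add: coact_first_def coact_first_sum_def tlift_coact_A'[OF 1] act_A')
qed

lemma tlift_coact_first_A:
  assumes "lin2 s (\<lambda>h a. F h (\<iota> a))"
  shows "tlift H A (coact_first H A (\<iota> a)) F = coact_first_sum a (\<lambda>g c. F g (\<iota> c))"
  by (simp add: coact_first_A_sum tlift_coact_sum[OF lin2_vs[OF assms] bilinear_iota[OF lin2_vs[OF assms] refl assms]]
      tlift_A[OF assms])

section \<open>The tensor square of A\<close>

abbreviation "T \<equiv> tensor_hmod H A A"

lemma T_simps [simp]: "carrier T = carrier (tensor_space A A)" "scale T = tscale"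
  by (simp_all add: tensor_hmod_def)

lemma pure_T: "pure H (tensor_space A A) = pure H T"
  by (rule pure_space_cong) (simp_all add: tensor_space_def)

lemma lin_pureT [lin_intros]:
  assumes f: "lin (scale H) f"
  shows "lin tscale (\<lambda>x. pure A A (\<iota> (f x)) (\<iota> b))" "lin tscale (\<lambda>x. pure A A (\<iota> a) (\<iota> (f x)))"
    "lin tscale (\<lambda>x. pure H T (f x) (pure A A (\<iota> a) (\<iota> b)))"
    "lin tscale (\<lambda>x. pure H T u (pure A A (\<iota> (f x)) (\<iota> b)))"
    "lin tscale (\<lambda>x. pure H T u (pure A A (\<iota> a) (\<iota> (f x))))"
proof -
  have i: "\<iota> (f (a + b)) = \<iota> (f a) + \<iota> (f b)" "\<iota> (f (scale H k a)) = tscale k (\<iota> (f a))" for a b k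
    using lin_iota[OF f] by (simp_all add: lin_def)
  show 1: "lin tscale (\<lambda>x. pure A A (\<iota> (f x)) (\<iota> b))"
    using pure_add_left[of _ A _ _ A] pure_scale_left[of _ A _ A] by (simp add: lin_def i)
  show 2: "lin tscale (\<lambda>x. pure A A (\<iota> a) (\<iota> (f x)))"
    using pure_add_right[of _ A _ A] pure_scale_right[of _ A _ A] by (simp add: lin_def i)
  show "lin tscale (\<lambda>x. pure H T (f x) (pure A A (\<iota> a) (\<iota> b)))"
    using f by (rule lin_pure1) simp
  show "lin tscale (\<lambda>x. pure H T u (pure A A (\<iota> (f x)) (\<iota> b)))"
    "lin tscale (\<lambda>x. pure H T u (pure A A (\<iota> a) (\<iota> (f x))))"
    using 1 2 by (auto intro!: lin_pure2)
qed

lemma bilinear_AA: "lin2 s (\<lambda>a b. F (\<iota> a) (\<iota> b)) \<Longrightarrow> bilinear_on A A s F"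
  by (rule bilinear_iota2) simp_all

lemma tlift_AA:
  assumes "lin2 s (\<lambda>a b. F (\<iota> a) (\<iota> b))"
  shows "tlift A A (pure A A (\<iota> a) (\<iota> b)) F = F (\<iota> a) (\<iota> b)"
  by (rule tlift_pure[OF lin2_vs[OF assms] bilinear_AA[OF assms]]) simp_all

lemma act_T: "act T h (pure A A (\<iota> a) (\<iota> b)) = \<DD> h (\<lambda>h1 h2. pure A A (\<iota> (ad h1 a)) (\<iota> (ad h2 b)))"
proof -
  have 1: "lin2 tscale (\<lambda>a b. \<DD> h (\<lambda>h1 h2. pure A A (act A h1 (\<iota> a)) (act A h2 (\<iota> b))))"
    unfolding act_A' by (intro lin_intros)
  show ?thesis
    by (simp add: tensor_hmod_def tlift_AA[OF 1]) (simp add: act_A')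
qed

definition tensor_coact_sum :: "'h \<Rightarrow> 'h \<Rightarrow> ('h \<Rightarrow> 'h \<Rightarrow> 'h \<Rightarrow> 'u::ab_group_add) \<Rightarrow> 'u" where
  "tensor_coact_sum a b G = \<Phi> (\<lambda>x1 x2 x3. \<Psi> (\<lambda>y1 y2 y3. \<Phi> (\<lambda>z1 z2 z3.
     coact_first_sum (ad (y1 * z1) a) (\<lambda>g c. coact_first_sum (ad z2 b) (\<lambda>g' d.
       G (x1 * g * y2 * g' * z3) (ad x2 c) (ad (x3 * y3) d))))))"

lemma lin2_tensor_coact_sum:
  assumes "lin3 s G" shows "lin2 s (\<lambda>a b. tensor_coact_sum a b G)"
  unfolding tensor_coact_sum_def by (intro lin_intros lin3D[OF assms])

text \<open>Stated for Sweedler sums of pure tensors because the coaction of the second kind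
  evaluates it after \<open>p1\<close> has acted diagonally.\<close>

lemma tensor_coact_first_A:
  "tensor_coact_first H A A (sum2 H t (\<lambda>h1 h2. pure A A (\<iota> (F1 h1 h2)) (\<iota> (F2 h1 h2)))) =
   sum2 H t (\<lambda>h1 h2. tensor_coact_sum (F1 h1 h2) (F2 h1 h2) (\<lambda>u c d. pure H T u (pure A A (\<iota> c) (\<iota> d))))"
proof -
  let ?D = "\<lambda>v w. \<Phi> (\<lambda>x1 x2 x3. \<Psi> (\<lambda>y1 y2 y3. \<Phi> (\<lambda>z1 z2 z3.
       tlift H A (coact_first H A (act A (y1 * z1) v)) (\<lambda>g v0.
       tlift H A (coact_first H A (act A z2 w)) (\<lambda>g' w0.
         pure H (tensor_space A A) (x1 * g * y2 * g' * z3)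
           (pure A A (act A x2 v0) (act A (x3 * y3) w0)))))))"
  have 1: "lin2 tscale (\<lambda>g' d. pure H T (x1 * g * y2 * g' * z3) (pure A A (act A x2 (\<iota> c)) (act A h (\<iota> d))))"
    for x1 g y2 z3 x2 c h
    unfolding act_A' by (intro lin_intros)
  have 2: "lin2 tscale (\<lambda>g c. tlift H A (coact_first H A (\<iota> b)) (\<lambda>g' w0.
       pure H T (x1 * g * y2 * g' * z3) (pure A A (act A x2 (\<iota> c)) (act A h w0))))" for x1 y2 z3 x2 h b
    unfolding tlift_coact_first_A[OF 1] unfolding act_A' by (intro lin_intros)
  have D: "?D (\<iota> a) (\<iota> b) = tensor_coact_sum a b (\<lambda>u c d. pure H T u (pure A A (\<iota> c) (\<iota> d)))" for a b
    unfolding pure_T act_A'[of _ a] act_A'[of _ b] tlift_coact_first_A[OF 2] tlift_coact_first_A[OF 1]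
    unfolding act_A' tensor_coact_sum_def ..
  have 3: "lin2 tscale (\<lambda>a b. ?D (\<iota> a) (\<iota> b))"
    unfolding D by (intro lin2_tensor_coact_sum lin_intros)
  have "tensor_coact_first H A A (sum2 H t (\<lambda>h1 h2. pure A A (\<iota> (F1 h1 h2)) (\<iota> (F2 h1 h2)))) =
    sum2 H t (\<lambda>h1 h2. ?D (\<iota> (F1 h1 h2)) (\<iota> (F2 h1 h2)))"
    unfolding tensor_coact_first_def
    by (subst tlift_sum[OF tscale_vector_space bilinear_AA[OF 3]]) (simp_all only: tlift_AA[OF 3], simp)
  then show ?thesis
    unfolding D .
qed

section \<open>Counits on the tensor square and the product\<close>

abbreviation "\<epsilon>\<^sub>A \<equiv> adj_counit H \<kappa>"
abbreviation "N \<equiv> tensor_hmod H \<kappa> \<kappa>"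

lemma N_simps [simp]: "carrier N = carrier (tensor_space \<kappa> \<kappa>)" "scale N = tscale"
  by (simp_all add: tensor_hmod_def)

lemma counit_iota: "\<epsilon>\<^sub>A (\<iota> c) = \<epsilon> c"
  unfolding adj_counit_def
  by (rule tlift_iota[where s = "(*)"]) (intro lin_intros | simp)+

text \<open>The counit of the adjunction on both factors, already composed with the identification
  of \<open>k \<otimes> k\<close> with \<open>k\<close>.\<close>

definition counit_AA :: "('k, ('k, 'h, 'k) tensor, ('k, 'h, 'k) tensor) tensor \<Rightarrow> 'k" where
  "counit_AA w = tlift A A w (\<lambda>v v'. \<epsilon>\<^sub>A v * \<epsilon>\<^sub>A v')"

definition counit_T where
  "counit_T h w = pure H \<kappa> h (counit_AA w)"

lemma bilinear_counit_AA: "bilinear_on A A (*) (\<lambda>v v'. \<epsilon>\<^sub>A v * \<epsilon>\<^sub>A v')"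
  by (rule bilinear_AA) (unfold counit_iota, intro lin_intros)

lemma counit_AA_pure: "counit_AA (pure A A (\<iota> c) (\<iota> d)) = \<epsilon> c * \<epsilon> d"
  unfolding counit_AA_def
  by (subst tlift_AA[where s = "(*)"]) (unfold counit_iota, intro lin_intros, rule refl)

lemma tscale_A: "v \<in> carrier A \<Longrightarrow> scale A c v \<in> carrier A"
  by (simp add: tscale_in_tensor_space)

lemma bilinear_counit_T:
  assumes "lin (scale H) f"
  shows "bilinear_on H T tscale (\<lambda>h w. counit_T (f h) w)"
proof -
  have i: "\<iota> (x + y) = \<iota> x + \<iota> y" "\<iota> (scale H k x) = tscale k (\<iota> x)" for x y k
    using lin_iota[OF lin_id] by (simp_all add: lin_def)
  have w: "counit_AA (w + w') = counit_AA w + counit_AA w'" if "w \<in> carrier T" "w' \<in> carrier T" for w w'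
    using that unfolding counit_AA_def by (intro tlift_add[OF vs_field bilinear_counit_AA]) simp_all
  have c: "counit_AA (tscale k w) = k * counit_AA w" if "w \<in> carrier T" for k w
    using that unfolding counit_AA_def by (intro tlift_scale[OF vs_field bilinear_counit_AA _ tscale_A]) simp_all
  show ?thesis
    using assms unfolding bilinear_on_def counit_T_def pure_unit
    by (simp add: w[simplified] c[simplified] lin_def i scale_add scale_add_left mult.commute flip: i(2))
qed

text \<open>Fuses \<open>R\<close> of the two counits with \<open>R\<close> of the multiplication of
  \<open>k\<close> into one induced map. The product is computed by pushing this map through the
  tensor coaction.\<close>

lemma R_map_counit:
  assumes x: "x \<in> carrier (tensor_space H T)"
  shows "R_map H N \<kappa> (\<lambda>t. tlift \<kappa> \<kappa> t (*)) (R_map H T N (tmap A A \<kappa> \<kappa> \<epsilon>\<^sub>A \<epsilon>\<^sub>A) x) = tlift H T x counit_T"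
proof -
  let ?m = "\<lambda>t. tlift \<kappa> \<kappa> t (*)"
  let ?e = "tmap A A \<kappa> \<kappa> \<epsilon>\<^sub>A \<epsilon>\<^sub>A"
  have m: "bilinear_on \<kappa> \<kappa> (*) ((*) :: 'k \<Rightarrow> 'k \<Rightarrow> 'k)"
    by (simp add: bilinear_on_def algebra_simps)
  have e_closed: "?e w \<in> carrier N" if "w \<in> carrier T" for w
    using that unfolding tmap_def N_simps by (intro tlift_closed) simp_all
  have me: "?m (?e w) = counit_AA w" if "w \<in> carrier T" for w
    using that unfolding tmap_def counit_AA_def
    by (subst tlift_tlift[OF vs_field m]) (simp_all add: tlift_pure[OF vs_field m])
  have i: "\<iota> (x + y) = \<iota> x + \<iota> y" "\<iota> (scale H k x) = tscale k (\<iota> x)" for x y k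
    using lin_iota[OF lin_id] by (simp_all add: lin_def)
  have b: "bilinear_on H N tscale (\<lambda>v w. pure H \<kappa> v (?m w))"
    unfolding bilinear_on_def pure_unit
    by (simp add: tlift_add[OF vs_field m] tlift_scale[OF vs_field m] i scale_add scale_add_left mult.commute flip: i(2))
  have "R_map H N \<kappa> ?m (R_map H T N ?e x) =
    tlift H N (tlift H T x (\<lambda>v w. pure H N v (?e w))) (\<lambda>v w. pure H \<kappa> v (?m w))"
    by (simp add: R_map_def tmap_def[of H])
  also have "\<dots> = tlift H T x (\<lambda>v w. tlift H N (pure H N v (?e w)) (\<lambda>v w. pure H \<kappa> v (?m w)))"
    using x e_closed by (intro tlift_tlift[OF tscale_vector_space b]) (auto intro!: pure_in_tensor_space)
  also have "\<dots> = tlift H T x counit_T"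
    using x e_closed by (intro tlift_cong) (simp_all add: tlift_pure[OF tscale_vector_space b] counit_T_def me)
  finally show ?thesis .
qed

lemma tlift_tensor_coact_sum:
  assumes "vector_space s" "bilinear_on V W s F" "\<And>u c d. G u c d \<in> carrier (tensor_space V W)"
  shows "tlift V W (tensor_coact_sum a b G) F = tensor_coact_sum a b (\<lambda>u c d. tlift V W (G u c d) F)"
  using assms(3) unfolding tensor_coact_sum_def
  by (simp add: tlift_sum[OF assms(1,2)] tlift_coact_sum[OF assms(1,2)])

lemma tensor_coact_sum_closed [simp]:
  assumes "\<And>u c d. G u c d \<in> carrier (tensor_space V W)"
  shows "tensor_coact_sum a b G \<in> carrier (tensor_space V W)"
  using assms unfolding tensor_coact_sum_def by simp

context
  assumes bij: "bij S"
begin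

text \<open>This is where \<open>J\<close> comes from. The counit undoes the second-kind coaction by
  \<open>coact_sum_counit\<close>, so only \<open>q1 * a * S q2\<close> survives, and
  \<open>S q2\<close> equals \<open>S x2 * \<alpha> * x3\<close>.\<close>

lemma coact_first_sum_counit:
  assumes M: "lin s M" and vs: "vector_space s"
  shows "coact_first_sum a (\<lambda>g c. s (\<epsilon> c) (M g)) = M (J a)" (is "?L = _")
proof -
  note [lin_intros] = linD[OF M] vs
  have "?L = sum2 H (qR H) (\<lambda>q1 q2. \<DD> q1 (\<lambda>q11 q12. s (\<epsilon> q12) (M (q11 * a * S q2))))"
  proof -
    have "coact_sum a (\<lambda>g c. s (\<epsilon> c) (s (\<epsilon> q12) (M (q11 * g * S q2)))) = s (\<epsilon> q12) (M (q11 * a * S q2))" for q11 q12 q2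
      by (rule coact_sum_counit) (intro lin_intros)+
    then show ?thesis
      by (simp add: coact_first_sum_def counit_ad vs_simps[OF vs] mult.commute)
  qed
  also have "\<dots> = sum2 H (qR H) (\<lambda>q1 q2. M (q1 * a * S q2))"
    by (subst counit_sum(2)[where s = s]; (intro lin_intros)?) simp
  also have "\<dots> = \<Phi> (\<lambda>x1 x2 x3. M (x1 * (a * (S x2 * (\<alpha> * x3)))))"
    by (subst sum_qR[OF bij, where s = s]; (intro lin_intros)?) (simp add: sweedler antipode_inv[OF bij])
  finally show ?thesis
    by (simp add: J_def lin_hom[OF M])
qed

text \<open>Each nested coaction becomes one \<open>J\<close>. Two of the three reassociators in the
  tensor coaction carry counits and disappear, and only the one acting before the coactions
  remains.\<close>

lemma tensor_coact_sum_counit: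
  "tensor_coact_sum a b (\<lambda>u c d. tscale (\<epsilon> c * \<epsilon> d) (\<iota> (u * p))) =
    \<Phi> (\<lambda>z1 z2 z3. \<iota> (J (ad z1 a) * (J (ad z2 b) * (z3 * p))))"
proof -
  note vs = tscale_vector_space
  \<comment> \<open>The coaction of the second factor is the inner one, so its counit is evaluated
    first; counits of other legs are carried along as scalars.\<close>
  have 1: "coact_first_sum b (\<lambda>g' d. tscale (k * (\<epsilon> h * \<epsilon> d)) (\<iota> (x1 * g * y2 * g' * z3 * p))) =
    tscale (k * \<epsilon> h) (\<iota> (x1 * g * y2 * J b * z3 * p))" for b k h x1 g y2 z3
  proof -
    have "coact_first_sum b (\<lambda>g' d. tscale (\<epsilon> d) (tscale (k * \<epsilon> h) (\<iota> (x1 * g * y2 * g' * z3 * p)))) =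
      tscale (k * \<epsilon> h) (\<iota> (x1 * g * y2 * J b * z3 * p))"
      by (rule coact_first_sum_counit) (intro lin_intros)+
    then show ?thesis
      by (simp add: vs_simps[OF vs] mult_ac)
  qed
  have 2: "coact_first_sum a (\<lambda>g c. tscale (\<epsilon> x2 * \<epsilon> c * \<epsilon> h) (\<iota> (x1 * g * y2 * J b * z3 * p))) =
    tscale (\<epsilon> x2 * \<epsilon> h) (\<iota> (x1 * J a * y2 * J b * z3 * p))" for a b x1 x2 y2 z3 h
  proof -
    have "coact_first_sum a (\<lambda>g c. tscale (\<epsilon> c) (tscale (\<epsilon> x2 * \<epsilon> h) (\<iota> (x1 * g * y2 * J b * z3 * p)))) =
      tscale (\<epsilon> x2 * \<epsilon> h) (\<iota> (x1 * J a * y2 * J b * z3 * p))"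
      by (rule coact_first_sum_counit) (intro lin_intros)+
    then show ?thesis
      by (simp add: vs_simps[OF vs] mult_ac)
  qed
  have "tensor_coact_sum a b (\<lambda>u c d. tscale (\<epsilon> c * \<epsilon> d) (\<iota> (u * p))) =
    \<Phi> (\<lambda>x1 x2 x3. tscale (\<epsilon> x3) (tscale (\<epsilon> x2) (\<Psi> (\<lambda>y1 y2 y3. tscale (\<epsilon> y3) (\<Phi> (\<lambda>z1 z2 z3.
      \<iota> (x1 * J (ad (y1 * z1) a) * y2 * J (ad z2 b) * z3 * p)))))))"
    unfolding tensor_coact_sum_def counit_ad 1 2
    by (simp add: vs_simps[OF vs] counit_mult mult_ac)
  also have "\<dots> = \<Phi> (\<lambda>x1 x2 x3. tscale (\<epsilon> x3) (tscale (\<epsilon> x2) (\<Phi> (\<lambda>z1 z2 z3.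
      \<iota> (x1 * J (ad (1 * z1) a) * 1 * J (ad z2 b) * z3 * p)))))"
    by (subst reassoc_inv_counit(3)[where s = tscale]; (intro lin_intros)?) simp
  also have "\<dots> = tscale (\<epsilon> 1) (\<Phi> (\<lambda>z1 z2 z3.
      \<iota> (1 * J (ad (1 * z1) a) * 1 * J (ad z2 b) * z3 * p)))"
    by (subst reassoc_counit3[where s = tscale]; (intro lin_intros)?) simp
  finally show ?thesis
    by (simp add: counit_one vs_simps[OF vs] mult.assoc)
qed

lemma A_mult_eq: "A_mult H (\<iota> a) (\<iota> b) =
  \<iota> (\<Phi> (\<lambda>x1 x2 x3. \<Psi> (\<lambda>y1 y2 y3. \<DD> x3 (\<lambda>x31 x32.
    x1 * a * S (y1 * x2) * \<alpha> * y2 * x31 * b * S (y3 * x32)))))"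
proof -
  \<comment> \<open>\<open>C p\<close> is the first-kind coaction of \<open>p\<close> acting on the
    tensor of \<open>a\<close> and \<open>b\<close>. \<open>Z\<close> below is the corresponding
    second-kind coaction, that is, the unit of the adjunction at this tensor.\<close>
  define C where "C p = \<DD> p (\<lambda>h1 h2. tensor_coact_sum (ad h1 a) (ad h2 b)
    (\<lambda>u c d. pure H T u (pure A A (\<iota> c) (\<iota> d))))" for p
  define Z where "Z = sum2 H (pR H) (\<lambda>p1 p2. tlift H T (C p1) (\<lambda>g w. pure H T (g * p2) w))"
  have C: "C p \<in> carrier (tensor_space H T)" for p
    unfolding C_def by simp
  have Z: "Z \<in> carrier (tensor_space H T)"
    unfolding Z_def using C by (intro sum_closed tlift_closed) simp_all
  have bil: "bilinear_on H T tscale counit_T"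
    using bilinear_counit_T[OF lin_id] by simp
  have bil': "bilinear_on H T tscale (\<lambda>h w. counit_T (h * p) w)" for p
    by (rule bilinear_counit_T) (intro lin_intros)
  have ev: "tlift H T (pure H T u (pure A A (\<iota> c) (\<iota> d))) (\<lambda>h w. counit_T (h * p) w) =
    tscale (\<epsilon> c * \<epsilon> d) (\<iota> (u * p))" for u c d p
    by (subst tlift_pure[OF tscale_vector_space bil'])
      (simp_all add: counit_T_def counit_AA_pure pure_unit lin_scale[OF lin_iota[OF lin_id]])
  have "A_mult H (\<iota> a) (\<iota> b) = R_map H N \<kappa> (\<lambda>t. tlift \<kappa> \<kappa> t (*)) (R_map H T N (tmap A A \<kappa> \<kappa> \<epsilon>\<^sub>A \<epsilon>\<^sub>A) Z)"
    by (simp add: A_mult_def R2_def adj_unit_def tensor_yd_def hmod.defs ydmod.defs second_of_first_def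
        tensor_coact_first_A act_T Z_def C_def flip: A_obj_def)
  also have "\<dots> = tlift H T Z counit_T"
    by (rule R_map_counit[OF Z])
  also have "\<dots> = sum2 H (pR H) (\<lambda>p1 p2. tlift H T (tlift H T (C p1) (\<lambda>g w. pure H T (g * p2) w)) counit_T)"
    unfolding Z_def using C by (intro tlift_sum[OF tscale_vector_space bil] tlift_closed) simp_all
  also have "\<dots> = sum2 H (pR H) (\<lambda>p1 p2. tlift H T (C p1) (\<lambda>g w. tlift H T (pure H T (g * p2) w) counit_T))"
    using C by (intro sum2_cong tlift_tlift[OF tscale_vector_space bil]) simp_all
  also have "\<dots> = sum2 H (pR H) (\<lambda>p1 p2. tlift H T (C p1) (\<lambda>g w. counit_T (g * p2) w))"
    using C by (intro sum2_cong tlift_cong) (simp_all add: tlift_pure[OF tscale_vector_space bil])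
  \<comment> \<open>The fused counit map commutes with the Sweedler sums by linearity, so the
    counits reach the innermost tensors and \<open>tensor_coact_sum_counit\<close> applies.
    \<open>ad_ad\<close> merges the action of \<open>p1\<close> with that of the remaining
    reassociator.\<close>
  also have "\<dots> = sum2 H (pR H) (\<lambda>p1 p2. \<DD> p1 (\<lambda>h1 h2. \<Phi> (\<lambda>z1 z2 z3.
      \<iota> (J (ad (z1 * h1) a) * (J (ad (z2 * h2) b) * (z3 * p2))))))"
    unfolding C_def
    by (simp add: tlift_sum[OF tscale_vector_space bil'] tlift_tensor_coact_sum[OF tscale_vector_space bil']
        ev tensor_coact_sum_counit ad_ad)
  finally show ?thesis
    by (simp only: iota_sum flip: J_mult)
qed

end

lemma bij_iota: "bij_betw \<iota> UNIV (carrier A)"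
  using iota_inj unfolding bij_betw_def by (auto elim: iota_surj)

end

theorem theorem5p5:
  fixes H :: "('k::field, 'h::ring_1) quasi_hopf"
  assumes "quasi_hopf_algebra H"
    and "bij (antipode H)"
  defines "S \<equiv> antipode H"
    and "\<Delta> \<equiv> comult H"
    and "\<phi> \<equiv> reassoc H"
    and "\<phi>inv \<equiv> reassoc_inv H"
    and "\<iota> \<equiv> to_A H"
    and "A \<equiv> A_obj H"
  shows
    "bij_betw \<iota> UNIV (carrier A)
     \<and> (\<forall>a b. \<iota> (a + b) = \<iota> a + \<iota> b)
     \<and> (\<forall>c a. \<iota> (scale H c a) = scale A c (\<iota> a))
     \<and> (\<forall>h a. act A h (\<iota> a) = \<iota> (sum2 H (\<Delta> h) (\<lambda>h1 h2. h1 * a * S h2)))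
     \<and> (\<forall>a. coact_first H A (\<iota> a) =
          sum3 H \<phi> (\<lambda>x1 x2 x3. sum3 H \<phi> (\<lambda>y1 y2 y3.
          sum2 H (\<Delta> y1) (\<lambda>y11 y12. sum2 H (\<Delta> y2) (\<lambda>y21 y22.
          sum2 H (\<Delta> a) (\<lambda>a1 a2. sum2 H (f_inv H) (\<lambda>f1 f2. sum2 H (qR H) (\<lambda>q1 q2.
            pure H A (x1 * y11 * a1 * f1 * S (q2 * y22) * y3)
                     (\<iota> (x2 * y12 * a2 * f2 * S (x3 * q1 * y21)))))))))))
     \<and> (\<forall>a. coact A (\<iota> a) =
          sum3 H \<phi> (\<lambda>x1 x2 x3. sum3 H \<phi>inv (\<lambda>y1 y2 y3.
          sum2 H (\<Delta> y1) (\<lambda>y11 y12.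
          sum2 H (\<Delta> a) (\<lambda>a1 a2. sum2 H (f_inv H) (\<lambda>f1 f2.
            pure H A (x1 * y11 * a1 * f1 * S y3)
                     (\<iota> (x2 * y12 * a2 * f2 * S (x3 * y2)))))))))
     \<and> (\<forall>a b. A_mult H (\<iota> a) (\<iota> b) =
          \<iota> (sum3 H \<phi> (\<lambda>x1 x2 x3. sum3 H \<phi>inv (\<lambda>y1 y2 y3. sum2 H (\<Delta> x3) (\<lambda>x31 x32.
            x1 * a * S (y1 * x2) * alpha H * y2 * x31 * b * S (y3 * x32))))))
     \<and> A_one H = \<iota> (beta H)"
proof -
  interpret quasi_hopf_algebra H by fact
  have "\<iota> (a + b) = \<iota> a + \<iota> b" "\<iota> (scale H c a) = scale A c (\<iota> a)" for a b c
    using lin_iota[OF lin_id] by (simp_all add: lin_def \<iota>_def A_def)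
  then show ?thesis
    unfolding S_def \<Delta>_def \<phi>_def \<phi>inv_def \<iota>_def A_def
    using bij_iota act_A coact_first_A[OF assms(2)] coact_A A_mult_eq[OF assms(2)] A_one_eq by blast
qed

end
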